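(* Let $d=1$ and let $V(z,\omega)$, $z\in\mathbb{Z}$, be i.i.d. random variables on $(\Omega,\mathcal{F},\mathbb{P})$ such that $V(0,\omega)\in[0,\infty]$ a.s., $\mathbb{P}(V(0,\omega)=0)<1$, $\operatorname{ess\,inf}_{\omega\in\Omega}V(0,\omega)=0$, and $\mathbb{P}(V(0,\omega)\in(0,\infty))>0$. Then there exists a constant $v\in(0,1)$ such that $$\lim_{y\to\infty}\frac{E_{Q^0_y}(\tau_y)}{y}=\frac1v.$$ Moreover, $$\frac{d\beta_{\lambda+V}(1)}{d\lambda}\Big|_{\lambda=0+}=\frac1v.$$
   Context: $\mathbb{E}$ is expectation with respect to $\mathbb{P}$. $P^x$ is the law of the simple symmetric nearest-neighbor random walk $(S_n)_{n\ge0}$ on $\mathbb{Z}$ started at $x$ (independent of the environment), with expectation $E^x$; $\tau_y=\inf\{n\ge0:S_n=y\}$; $e^{-\infty}=0$. For $y\ne0$ the annealed path measure is $Q^0_y(A)=(Z^0_y)^{-1}\mathbb{E}E^0(\mathbf{1}_{\{\tau_y<\infty\}}\mathbf{1}_A e^{-\sum_{n=0}^{\tau_y-1}V(S_n,\omega)})$ with $Z^0_y=\mathbb{E}E^0(\mathbf{1}_{\{\tau_y<\infty\}}e^{-\sum_{n=0}^{\tau_y-1}V(S_n,\omega)})$, and $E_{Q^0_y}$ is its expectation. The annealed Lyapunov exponent is $\beta_V(1)=-\lim_{r\to\infty}\frac1r\log Z^0_{[r]}$ (the limit is known to exist), and $\beta_{\lambda+V}(1)$ is the same quantity for the potential $\lambda+V(z,\omega)$,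 $\lambda\ge0$. It is known that $\lambda\mapsto\beta_{\lambda+V}(1)$ is concave on $[0,\infty)$, so that its right derivative at $0$ exists. *)

theory Defs
  imports "HOL-Probability.Probability"
begin

section \<open>Simple random walk on the integers\<close>

definition path_space :: "(nat \<Rightarrow> int) measure" where
  "path_space = PiM UNIV (\<lambda>_. count_space UNIV)"

definition srw :: "int \<Rightarrow> (nat \<Rightarrow> int) measure" where
  "srw x = distr (PiM UNIV (\<lambda>_::nat. measure_pmf (pmf_of_set {-1, 1 :: int})))
             path_space (\<lambda>\<xi> n. x + (\<Sum>i<n. \<xi> i))"

text \<open>The infimum of the empty set in \<^typ>\<open>enat\<close> is \<open>\<infinity>\<close>.\<close>

definition hit_time :: "int \<Rightarrow> (nat \<Rightarrow> int) \<Rightarrow> enat" where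
  "hit_time y s = Inf (enat ` {n. s n = y})"

section \<open>The annealed path measure\<close>

text \<open>The function \<open>exp (- x)\<close> on the extended reals, with \<open>exp (- \<infinity>) = 0\<close>.
  Potentials are real random variables with values in \<^typ>\<open>ereal\<close>, which are assumed to be
  nonnegative only almost surely, so negative arguments occur only on a null set.\<close>

definition exp_minus :: "ereal \<Rightarrow> ennreal" where
  "exp_minus x = (if x = \<infinity> then 0 else if x = -\<infinity> then \<infinity> else ennreal (exp (- real_of_ereal x)))"

text \<open>The random weight \<open>1{\<tau>_y < \<infinity>} exp (- (\<Sum>n < \<tau>_y. V(S_n, \<omega>)))\<close>.\<close>

definition path_weight ::
  "(int \<Rightarrow> 'w \<Rightarrow> ereal) \<Rightarrow> int \<Rightarrow> 'w \<Rightarrow> (nat \<Rightarrow> int) \<Rightarrow> ennreal" where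
  "path_weight V y \<omega> s =
     (if hit_time y s < \<infinity> then exp_minus (\<Sum>n<the_enat (hit_time y s). V (s n) \<omega>) else 0)"

definition annealed_Z :: "'w measure \<Rightarrow> (int \<Rightarrow> 'w \<Rightarrow> ereal) \<Rightarrow> int \<Rightarrow> ennreal" where
  "annealed_Z M V y = (\<integral>\<^sup>+\<omega>. (\<integral>\<^sup>+s. path_weight V y \<omega> s \<partial>srw 0) \<partial>M)"

text \<open>The walk is independent of the environment, so the pair lives on the product space; the
  annealed measure is the path marginal of the reweighted product. The lemma
  \<open>emeasure_annealed_measure\<close> below gives its values as a double expectation.\<close>

definition annealed_measure ::
  "'w measure \<Rightarrow> (int \<Rightarrow> 'w \<Rightarrow> ereal) \<Rightarrow> int \<Rightarrow> (nat \<Rightarrow> int) measure" where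
  "annealed_measure M V y =
     distr (density (M \<Otimes>\<^sub>M srw 0) (\<lambda>(\<omega>, s). path_weight V y \<omega> s / annealed_Z M V y))
       path_space snd"

text \<open>The expectation of the hitting time is taken in \<^typ>\<open>ennreal\<close>, so that it is meaningful
  without knowing integrability in advance.\<close>

definition annealed_expected_hit_time ::
  "'w measure \<Rightarrow> (int \<Rightarrow> 'w \<Rightarrow> ereal) \<Rightarrow> int \<Rightarrow> ennreal" where
  "annealed_expected_hit_time M V y =
     (\<integral>\<^sup>+s. ennreal_of_enat (hit_time y s) \<partial>annealed_measure M V y)"

text \<open>The annealed Lyapunov exponent \<open>\<beta>_V(1)\<close>.\<close>

definition lyapunov :: "'w measure \<Rightarrow> (int \<Rightarrow> 'w \<Rightarrow> ereal) \<Rightarrow> real" where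
  "lyapunov M V = - Lim at_top (\<lambda>r::real. ln (enn2real (annealed_Z M V \<lfloor>r\<rfloor>)) / r)"

definition essinf :: "'w measure \<Rightarrow> ('w \<Rightarrow> ereal) \<Rightarrow> ereal" where
  "essinf M f = Sup {c. AE \<omega> in M. c \<le> f \<omega>}"

section \<open>Basic facts\<close>

lemma space_path_space [simp]: "space path_space = UNIV"
  by (auto simp: path_space_def space_PiM)

lemma sets_srw [simp, measurable_cong]: "sets (srw x) = sets path_space"
  by (simp add: srw_def)

lemma space_srw [simp]: "space (srw x) = UNIV"
  by (simp add: srw_def)

lemma measurable_path_component [measurable]: "(\<lambda>s. s n) \<in> path_space \<rightarrow>\<^sub>M count_space UNIV"
  unfolding path_space_def by (rule measurable_component_singleton) simp

lemma measurable_walk [measurable]: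
  "(\<lambda>\<xi> n. x + (\<Sum>i<n. \<xi> i)) \<in>
     PiM UNIV (\<lambda>_::nat. measure_pmf (p :: int pmf)) \<rightarrow>\<^sub>M path_space"
proof -
  have c [measurable]: "(\<lambda>\<xi>. \<xi> i) \<in>
      PiM UNIV (\<lambda>_::nat. measure_pmf p) \<rightarrow>\<^sub>M count_space UNIV" for i
    using measurable_component_singleton[of i UNIV "\<lambda>_. measure_pmf p"]
    by (simp cong: measurable_cong_sets)
  have "(\<lambda>\<xi>. \<Sum>i<n. \<xi> i) \<in>
      PiM UNIV (\<lambda>_::nat. measure_pmf p) \<rightarrow>\<^sub>M count_space UNIV" for n
    by (induction n) simp_all
  then show ?thesis
    unfolding path_space_def by (intro measurable_PiM_single') (auto simp: space_PiM)
qed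

lemma prob_space_srw: "prob_space (srw x)"
proof -
  interpret product_prob_space "\<lambda>_::nat. measure_pmf (pmf_of_set {-1, 1 :: int})" UNIV
    by unfold_locales
  show ?thesis
    unfolding srw_def by (rule prob_space_distr) (rule measurable_walk)
qed

lemma hit_time_le_enat_iff: "hit_time y s \<le> enat n \<longleftrightarrow> (\<exists>m\<le>n. s m = y)"
proof
  assume *: "hit_time y s \<le> enat n"
  have "enat ` {n. s n = y} \<noteq> {}"
  proof
    assume "enat ` {n. s n = y} = {}"
    then have "hit_time y s = \<infinity>"
      unfolding hit_time_def by (simp only: Inf_enat_def refl if_True)
    with * show False by simp
  qed
  then obtain k where "k \<in> enat ` {n. s n = y}" by blast
  then have "hit_time y s \<in> enat ` {n. s n = y}"
    unfolding hit_time_def by (rule wellorder_InfI)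
  with * show "\<exists>m\<le>n. s m = y" by auto
next
  assume "\<exists>m\<le>n. s m = y"
  then obtain m where "m \<le> n" "s m = y" by blast
  then show "hit_time y s \<le> enat n"
    unfolding hit_time_def by (intro Inf_lower2[of "enat m"]) auto
qed

lemma measurable_hit_time [measurable]: "hit_time y \<in> path_space \<rightarrow>\<^sub>M count_space UNIV"
proof (subst measurable_count_space_eq_countable, safe)
  fix a :: enat
  have le: "{s. hit_time y s \<le> enat n} \<in> sets path_space" for n
  proof -
    have "{s \<in> space path_space. \<exists>m\<le>n. s m = y} \<in> sets path_space" by measurable
    then show ?thesis by (simp add: hit_time_le_enat_iff)
  qed
  have fin: "{s. hit_time y s = enat n} \<in> sets path_space" for n
  proof (cases n)
    case 0
    with le[of 0] show ?thesis by (simp flip: zero_enat_def)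
  next
    case (Suc k)
    have "h = enat n \<longleftrightarrow> h \<le> enat n \<and> \<not> h \<le> enat k" for h
      using Suc by (cases h) auto
    then have "{s. hit_time y s = enat n} = {s. hit_time y s \<le> enat n} - {s. hit_time y s \<le> enat k}"
      by blast
    with le show ?thesis by auto
  qed
  show "hit_time y -` {a} \<inter> space path_space \<in> sets path_space"
  proof (cases a)
    case (enat n)
    with fin[of n] show ?thesis by (simp add: vimage_def)
  next
    case infinity
    have "hit_time y -` {\<infinity>} = UNIV - (\<Union>n. {s. hit_time y s = enat n})"
      by (auto simp: vimage_def)
    also have "\<dots> \<in> sets path_space"
      using fin sets.top[of path_space] by (intro sets.Diff) auto
    finally show ?thesis using infinity by simp
  qed
qed (auto)

lemma measurable_exp_minus [measurable]: "exp_minus \<in> borel_measurable borel"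
  unfolding exp_minus_def by measurable

lemma measurable_path_weight:
  assumes V: "\<And>z. V z \<in> borel_measurable M"
  shows "(\<lambda>(\<omega>, s). path_weight V y \<omega> s) \<in> borel_measurable (M \<Otimes>\<^sub>M path_space)"
proof -
  note V [measurable]
  have [measurable]: "(\<lambda>p. V (snd p n) (fst p)) \<in> borel_measurable (M \<Otimes>\<^sub>M path_space)" for n
    by (rule measurable_compose_countable[where g = "\<lambda>p. snd p n"]) measurable
  have "(\<lambda>p. exp_minus (\<Sum>n<the_enat (hit_time y (snd p)). V (snd p n) (fst p)))
      \<in> borel_measurable (M \<Otimes>\<^sub>M path_space)"
    by (rule measurable_compose_countable
        [where g = "\<lambda>p. the_enat (hit_time y (snd p))"
           and f = "\<lambda>k p. exp_minus (\<Sum>n<k. V (snd p n) (fst p))"]) measurable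
  then show ?thesis
    unfolding path_weight_def case_prod_beta by measurable
qed

lemma emeasure_annealed_measure:
  assumes V: "\<And>z. V z \<in> borel_measurable M" and A: "A \<in> sets path_space"
  shows "emeasure (annealed_measure M V y) A =
     (\<integral>\<^sup>+\<omega>. (\<integral>\<^sup>+s. path_weight V y \<omega> s * indicator A s \<partial>srw 0) \<partial>M) / annealed_Z M V y"
proof -
  interpret srw: prob_space "srw 0" by (rule prob_space_srw)
  have [measurable]: "(\<lambda>(\<omega>, s). path_weight V y \<omega> s) \<in> borel_measurable (M \<Otimes>\<^sub>M srw 0)"
    using measurable_path_weight[of V M y, OF V] by (simp cong: measurable_cong_sets sets_pair_measure_cong)
  note A [measurable]
  have snd: "snd \<in> M \<Otimes>\<^sub>M srw 0 \<rightarrow>\<^sub>M path_space"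
    using measurable_snd[of M "srw 0"] by (simp cong: measurable_cong_sets)
  have A': "snd -` A \<inter> space (M \<Otimes>\<^sub>M srw 0) \<in> sets (M \<Otimes>\<^sub>M srw 0)"
    using snd A by (rule measurable_sets)
  have "emeasure (annealed_measure M V y) A =
      (\<integral>\<^sup>+p. (case p of (\<omega>, s) \<Rightarrow> path_weight V y \<omega> s / annealed_Z M V y) *
         indicator (snd -` A \<inter> space (M \<Otimes>\<^sub>M srw 0)) p \<partial>(M \<Otimes>\<^sub>M srw 0))"
    unfolding annealed_measure_def using snd A A'
    by (subst emeasure_distr) (simp_all add: emeasure_density)
  also have "\<dots> = (\<integral>\<^sup>+p. (case p of (\<omega>, s) \<Rightarrow> path_weight V y \<omega> s * indicator A s)
       / annealed_Z M V y \<partial>(M \<Otimes>\<^sub>M srw 0))"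
    by (intro nn_integral_cong) (auto simp: divide_ennreal_def indicator_def split: prod.split)
  also have "\<dots> = (\<integral>\<^sup>+p. (case p of (\<omega>, s) \<Rightarrow> path_weight V y \<omega> s * indicator A s)
       \<partial>(M \<Otimes>\<^sub>M srw 0)) / annealed_Z M V y"
    by (rule nn_integral_divide) measurable
  also have "(\<integral>\<^sup>+p. (case p of (\<omega>, s) \<Rightarrow> path_weight V y \<omega> s * indicator A s) \<partial>(M \<Otimes>\<^sub>M srw 0))
      = (\<integral>\<^sup>+\<omega>. (\<integral>\<^sup>+s. path_weight V y \<omega> s * indicator A s \<partial>srw 0) \<partial>M)"
    by (subst srw.nn_integral_fst[symmetric]) measurable
  finally show ?thesis .
qed

end

theory Submission
  imports Defs "HOL-Library.Diagonal_Subsequence"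
begin

text \<open>Read from right to left, the numbers of down-steps across the bonds form a critical branching
  chain with one immigrant per generation, whose transition kernel \<open>p(a,b) = 2\<^sup>-\<^sup>(\<^sup>a\<^sup>+\<^sup>b\<^sup>+\<^sup>1\<^sup>) (a + b choose a)\<close>
  is symmetric. A site visited \<open>1 + a + b\<close> times contributes \<open>E exp (- (1 + a + b) V)\<close>, so that the
  annealed partition function is \<open>(K\<^sup>y G) 0\<close> for the symmetric, positive semidefinite kernel
  \<open>K(a,b) = p(a,b) E exp (- (1 + a + b) V)\<close> and some \<open>G \<le> 1\<close>; killing at rate \<open>t\<close> multiplies \<open>K\<close> by
  \<open>exp (- t (1 + a + b))\<close>. Semidefiniteness makes \<open>u\<^sub>n = (K\<^sup>n \<delta>\<^sub>0) 0\<close> log-convex, so \<open>u\<^sub>n\<^sub>+\<^sub>1 / u\<^sub>n\<close>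
  increases to a rate \<open>r\<close> and \<open>u\<^sub>n / r\<^sup>n\<close> decreases. Off a finite set \<open>K \<le> s p\<close> with \<open>s\<close> close to
  \<open>q = P(V = 0)\<close>, and \<open>q < r\<close> because \<open>p\<close> is recurrent (\<open>p\<^sup>n(0,0) = 1/(n+1)\<close> is not summable) while
  \<open>P(0 < V < \<infinity>) > 0\<close>. Hence \<open>K\<^sup>n \<delta>\<^sub>0\<close> is dominated by \<open>u\<^sub>n\<close> times a fixed rapidly decreasing function,
  \<open>u\<^sub>n / r\<^sup>n\<close> stays away from \<open>0\<close>, and \<open>K\<close> has a simple, rapidly decreasing eigenfunction \<open>h\<close>. As the
  hitting time is \<open>y\<close> plus twice the number of down-steps, its mean under the annealed measure grows like
  \<open>y (1 + 2 \<Sum> a h(a)\<^sup>2 / \<Sum> h(a)\<^sup>2)\<close>. First-order perturbation of \<open>r\<close> in the killing rate gives the same constant.\<close>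

section \<open>Nonnegative kernels on the natural numbers\<close>

text \<open>All analysis takes place among nonnegative functions in \<open>ennreal\<close>, where
  neither signed functions nor subtraction are at hand. Spectral theory is therefore replaced by
  three devices: log-convex bounded sequences are monotone, limits are exchanged with sums under one
  fixed majorant, and eigenfunctions at small killing rates are compared through diagonal
  subsequences. What shapes the estimates is uniformity: the majorant and the lower bound on the
  normalised return weights must not depend on n or on the killing rate near 0. Down-steps are not
  counted on paths. The line enters only through \<open>hit_mult\<close>, by which a walk to the
  right must pass every site in between; the kernel then arises from the continued fraction of the
  crossing weights. Likewise the mean hitting time is obtained as minus the derivative at 0 of the
  partition function in the killing rate. The boundary weight G depends on this rate as well; a
  contraction with factor E exp (- 2 V) < 1 shows that the dependence is Lipschitz, and the
  resulting error lacks the factor y and vanishes in the limit.\<close>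

definition ip :: "(nat \<Rightarrow> ennreal) \<Rightarrow> (nat \<Rightarrow> ennreal) \<Rightarrow> ennreal" where
  "ip f g = (\<integral>\<^sup>+a. f a * g a \<partial>count_space UNIV)"

definition kop :: "(nat \<Rightarrow> nat \<Rightarrow> ennreal) \<Rightarrow> (nat \<Rightarrow> ennreal) \<Rightarrow> nat \<Rightarrow> ennreal" where
  "kop k f a = (\<integral>\<^sup>+b. k a b * f b \<partial>count_space UNIV)"

lemma ip_commute: "ip f g = ip g f"
  by (simp add: ip_def mult.commute)

lemma ip_mono: "(\<And>a. f a \<le> f' a) \<Longrightarrow> (\<And>a. g a \<le> g' a) \<Longrightarrow> ip f g \<le> ip f' g'"
  unfolding ip_def by (intro nn_integral_mono mult_mono) auto

lemma ip_cmult_left: "ip (\<lambda>a. c * f a) g = c * ip f g"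
  by (simp add: ip_def mult.assoc nn_integral_cmult)

lemma ip_cmult_right: "ip f (\<lambda>a. c * g a) = c * ip f g"
  by (simp add: ip_cmult_left ip_commute[of f])

lemma ip_add_left: "ip (\<lambda>a. f a + f' a) g = ip f g + ip f' g"
  by (simp add: ip_def distrib_right nn_integral_add)

lemma ip_add_right: "ip f (\<lambda>a. g a + g' a) = ip f g + ip f g'"
  by (simp add: ip_add_left ip_commute[of f])

lemma ip_indicator_left [simp]: "ip (indicator {a}) f = f a"
  by (simp add: ip_def mult.commute)

lemma ip_indicator_right [simp]: "ip f (indicator {a}) = f a"
  by (simp add: ip_commute[of f])

lemma nn_integral_count_space_ge: "f a \<le> (\<integral>\<^sup>+a. f a \<partial>count_space UNIV)"
  by (rule nn_integral_ge_point) simp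

lemma ip_ge: "f a * g a \<le> ip f g"
  unfolding ip_def by (rule nn_integral_count_space_ge[where f = "\<lambda>a. f a * g a"])

lemma kop_eq_ip: "kop k f a = ip (k a) f"
  by (simp add: kop_def ip_def)

lemma kop_ge: "k a b * f b \<le> kop k f a"
  unfolding kop_eq_ip by (rule ip_ge)

lemma kop_indicator [simp]: "kop k (indicator {b}) a = k a b"
  by (simp add: kop_eq_ip)

lemma kop_cmult: "kop k (\<lambda>a. c * f a) = (\<lambda>a. c * kop k f a)"
  by (simp add: kop_eq_ip ip_cmult_right fun_eq_iff)

lemma kop_add: "kop k (\<lambda>a. f a + g a) = (\<lambda>a. kop k f a + kop k g a)"
  by (simp add: kop_eq_ip ip_add_right fun_eq_iff)

lemma kop_mono: "(\<And>a b. k a b \<le> k' a b) \<Longrightarrow> (\<And>a. f a \<le> f' a) \<Longrightarrow> kop k f a \<le> kop k' f' a"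
  unfolding kop_eq_ip by (rule ip_mono)

lemma kop_row_mono: "(\<And>b. k a b \<le> k' a b) \<Longrightarrow> (\<And>b. f b \<le> f' b) \<Longrightarrow> kop k f a \<le> kop k' f' a"
  unfolding kop_eq_ip by (rule ip_mono)

lemma kop_pow_cmult: "(kop k ^^ n) (\<lambda>a. c * f a) = (\<lambda>a. c * (kop k ^^ n) f a)"
  by (induction n) (simp_all add: kop_cmult)

lemma kop_pow_add: "(kop k ^^ n) (\<lambda>a. f a + g a) = (\<lambda>a. (kop k ^^ n) f a + (kop k ^^ n) g a)"
  by (induction n) (simp_all add: kop_add)

lemma kop_pow_mono:
  "(\<And>a b. k a b \<le> k' a b) \<Longrightarrow> (\<And>a. f a \<le> f' a) \<Longrightarrow> (kop k ^^ n) f a \<le> (kop k' ^^ n) f' a"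
  by (induction n arbitrary: a) (auto intro: kop_mono)

lemma nn_integral_count_space_swap:
  fixes f :: "nat \<Rightarrow> 'a \<Rightarrow> ennreal"
  assumes "\<And>a. f a \<in> borel_measurable N"
  shows "(\<integral>\<^sup>+a. (\<integral>\<^sup>+x. f a x \<partial>N) \<partial>count_space UNIV) = (\<integral>\<^sup>+x. (\<integral>\<^sup>+a. f a x \<partial>count_space UNIV) \<partial>N)"
  by (simp add: nn_integral_count_space_nat nn_integral_suminf assms)

lemma ip_kop:
  assumes "\<And>a b. k a b = k b a"
  shows "ip f (kop k g) = ip (kop k f) g"
proof -
  have "ip f (kop k g) = (\<integral>\<^sup>+a. \<integral>\<^sup>+b. f a * (k a b * g b) \<partial>count_space UNIV \<partial>count_space UNIV)"
    by (simp add: ip_def kop_def nn_integral_cmult)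
  also have "\<dots> = (\<integral>\<^sup>+b. \<integral>\<^sup>+a. f a * (k a b * g b) \<partial>count_space UNIV \<partial>count_space UNIV)"
    by (rule nn_integral_count_space_swap) simp
  also have "\<dots> = (\<integral>\<^sup>+b. \<integral>\<^sup>+a. k b a * f a * g b \<partial>count_space UNIV \<partial>count_space UNIV)"
    by (intro nn_integral_cong) (simp add: assms mult_ac)
  also have "\<dots> = ip (kop k f) g"
    by (simp add: ip_def kop_def nn_integral_multc)
  finally show ?thesis .
qed

lemma ip_kop_pow:
  assumes "\<And>a b. k a b = k b a"
  shows "ip f ((kop k ^^ n) g) = ip ((kop k ^^ n) f) g"
proof (induction n arbitrary: g)
  case (Suc n)
  have "ip f ((kop k ^^ Suc n) g) = ip f ((kop k ^^ n) (kop k g))"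
    by (simp add: funpow_swap1)
  also have "\<dots> = ip ((kop k ^^ Suc n) f) g"
    by (simp add: Suc ip_kop[OF assms])
  finally show ?case .
qed simp

lemma ip_Cauchy_Schwarz: "(ip f g)\<^sup>2 \<le> ip f f * ip g g"
  using Cauchy_Schwarz_nn_integral[of f "count_space UNIV" g]
  by (simp add: ip_def power2_eq_square)

text \<open>Quadratic forms of signed functions cannot be written in \<open>ennreal\<close>, so
  semidefiniteness is encoded by its consequence for nonnegative functions, the Cauchy-Schwarz
  inequality for the form.\<close>

definition psd_kernel :: "(nat \<Rightarrow> nat \<Rightarrow> ennreal) \<Rightarrow> bool" where
  "psd_kernel k \<longleftrightarrow> (\<forall>f g. (ip f (kop k g))\<^sup>2 \<le> ip f (kop k f) * ip g (kop k g))"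

text \<open>A mixture of rank-one kernels is a Gram kernel: its form is the inner product in L2(N)
  of \<open>ip f (\<phi> x)\<close> and \<open>ip g (\<phi> x)\<close>, to which Cauchy-Schwarz
  applies.\<close>

lemma psd_kernelI:
  fixes \<phi> :: "'x \<Rightarrow> nat \<Rightarrow> ennreal"
  assumes k: "\<And>a b. k a b = (\<integral>\<^sup>+x. \<phi> x a * \<phi> x b \<partial>N)"
    and [measurable]: "\<And>a. (\<lambda>x. \<phi> x a) \<in> borel_measurable N"
  shows "psd_kernel k"
proof -
  have m [measurable]: "(\<lambda>x. ip f (\<phi> x)) \<in> borel_measurable N" for f
    unfolding ip_def nn_integral_count_space_nat by measurable
  have *: "ip f (kop k g) = (\<integral>\<^sup>+x. ip f (\<phi> x) * ip g (\<phi> x) \<partial>N)" for f g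
  proof -
    have "kop k g a = (\<integral>\<^sup>+b. \<integral>\<^sup>+x. \<phi> x a * \<phi> x b * g b \<partial>N \<partial>count_space UNIV)" for a
      by (simp add: kop_def k nn_integral_multc)
    also have "\<dots> a = (\<integral>\<^sup>+x. \<integral>\<^sup>+b. \<phi> x a * \<phi> x b * g b \<partial>count_space UNIV \<partial>N)" for a
      by (rule nn_integral_count_space_swap) measurable
    also have "\<dots> a = (\<integral>\<^sup>+x. \<phi> x a * ip g (\<phi> x) \<partial>N)" for a
      by (simp add: ip_def mult.assoc nn_integral_cmult mult.commute[of "g _"])
    finally have kg: "kop k g a = (\<integral>\<^sup>+x. \<phi> x a * ip g (\<phi> x) \<partial>N)" for a .
    have "ip f (kop k g) = (\<integral>\<^sup>+a. \<integral>\<^sup>+x. f a * (\<phi> x a * ip g (\<phi> x)) \<partial>N \<partial>count_space UNIV)"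
      unfolding ip_def[of f "kop k g"] kg by (simp add: nn_integral_cmult)
    also have "\<dots> = (\<integral>\<^sup>+x. \<integral>\<^sup>+a. f a * (\<phi> x a * ip g (\<phi> x)) \<partial>count_space UNIV \<partial>N)"
      by (rule nn_integral_count_space_swap) measurable
    also have "\<dots> = (\<integral>\<^sup>+x. ip f (\<phi> x) * ip g (\<phi> x) \<partial>N)"
      by (simp add: ip_def[of f] nn_integral_multc flip: mult.assoc)
    finally show ?thesis .
  qed
  show ?thesis
    unfolding psd_kernel_def * using Cauchy_Schwarz_nn_integral[of "\<lambda>x. ip f (\<phi> x)" N "\<lambda>x. ip g (\<phi> x)" for f g]
    by (auto simp: power2_eq_square)
qed

text \<open>By symmetry the powers can be shared between the two arguments. For even n this leaves
  the plain inner product, for odd n one copy of \<open>k\<close> remains in the middle and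
  semidefiniteness is needed.\<close>

lemma ip_pow_log_convex:
  assumes sym: "\<And>a b. k a b = k b a" and psd: "psd_kernel k"
  shows "(ip f ((kop k ^^ Suc n) f))\<^sup>2 \<le> ip f ((kop k ^^ n) f) * ip f ((kop k ^^ Suc (Suc n)) f)"
proof -
  have split: "ip f ((kop k ^^ (i + j)) f) = ip ((kop k ^^ i) f) ((kop k ^^ j) f)" for i j
    by (simp add: funpow_add ip_kop_pow[OF sym])
  show ?thesis
  proof (cases "even n")
    case True
    then obtain m where n: "n = m + m" by (metis evenE mult_2)
    have "ip f ((kop k ^^ Suc n) f) = ip ((kop k ^^ m) f) ((kop k ^^ Suc m) f)"
      using split[of m "Suc m"] n by simp
    moreover have "ip f ((kop k ^^ n) f) = ip ((kop k ^^ m) f) ((kop k ^^ m) f)"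
      using split[of m m] n by simp
    moreover have "ip f ((kop k ^^ Suc (Suc n)) f) = ip ((kop k ^^ Suc m) f) ((kop k ^^ Suc m) f)"
      using split[of "Suc m" "Suc m"] n by simp
    ultimately show ?thesis
      by (metis ip_Cauchy_Schwarz)
  next
    case False
    then obtain m where n: "n = m + Suc m" by (metis oddE mult_2 add_Suc_right Suc_eq_plus1)
    have "ip f ((kop k ^^ Suc n) f) = ip ((kop k ^^ m) f) (kop k ((kop k ^^ Suc m) f))"
      using split[of m "Suc (Suc m)"] n by simp
    moreover have "ip f ((kop k ^^ n) f) = ip ((kop k ^^ m) f) (kop k ((kop k ^^ m) f))"
      using split[of m "Suc m"] n by simp
    moreover have "ip f ((kop k ^^ Suc (Suc n)) f) = ip ((kop k ^^ Suc m) f) (kop k ((kop k ^^ Suc m) f))"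
      using split[of "Suc m" "Suc (Suc m)"] n by simp
    ultimately show ?thesis
      using psd unfolding psd_kernel_def by metis
  qed
qed

text \<open>Ratios of a log-convex sequence increase, so a single ratio above 1 would force
  geometric growth past the bound.\<close>

lemma log_convex_bounded_decseq:
  fixes t :: "nat \<Rightarrow> real"
  assumes pos: "\<And>n. 0 < t n" and lc: "\<And>n. (t (Suc n))\<^sup>2 \<le> t n * t (Suc (Suc n))"
    and bd: "\<And>n. t n \<le> B"
  shows "decseq t"
proof (rule decseq_SucI, rule ccontr)
  fix N assume "\<not> t (Suc N) \<le> t N"
  define \<rho> where "\<rho> = t (Suc N) / t N"
  have \<rho>: "\<rho> > 1" using \<open>\<not> t (Suc N) \<le> t N\<close> pos[of N] by (simp add: \<rho>_def)
  have step: "\<rho> * t (N + j) \<le> t (Suc (N + j))" for j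
  proof (induction j)
    case 0 then show ?case using pos[of N] by (simp add: \<rho>_def)
  next
    case (Suc j)
    have "\<rho> * t (N + j) * t (Suc (N + j)) \<le> t (Suc (N + j)) * t (Suc (N + j))"
      using Suc pos by (intro mult_right_mono) (auto intro: less_imp_le)
    also have "\<dots> \<le> t (N + j) * t (Suc (Suc (N + j)))"
      using lc[of "N + j"] by (simp add: power2_eq_square)
    finally show ?case using pos[of "N + j"] by (simp add: mult_ac)
  qed
  have "\<rho> ^ j * t N \<le> t (N + j)" for j
  proof (induction j)
    case (Suc j)
    have "\<rho> ^ Suc j * t N \<le> \<rho> * t (N + j)" using Suc \<rho> by simp
    with step[of j] show ?case by simp
  qed simp
  then have "\<rho> ^ j \<le> B / t N" for j
    using bd[of "N + j"] pos[of N] by (metis le_divide_eq order_trans)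
  moreover obtain j where "B / t N < \<rho> ^ j" using real_arch_pow[OF \<rho>] by blast
  ultimately show False by (metis not_le)
qed

lemma kop_sum: "finite A \<Longrightarrow> kop k (\<lambda>a. \<Sum>i\<in>A. c i * f i a) a = (\<Sum>i\<in>A. c i * kop k (f i) a)"
proof (induction A rule: finite_induct)
  case empty
  then show ?case by (simp add: kop_def)
next
  case (insert i A)
  have "kop k (\<lambda>a. \<Sum>i\<in>insert i A. c i * f i a) a = kop k (\<lambda>a. c i * f i a + (\<Sum>i\<in>A. c i * f i a)) a"
    using insert by simp
  also have "\<dots> = kop k (\<lambda>a. c i * f i a) a + kop k (\<lambda>a. \<Sum>i\<in>A. c i * f i a) a"
    by (simp add: kop_add)
  finally show ?case using insert by (simp add: kop_cmult)
qed

section \<open>The negative binomial kernel\<close>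

text \<open>For fixed \<open>a\<close> this is the law of the number of tails before head number a +
  1 in fair coin tossing; in particular every row sums to 1.\<close>

definition pk :: "nat \<Rightarrow> nat \<Rightarrow> real" where
  "pk a b = real ((a + b) choose a) / 2 ^ (a + b + 1)"

abbreviation pe :: "nat \<Rightarrow> nat \<Rightarrow> ennreal" where
  "pe a b \<equiv> ennreal (pk a b)"

lemma pk_pos: "0 < pk a b"
  by (simp add: pk_def)

lemma pk_sym: "pk a b = pk b a"
  by (simp add: pk_def add.commute binomial_symmetric[of a "a + b"])

text \<open>This is the normalisation of the negative binomial law with success probability 1 -
  x.\<close>

lemma nn_integral_negative_binomial:
  assumes "0 \<le> x" "x < 1"
  shows "(\<integral>\<^sup>+b. ennreal (real ((a + b) choose a) * x ^ b) \<partial>count_space UNIV) = ennreal (1 / (1 - x) ^ (a + 1))"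
proof -
  have p: "1 - x \<in> {0<..1}" using assms by auto
  have "pmf (neg_binomial_pmf (Suc a) (1 - x)) b = (1 - x) ^ (a + 1) * (real ((a + b) choose a) * x ^ b)" for b
  proof -
    have "(b + a) choose b = (a + b) choose a"
      by (simp add: add.commute binomial_symmetric[of b "a + b"])
    then show ?thesis using p by (subst pmf_neg_binomial) auto
  qed
  then have "1 = (\<integral>\<^sup>+b. ennreal ((1 - x) ^ (a + 1) * (real ((a + b) choose a) * x ^ b)) \<partial>count_space UNIV)"
    using nn_integral_pmf[where p = "neg_binomial_pmf (Suc a) (1 - x)" and A = UNIV]
      measure_pmf.emeasure_space_1[of "neg_binomial_pmf (Suc a) (1 - x)"] by simp
  also have "\<dots> = ennreal ((1 - x) ^ (a + 1)) * (\<integral>\<^sup>+b. ennreal (real ((a + b) choose a) * x ^ b) \<partial>count_space UNIV)"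
    using assms by (simp add: ennreal_mult'' nn_integral_cmult)
  finally have "ennreal ((1 - x) ^ (a + 1)) * (\<integral>\<^sup>+b. ennreal (real ((a + b) choose a) * x ^ b) \<partial>count_space UNIV) = 1" ..
  then have "ennreal (1 / (1 - x) ^ (a + 1)) * (ennreal ((1 - x) ^ (a + 1)) *
      (\<integral>\<^sup>+b. ennreal (real ((a + b) choose a) * x ^ b) \<partial>count_space UNIV)) = ennreal (1 / (1 - x) ^ (a + 1))"
    by simp
  moreover have "ennreal (1 / (1 - x) ^ (a + 1)) * ennreal ((1 - x) ^ (a + 1)) = 1"
    using assms by (simp flip: ennreal_mult'')
  ultimately show ?thesis by (simp flip: mult.assoc)
qed

text \<open>Geometric functions stay geometric, up to a factor, under the Moebius map s -> 1 / (2 -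
  s). The same map drives the continued fraction of the crossing weights, see
  \<open>cross_weight_power\<close>.\<close>

lemma kop_pe_power:
  assumes "0 \<le> s" "s \<le> 1"
  shows "kop pe (\<lambda>b. ennreal (s ^ b)) a = ennreal ((1 / (2 - s)) ^ (a + 1))"
proof -
  have "kop pe (\<lambda>b. ennreal (s ^ b)) a =
      (\<integral>\<^sup>+b. ennreal (1 / 2 ^ (a + 1)) * ennreal (real ((a + b) choose a) * (s / 2) ^ b) \<partial>count_space UNIV)"
    unfolding kop_def using assms
    by (intro nn_integral_cong) (simp add: pk_def power_add power_divide field_simps flip: ennreal_mult'')
  also have "\<dots> = ennreal (1 / 2 ^ (a + 1)) * ennreal (1 / (1 - s / 2) ^ (a + 1))"
    using assms by (simp add: nn_integral_cmult nn_integral_negative_binomial)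
  also have "\<dots> = ennreal (1 / (2 ^ (a + 1) * (1 - s / 2) ^ (a + 1)))"
    using assms by (simp flip: ennreal_mult'')
  also have "2 ^ (a + 1) * (1 - s / 2) ^ (a + 1) = (2 - s) ^ (a + 1)"
    by (simp only: power_mult_distrib[symmetric]) (simp add: right_diff_distrib)
  finally show ?thesis by (simp add: power_divide)
qed

lemma kop_pe_const: "kop pe (\<lambda>_. c) = (\<lambda>_. c)"
  using kop_pe_power[of 1] kop_cmult[of pe c "\<lambda>_. 1"] by (simp add: fun_eq_iff)

text \<open>Geometric weights with mean \<open>n\<close>: up to a factor the kernel maps \<open>psi n\<close> to \<open>psi (n + 1)\<close>, which makes
  both its iterates and the supersolution \<open>SS\<close> below explicit.\<close>

definition psi :: "nat \<Rightarrow> nat \<Rightarrow> real" where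
  "psi n a = (real n / (real n + 1)) ^ a"

lemma psi_nonneg: "0 \<le> psi n a" and psi_le_1: "psi n a \<le> 1"
  by (auto simp: psi_def intro!: power_le_one)

lemma kop_pe_psi: "kop pe (\<lambda>b. ennreal (psi n b)) a = ennreal ((real n + 1) / (real n + 2) * psi (Suc n) a)"
proof -
  have "1 / (2 - real n / (real n + 1)) = real (Suc n) / (real (Suc n) + 1)"
    by (simp add: field_simps)
  moreover have "0 \<le> real n / (real n + 1)" "real n / (real n + 1) \<le> 1" by auto
  ultimately show ?thesis
    using kop_pe_power[of "real n / (real n + 1)" a]
    unfolding psi_def by (simp add: add_ac)
qed

text \<open>The induction starts from \<open>psi 0\<close>, which is the indicator of 0 because 0 ^
  0 = 1, and the factors (n + 1) / (n + 2) telescope.\<close>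

lemma kop_pe_pow_indicator: "(kop pe ^^ n) (indicator {0}) = (\<lambda>a. ennreal (psi n a / (real n + 1)))"
proof (induction n)
  case 0
  show ?case by (auto simp: psi_def fun_eq_iff indicator_def power_0_left)
next
  case (Suc n)
  have "(kop pe ^^ Suc n) (indicator {0}) = kop pe (\<lambda>a. ennreal (1 / (real n + 1)) * ennreal (psi n a))"
    by (simp add: Suc psi_nonneg field_simps flip: ennreal_mult'')
  also have "\<dots> = (\<lambda>a. ennreal (1 / (real n + 1)) * ennreal ((real n + 1) / (real n + 2) * psi (Suc n) a))"
    by (simp only: kop_cmult kop_pe_psi)
  also have "\<dots> = (\<lambda>a. ennreal (psi (Suc n) a / (real (Suc n) + 1)))"
  proof
    fix a
    have "1 / (real n + 1) * ((real n + 1) / (real n + 2) * psi (Suc n) a) = psi (Suc n) a / (real (Suc n) + 1)"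
      by (simp add: add_ac)
    then show "ennreal (1 / (real n + 1)) * ennreal ((real n + 1) / (real n + 2) * psi (Suc n) a)
        = ennreal (psi (Suc n) a / (real (Suc n) + 1))"
      by (metis ennreal_mult' divide_nonneg_nonneg zero_le_one add_nonneg_nonneg of_nat_0_le_iff)
  qed
  finally show ?case .
qed

definition SS :: "real \<Rightarrow> nat \<Rightarrow> ennreal" where
  "SS \<theta> a = (\<integral>\<^sup>+n. ennreal (\<theta> ^ n * psi n a) \<partial>count_space UNIV)"

lemma nn_integral_count_space_Suc_le:
  "(\<integral>\<^sup>+n. f (Suc n) \<partial>count_space UNIV) \<le> (\<integral>\<^sup>+n. f n \<partial>count_space UNIV)"
proof -
  have "(\<integral>\<^sup>+n. f (Suc n) \<partial>count_space UNIV) = (\<integral>\<^sup>+n. f n \<partial>count_space (Suc ` UNIV))"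
    by (rule nn_integral_bij_count_space) (simp add: bij_betw_def)
  also have "\<dots> = (\<integral>\<^sup>+n. f n * indicator (Suc ` UNIV) n \<partial>count_space UNIV)"
    by (subst nn_integral_count_space_indicator) auto
  also have "\<dots> \<le> (\<integral>\<^sup>+n. f n \<partial>count_space UNIV)"
    by (intro nn_integral_mono) (auto simp: indicator_def)
  finally show ?thesis .
qed

lemma SS_ge:
  "ennreal (\<theta> ^ n * psi n a) \<le> SS \<theta> a"
  unfolding SS_def by (rule nn_integral_count_space_ge[where f = "\<lambda>n. ennreal (\<theta> ^ n * psi n a)"])

text \<open>The kernel shifts the index of \<open>psi\<close> by one and the factor
  \<open>\<theta>\<close> shifts its coefficient, so the series is mapped below its own tail; the
  factors (n + 1) / (n + 2) only help.\<close>

lemma kop_pe_SS: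
  assumes "0 \<le> \<theta>"
  shows "ennreal \<theta> * kop pe (SS \<theta>) a \<le> SS \<theta> a"
proof -
  have "kop pe (SS \<theta>) a = (\<integral>\<^sup>+b. \<integral>\<^sup>+n. pe a b * ennreal (\<theta> ^ n * psi n b) \<partial>count_space UNIV \<partial>count_space UNIV)"
    by (simp add: kop_def SS_def nn_integral_cmult)
  also have "\<dots> = (\<integral>\<^sup>+n. \<integral>\<^sup>+b. pe a b * ennreal (\<theta> ^ n * psi n b) \<partial>count_space UNIV \<partial>count_space UNIV)"
    by (rule nn_integral_count_space_swap) simp
  also have "\<dots> = (\<integral>\<^sup>+n. ennreal (\<theta> ^ n) * kop pe (\<lambda>b. ennreal (psi n b)) a \<partial>count_space UNIV)"
  proof (intro nn_integral_cong)
    fix n :: nat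
    have "(\<integral>\<^sup>+b. pe a b * ennreal (\<theta> ^ n * psi n b) \<partial>count_space UNIV)
        = (\<integral>\<^sup>+b. ennreal (\<theta> ^ n) * (pe a b * ennreal (psi n b)) \<partial>count_space UNIV)"
      using assms by (intro nn_integral_cong) (simp add: ennreal_mult psi_nonneg mult_ac)
    then show "(\<integral>\<^sup>+b. pe a b * ennreal (\<theta> ^ n * psi n b) \<partial>count_space UNIV)
        = ennreal (\<theta> ^ n) * kop pe (\<lambda>b. ennreal (psi n b)) a"
      by (simp add: kop_def nn_integral_cmult)
  qed
  also have "\<dots> \<le> (\<integral>\<^sup>+n. ennreal (\<theta> ^ n) * ennreal (psi (Suc n) a) \<partial>count_space UNIV)"
    unfolding kop_pe_psi
    by (intro nn_integral_mono mult_left_mono ennreal_leI mult_left_le_one_le) (auto simp: psi_nonneg)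
  finally have "ennreal \<theta> * kop pe (SS \<theta>) a \<le> ennreal \<theta> * (\<integral>\<^sup>+n. ennreal (\<theta> ^ n) * ennreal (psi (Suc n) a) \<partial>count_space UNIV)"
    by (rule mult_left_mono) simp
  also have "\<dots> = (\<integral>\<^sup>+n. ennreal \<theta> * (ennreal (\<theta> ^ n) * ennreal (psi (Suc n) a)) \<partial>count_space UNIV)"
    by (simp add: nn_integral_cmult)
  also have "\<dots> = (\<integral>\<^sup>+n. ennreal (\<theta> ^ Suc n * psi (Suc n) a) \<partial>count_space UNIV)"
    using assms by (intro nn_integral_cong) (simp add: ennreal_mult psi_nonneg mult_ac)
  also have "\<dots> \<le> SS \<theta> a"
    unfolding SS_def by (rule nn_integral_count_space_Suc_le[where f = "\<lambda>n. ennreal (\<theta> ^ n * psi n a)"])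
  finally show ?thesis .
qed

lemma SS_le:
  assumes "0 \<le> \<theta>" "\<theta> < 1"
  shows "SS \<theta> a \<le> ennreal (1 / (1 - \<theta>))"
proof -
  have "SS \<theta> a \<le> (\<integral>\<^sup>+n. ennreal (real ((0 + n) choose 0) * \<theta> ^ n) \<partial>count_space UNIV)"
    unfolding SS_def using assms by (intro nn_integral_mono ennreal_leI) (auto simp: psi_le_1 mult_left_le)
  then show ?thesis using assms by (subst (asm) nn_integral_negative_binomial) auto
qed

lemma SS_pos': "0 < \<theta> \<Longrightarrow> 0 < SS \<theta> a"
proof -
  assume "0 < \<theta>"
  then have "0 < ennreal (\<theta> ^ 1 * psi 1 a)" by (simp add: psi_def)
  then show ?thesis using SS_ge[of \<theta> 1 a] by (rule less_le_trans)
qed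

text \<open>A finite first moment of the majorant is what makes the mean number of down-steps
  finite. The sum over a equals (n + 1)^2, and the bound by 2 (n + 2 choose 2) turns the sum over n
  into a negative binomial series.\<close>

lemma SS_weighted_sum:
  assumes "0 \<le> \<theta>" "\<theta> < 1"
  shows "(\<integral>\<^sup>+a. ennreal (1 + real a) * SS \<theta> a \<partial>count_space UNIV) \<le> ennreal (2 / (1 - \<theta>) ^ 3)"
proof -
  have "(\<integral>\<^sup>+a. ennreal (1 + real a) * SS \<theta> a \<partial>count_space UNIV) =
      (\<integral>\<^sup>+a. \<integral>\<^sup>+n. ennreal (1 + real a) * ennreal (\<theta> ^ n * psi n a) \<partial>count_space UNIV \<partial>count_space UNIV)"
    by (simp add: SS_def nn_integral_cmult)
  also have "\<dots> = (\<integral>\<^sup>+n. \<integral>\<^sup>+a. ennreal (1 + real a) * ennreal (\<theta> ^ n * psi n a) \<partial>count_space UNIV \<partial>count_space UNIV)"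
    by (rule nn_integral_count_space_swap) simp
  also have "\<dots> = (\<integral>\<^sup>+n. ennreal (\<theta> ^ n) * (\<integral>\<^sup>+a. ennreal (real ((1 + a) choose 1) * (real n / (real n + 1)) ^ a) \<partial>count_space UNIV) \<partial>count_space UNIV)"
  proof (intro nn_integral_cong)
    fix n :: nat
    have "(\<integral>\<^sup>+a. ennreal (1 + real a) * ennreal (\<theta> ^ n * psi n a) \<partial>count_space UNIV)
        = (\<integral>\<^sup>+a. ennreal (\<theta> ^ n) * ennreal (real ((1 + a) choose 1) * (real n / (real n + 1)) ^ a) \<partial>count_space UNIV)"
      using assms by (intro nn_integral_cong) (simp add: psi_def mult_ac ennreal_mult'[symmetric] del: ennreal_plus)
    then show "(\<integral>\<^sup>+a. ennreal (1 + real a) * ennreal (\<theta> ^ n * psi n a) \<partial>count_space UNIV)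
        = ennreal (\<theta> ^ n) * (\<integral>\<^sup>+a. ennreal (real ((1 + a) choose 1) * (real n / (real n + 1)) ^ a) \<partial>count_space UNIV)"
      by (simp add: nn_integral_cmult)
  qed
  also have "\<dots> = (\<integral>\<^sup>+n. ennreal (\<theta> ^ n) * ennreal ((real n + 1) ^ 2) \<partial>count_space UNIV)"
  proof (intro nn_integral_cong)
    fix n :: nat
    have "1 / (1 - real n / (real n + 1)) ^ (1 + 1) = (real n + 1) ^ 2"
      by (simp add: field_simps power2_eq_square)
    then show "ennreal (\<theta> ^ n) * (\<integral>\<^sup>+a. ennreal (real ((1 + a) choose 1) * (real n / (real n + 1)) ^ a) \<partial>count_space UNIV)
        = ennreal (\<theta> ^ n) * ennreal ((real n + 1) ^ 2)"
      by (subst nn_integral_negative_binomial) auto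
  qed
  also have "\<dots> \<le> (\<integral>\<^sup>+n. ennreal 2 * ennreal (real ((2 + n) choose 2) * \<theta> ^ n) \<partial>count_space UNIV)"
  proof (intro nn_integral_mono)
    fix n :: nat
    have "(real n + 1) ^ 2 \<le> 2 * real ((2 + n) choose 2)"
    proof -
      have "2 * ((2 + n) choose 2) = (n + 2) * (n + 1)"
        by (simp add: choose_two)
      then have "real (2 * ((2 + n) choose 2)) = real ((n + 2) * (n + 1))"
        by (simp only:)
      then show ?thesis by (simp add: power2_eq_square algebra_simps)
    qed
    then have "\<theta> ^ n * (real n + 1) ^ 2 \<le> \<theta> ^ n * (2 * real ((2 + n) choose 2))"
      using assms by (intro mult_left_mono) auto
    then show "ennreal (\<theta> ^ n) * ennreal ((real n + 1) ^ 2) \<le> ennreal 2 * ennreal (real ((2 + n) choose 2) * \<theta> ^ n)"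
      using assms by (subst (1 2) ennreal_mult[symmetric]) (auto intro!: ennreal_leI simp: mult_ac)
  qed
  also have "\<dots> = ennreal 2 * ennreal (1 / (1 - \<theta>) ^ (2 + 1))"
    using nn_integral_negative_binomial[OF assms, of 2] by (subst nn_integral_cmult) auto
  also have "\<dots> = ennreal (2 / (1 - \<theta>) ^ 3)"
    using assms by (subst ennreal_mult[symmetric]) (auto simp: numeral_eq_Suc)
  finally show ?thesis .
qed

text \<open>Discrete Duhamel expansion for a kernel that exceeds q p by at least
  \<open>\<epsilon>\<close> at (0, 0). The index j counts the steps of q p between \<open>a\<close>
  and the first use of this extra mass.\<close>

lemma kop_pow_lower_bound:
  assumes k: "\<And>a b. q * pe a b \<le> k a b" and k0: "q * pe 0 0 + \<epsilon> \<le> k 0 0"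
  shows "(\<Sum>j<n. \<epsilon> * q ^ j * (kop k ^^ (n - 1 - j)) (indicator {0}) 0 * (kop pe ^^ j) (indicator {0}) a)
    \<le> (kop k ^^ n) (indicator {0}) a"
proof (induction n arbitrary: a)
  case (Suc n)
  define x where "x n = (kop k ^^ n) (indicator {0})" for n
  define y where "y n = (kop pe ^^ n) (indicator {0})" for n
  have low: "q * kop pe f a + \<epsilon> * f 0 * indicator {0} a \<le> kop k f a" for f a
  proof -
    have "q * (\<integral>\<^sup>+b. pe a b * f b \<partial>count_space UNIV) + \<epsilon> * f 0 * indicator {0} a =
        (\<integral>\<^sup>+b. (q * pe a b + \<epsilon> * indicator {0} a * indicator {0} b) * f b \<partial>count_space UNIV)"
    proof -
      have "(\<integral>\<^sup>+b. (q * pe a b + \<epsilon> * indicator {0} a * indicator {0} b) * f b \<partial>count_space UNIV)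
          = (\<integral>\<^sup>+b. q * (pe a b * f b) + (\<epsilon> * indicator {0} a) * (f b * indicator {0} b) \<partial>count_space UNIV)"
        by (intro nn_integral_cong) (simp add: algebra_simps)
      also have "\<dots> = q * (\<integral>\<^sup>+b. pe a b * f b \<partial>count_space UNIV)
          + (\<epsilon> * indicator {0} a) * (\<integral>\<^sup>+b. f b * indicator {0} b \<partial>count_space UNIV)"
        by (subst nn_integral_add) (auto simp: nn_integral_cmult)
      finally show ?thesis by (simp add: kop_def mult_ac)
    qed
    also have "\<dots> \<le> kop k f a"
      unfolding kop_def using k k0
      by (intro nn_integral_mono mult_right_mono) (auto simp: indicator_def)
    finally show ?thesis by (simp add: kop_def)
  qed
  have "(\<Sum>j<Suc n. \<epsilon> * q ^ j * x (Suc n - 1 - j) 0 * y j a)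
      = \<epsilon> * x n 0 * indicator {0} a + (\<Sum>j<n. \<epsilon> * q ^ Suc j * x (n - 1 - j) 0 * y (Suc j) a)"
    by (subst sum.lessThan_Suc_shift) (simp add: y_def)
  also have "(\<Sum>j<n. \<epsilon> * q ^ Suc j * x (n - 1 - j) 0 * y (Suc j) a)
      = q * kop pe (\<lambda>a. \<Sum>j<n. \<epsilon> * q ^ j * x (n - 1 - j) 0 * y j a) a"
    by (subst kop_sum) (auto simp: sum_distrib_left y_def mult_ac)
  also have "\<dots> \<le> q * kop pe (x n) a"
    using Suc unfolding x_def y_def by (intro mult_left_mono kop_mono) auto
  finally have "(\<Sum>j<Suc n. \<epsilon> * q ^ j * x (Suc n - 1 - j) 0 * y j a) \<le> q * kop pe (x n) a + \<epsilon> * x n 0 * indicator {0} a"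
    by (simp add: add_ac)
  also have "\<dots> \<le> kop k (x n) a" by (rule low)
  finally show ?case by (simp add: x_def y_def)
qed simp

section \<open>Growth rate of the return weights\<close>

lemma tendsto_mult_ennreal:
  fixes f g :: "'a \<Rightarrow> ennreal"
  assumes f: "(f \<longlongrightarrow> l) F" and g: "(g \<longlongrightarrow> m) F" and l: "l < \<top>" and m: "m < \<top>"
  shows "((\<lambda>x. f x * g x) \<longlongrightarrow> l * m) F"
proof -
  have "((\<lambda>x. ennreal (enn2real (f x) * enn2real (g x))) \<longlongrightarrow> ennreal (enn2real l * enn2real m)) F"
    using f g l m by (intro tendsto_ennrealI tendsto_mult tendsto_enn2real) (auto simp: less_top)
  moreover have "\<forall>\<^sub>F x in F. ennreal (enn2real (f x) * enn2real (g x)) = f x * g x"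
    using order_tendstoD(2)[OF f l] order_tendstoD(2)[OF g m]
    by eventually_elim (simp add: ennreal_mult)
  ultimately have "((\<lambda>x. f x * g x) \<longlongrightarrow> ennreal (enn2real l * enn2real m)) F"
    by (blast intro: Lim_transform_eventually)
  then show ?thesis using l m by (simp add: ennreal_mult)
qed

text \<open>If \<open>D v n < 1\<close> for some \<open>n\<close>, repeated doubling makes \<open>v\<close> decay exponentially.\<close>

lemma doubling_lower_bound:
  fixes v :: "nat \<Rightarrow> real"
  assumes pos: "\<And>n. 0 < v n" and D: "0 < D" and v0: "v 0 = 1"
    and dbl: "\<And>n. v (n + n) \<le> D * (v n)\<^sup>2"
    and slow: "\<And>\<rho>. \<rho> < 1 \<Longrightarrow> 0 < \<rho> \<Longrightarrow> \<exists>k>0. \<forall>n. k * \<rho> ^ n \<le> v n"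
  shows "1 \<le> D * v n"
proof (rule ccontr)
  assume "\<not> 1 \<le> D * v n"
  define \<delta> where "\<delta> = D * v n"
  have \<delta>: "0 < \<delta>" "\<delta> < 1" using \<open>\<not> 1 \<le> D * v n\<close> pos[of n] D by (auto simp: \<delta>_def)
  have n: "n > 0"
  proof (rule ccontr)
    assume "\<not> n > 0"
    then show False using dbl[of 0] v0 \<open>\<not> 1 \<le> D * v n\<close> by simp
  qed
  have up: "D * v (2 ^ k * n) \<le> \<delta> ^ (2 ^ k)" for k
  proof (induction k)
    case (Suc k)
    have "D * v (2 ^ Suc k * n) \<le> D * (D * (v (2 ^ k * n))\<^sup>2)"
      using dbl[of "2 ^ k * n"] D by (intro mult_left_mono) (simp_all add: mult_2 distrib_right)
    also have "\<dots> = (D * v (2 ^ k * n))\<^sup>2" by (simp add: power2_eq_square)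
    also have "\<dots> \<le> (\<delta> ^ (2 ^ k))\<^sup>2" using Suc D pos by (intro power_mono) (auto intro: less_imp_le)
    finally show ?case by (simp add: power_mult[symmetric] mult.commute)
  qed (simp add: \<delta>_def)
  \<comment> \<open>By Bernoulli's inequality this choice gives
    \<open>\<rho> ^ n \<ge> (1 + \<delta>) / 2 > \<delta>\<close>, so the assumed lower bound of
    rate \<open>\<rho>\<close> overtakes the upper bound \<open>\<delta> ^ (2 ^ k)\<close> along the
    indices \<open>2 ^ k * n\<close>.\<close>
  define \<rho> where "\<rho> = 1 - (1 - \<delta>) / (2 * real n)"
  have \<rho>: "0 < \<rho>" "\<rho> < 1" using \<delta> n by (auto simp: \<rho>_def field_simps)
  have "1 + real n * (- ((1 - \<delta>) / (2 * real n))) \<le> (1 + - ((1 - \<delta>) / (2 * real n))) ^ n"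
    using \<rho> by (intro Bernoulli_inequality) (auto simp: \<rho>_def)
  moreover have "1 + real n * (- ((1 - \<delta>) / (2 * real n))) = (1 + \<delta>) / 2"
    using n by (simp add: field_simps)
  ultimately have "(1 + \<delta>) / 2 \<le> \<rho> ^ n" by (simp add: \<rho>_def)
  then have gt: "1 < \<rho> ^ n / \<delta>" using \<delta> by (simp add: field_simps)
  obtain k where k: "k > 0" "\<And>n. k * \<rho> ^ n \<le> v n" using slow[OF \<rho>(2,1)] by blast
  have "(\<rho> ^ n / \<delta>) ^ (2 ^ j) \<le> 1 / (D * k)" for j :: nat
  proof -
    have "D * (k * \<rho> ^ (2 ^ j * n)) \<le> \<delta> ^ (2 ^ j)"
      by (rule order_trans[OF _ up[of j]]) (use k(2)[of "2 ^ j * n"] D in simp)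
    then have "D * k * (\<rho> ^ n) ^ (2 ^ j) \<le> \<delta> ^ (2 ^ j)"
      by (simp add: power_mult[symmetric] mult_ac)
    then show ?thesis using D k(1) \<delta> by (simp add: power_divide field_simps)
  qed
  moreover obtain j where j: "1 / (D * k) < (\<rho> ^ n / \<delta>) ^ j" using real_arch_pow[OF gt] by blast
  moreover have "(\<rho> ^ n / \<delta>) ^ j \<le> (\<rho> ^ n / \<delta>) ^ (2 ^ j)"
    using gt by (intro power_increasing) (auto intro: less_imp_le less_exp)
  ultimately show False by (meson not_le order_less_le_trans)
qed

text \<open>The environment enters the kernel analysis only through the moments
  \<open>\<kappa> k\<close>, standing for E exp (- k V), and their limit \<open>q\<close>, standing
  for P(V = 0).\<close>

locale kernel_family =
  fixes \<kappa> :: "nat \<Rightarrow> real" and q :: real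
  assumes \<kappa>_pos: "0 < \<kappa> k" and \<kappa>_le_1: "\<kappa> k \<le> 1" and \<kappa>_decseq: "decseq \<kappa>"
    and \<kappa>_tendsto: "\<kappa> \<longlonglongrightarrow> q" and q_less: "q < \<kappa> 1"
    and psd: "0 \<le> t \<Longrightarrow>
      psd_kernel (\<lambda>a b. ennreal (exp (- t * real (1 + a + b)) * \<kappa> (1 + a + b) * pk a b))"
begin

definition K :: "real \<Rightarrow> nat \<Rightarrow> nat \<Rightarrow> ennreal" where
  "K t a b = ennreal (exp (- t * real (1 + a + b)) * \<kappa> (1 + a + b) * pk a b)"

definition x :: "real \<Rightarrow> nat \<Rightarrow> nat \<Rightarrow> ennreal" where
  "x t n = (kop (K t) ^^ n) (indicator {0})"

definition u :: "real \<Rightarrow> nat \<Rightarrow> real" where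
  "u t n = enn2real (x t n 0)"

text \<open>By log-convexity the ratios increase, so the supremum is also their limit. As a supremum
  of quantities continuous in the killing rate it is lower semicontinuous, which is one half of
  \<open>r_tendsto\<close>.\<close>

definition r :: "real \<Rightarrow> real" where
  "r t = (SUP n. u t (Suc n) / u t n)"

lemma q_nonneg: "0 \<le> q"
  using \<kappa>_tendsto \<kappa>_pos by (intro LIMSEQ_le_const) (auto intro: less_imp_le)

lemma q_le: "q \<le> \<kappa> k"
  using \<kappa>_tendsto \<kappa>_decseq by (rule decseq_ge[rotated])

lemma K_sym: "K t a b = K t b a"
  by (simp add: K_def pk_sym[of a b] add_ac)

lemma K_psd: "0 \<le> t \<Longrightarrow> psd_kernel (K t)"
  using psd[of t] by (simp add: K_def[abs_def])

lemma K_pos: "0 < K t a b"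
  by (simp add: K_def \<kappa>_pos pk_pos)

lemma K_less_top: "K t a b < \<top>"
  by (simp add: K_def)

lemma K_mono: "s \<le> t \<Longrightarrow> K t a b \<le> K s a b"
  unfolding K_def by (intro ennreal_leI mult_right_mono) (auto intro: less_imp_le[OF \<kappa>_pos] less_imp_le[OF pk_pos])

lemma K_le: "0 \<le> t \<Longrightarrow> K t a b \<le> ennreal (\<kappa> (1 + a + b)) * pe a b"
  unfolding K_def by (subst ennreal_mult[symmetric])
     (auto simp: less_imp_le[OF \<kappa>_pos] less_imp_le[OF pk_pos] intro!: mult_left_le_one_le
        ennreal_leI mult_right_mono)

lemma K_le_pe: "0 \<le> t \<Longrightarrow> K t a b \<le> pe a b"
proof -
  assume "0 \<le> t"
  then have "K t a b \<le> ennreal (\<kappa> (1 + a + b)) * pe a b" by (rule K_le)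
  also have "\<dots> \<le> 1 * pe a b" using \<kappa>_le_1 by (intro mult_right_mono) (auto simp: ennreal_le_1)
  finally show ?thesis by simp
qed

lemma kop_K_le_const: "0 \<le> t \<Longrightarrow> (\<And>a. f a \<le> c) \<Longrightarrow> (kop (K t) ^^ n) f a \<le> c"
proof (induction n arbitrary: a)
  case (Suc n)
  then have "(kop (K t) ^^ Suc n) f a \<le> kop pe (\<lambda>_. c) a"
    by (auto intro!: kop_mono K_le_pe)
  then show ?case by (simp add: kop_pe_const)
qed simp

lemma x_0: "x t 0 = indicator {0}"
  by (simp add: x_def)

lemma x_Suc: "x t (Suc n) = kop (K t) (x t n)"
  by (simp add: x_def)

lemma x_mono: "s \<le> t \<Longrightarrow> x t n a \<le> x s n a"
  unfolding x_def by (intro kop_pow_mono K_mono) auto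

lemma x_le_psi: "0 \<le> t \<Longrightarrow> x t n a \<le> ennreal (psi n a / (real n + 1))"
  using kop_pow_mono[of "K t" pe "indicator {0}" "indicator {0}" n a]
  by (simp add: x_def kop_pe_pow_indicator K_le_pe)

lemma x_le_1: "0 \<le> t \<Longrightarrow> x t n a \<le> 1"
  unfolding x_def by (rule kop_K_le_const) (auto simp: indicator_def)

lemma x_less_top: "0 \<le> t \<Longrightarrow> x t n a < \<top>"
  by (rule le_less_trans[OF x_le_1]) auto

lemma x_Suc_ge: "K t a b * x t n b \<le> x t (Suc n) a"
  unfolding x_Suc by (rule kop_ge)

lemma x_0_pos: "0 < x t n 0"
proof (induction n)
  case (Suc n)
  then have "0 < K t 0 0 * x t n 0" using K_pos[of t 0 0] by (simp add: ennreal_zero_less_mult_iff)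
  then show ?case using x_Suc_ge by (rule less_le_trans)
qed (simp add: x_0)

text \<open>Symmetry moves the m powers off the indicator of 0. With f that indicator this becomes
  the Chapman-Kolmogorov identity \<open>ip_x_x\<close>.\<close>

lemma ip_x: "ip (x t m) ((kop (K t) ^^ n) f) = (kop (K t) ^^ (m + n)) f 0"
proof -
  have "ip (x t m) ((kop (K t) ^^ n) f) = ip (indicator {0}) ((kop (K t) ^^ m) ((kop (K t) ^^ n) f))"
    unfolding x_def by (rule ip_kop_pow[OF K_sym, symmetric])
  then show ?thesis by (simp add: funpow_add)
qed

lemma ip_x_x: "ip (x t m) (x t n) = x t (m + n) 0"
  unfolding x_def[of t n] ip_x by (simp add: x_def)

lemma u_eq: "0 \<le> t \<Longrightarrow> ennreal (u t n) = x t n 0"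
  unfolding u_def by (intro ennreal_enn2real x_less_top)

lemma u_pos: "0 \<le> t \<Longrightarrow> 0 < u t n"
  unfolding u_def by (simp add: enn2real_positive_iff x_0_pos x_less_top)

lemma u_0: "u t 0 = 1"
  by (simp add: u_def x_0)

lemma u_le_1: "0 \<le> t \<Longrightarrow> u t n \<le> 1"
  using x_le_1[of t n 0] by (simp flip: u_eq add: ennreal_le_1)

lemma u_mono: "0 \<le> s \<Longrightarrow> s \<le> t \<Longrightarrow> u t n \<le> u s n"
  using x_mono[of s t n 0] u_pos[of s n] by (simp flip: u_eq add: ennreal_le_iff less_imp_le)

lemma u_log_convex:
  assumes t: "0 \<le> t"
  shows "(u t (Suc n))\<^sup>2 \<le> u t n * u t (Suc (Suc n))"
proof -
  have "(x t (Suc n) 0)\<^sup>2 \<le> x t n 0 * x t (Suc (Suc n)) 0"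
    using ip_pow_log_convex[OF K_sym K_psd[OF t], of "indicator {0}" n] by (simp add: x_def del: funpow.simps)
  then show ?thesis
    using t u_pos[OF t] by (simp flip: u_eq add: ennreal_power ennreal_mult[symmetric] less_imp_le)
qed

lemma u_decseq: "0 \<le> t \<Longrightarrow> decseq (u t)"
  using u_pos u_log_convex u_le_1 by (rule log_convex_bounded_decseq)

lemma u_ratio_incseq: "0 \<le> t \<Longrightarrow> incseq (\<lambda>n. u t (Suc n) / u t n)"
  using u_pos u_log_convex by (intro incseq_SucI) (simp add: field_simps power2_eq_square)

lemma u_ratio_le_1: "0 \<le> t \<Longrightarrow> u t (Suc n) / u t n \<le> 1"
  using u_pos[of t n] decseq_SucD[OF u_decseq, of t n] by simp

lemma u_ratio_le: "0 \<le> t \<Longrightarrow> u t (Suc n) / u t n \<le> r t"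
  unfolding r_def using u_ratio_le_1 by (intro cSUP_upper) (auto simp: bdd_above_def)

lemma u_ratio_tendsto: "0 \<le> t \<Longrightarrow> (\<lambda>n. u t (Suc n) / u t n) \<longlonglongrightarrow> r t"
  unfolding r_def using u_ratio_le_1 u_ratio_incseq by (intro LIMSEQ_incseq_SUP) (auto simp: bdd_above_def)

lemma r_pos: "0 \<le> t \<Longrightarrow> 0 < r t"
  using u_ratio_le[of t 0] u_pos[of t 0] u_pos[of t 1] by (auto intro: less_le_trans[rotated])

lemma r_le_1: "0 \<le> t \<Longrightarrow> r t \<le> 1"
  unfolding r_def by (intro cSUP_least u_ratio_le_1) auto

lemma u_Suc_le: "0 \<le> t \<Longrightarrow> u t (Suc n) \<le> r t * u t n"
  using u_ratio_le[of t n] u_pos[of t n] by (simp add: field_simps)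

lemma u_add_le: "0 \<le> t \<Longrightarrow> u t (m + n) \<le> r t ^ m * u t n"
proof (induction m)
  case (Suc m)
  have "u t (Suc m + n) \<le> r t * u t (m + n)" using u_Suc_le[of t "m + n"] Suc by simp
  also have "\<dots> \<le> r t * (r t ^ m * u t n)" using Suc r_pos[of t] by (intro mult_left_mono) auto
  finally show ?case by (simp add: mult_ac)
qed simp

lemma u_le_r_pow: "0 \<le> t \<Longrightarrow> u t n \<le> r t ^ n"
  using u_add_le[of t n 0] by (simp add: u_0)

definition v :: "real \<Rightarrow> nat \<Rightarrow> real" where
  "v t n = u t n / r t ^ n"

lemma v_pos: "0 \<le> t \<Longrightarrow> 0 < v t n"
  using u_pos r_pos by (simp add: v_def)

lemma v_le_1: "0 \<le> t \<Longrightarrow> v t n \<le> 1"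
  using u_le_r_pow[of t n] r_pos[of t] by (simp add: v_def)

lemma v_decseq: "0 \<le> t \<Longrightarrow> decseq (v t)"
  using u_Suc_le[of t] r_pos[of t] by (intro decseq_SucI) (simp add: v_def field_simps)

text \<open>Consecutive ratios of \<open>v t\<close> tend to 1, so from some index on they exceed
  \<open>\<rho>\<close>; the earlier terms are only larger, as \<open>v t\<close> decreases.\<close>

lemma v_slow:
  assumes t: "0 \<le> t" and \<rho>: "\<rho> < 1" "0 < \<rho>"
  shows "\<exists>k>0. \<forall>n. k * \<rho> ^ n \<le> v t n"
proof -
  have "\<rho> * r t < r t" using \<rho> r_pos[OF t] by simp
  then have "\<forall>\<^sub>F n in sequentially. \<rho> * r t < u t (Suc n) / u t n"
    using u_ratio_tendsto[OF t] by (rule order_tendstoD(1)[rotated])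
  then obtain N where N: "\<And>n. n \<ge> N \<Longrightarrow> \<rho> * r t < u t (Suc n) / u t n"
    by (auto simp: eventually_sequentially)
  have step: "\<rho> * v t n \<le> v t (Suc n)" if "n \<ge> N" for n
    using N[OF that] u_pos[OF t, of n] r_pos[OF t] by (simp add: v_def field_simps)
  have "v t N * \<rho> ^ n \<le> v t (N + n)" for n
  proof (induction n)
    case (Suc n)
    have "v t N * \<rho> ^ Suc n \<le> \<rho> * v t (N + n)" using Suc \<rho> by (simp add: mult_ac)
    also have "\<dots> \<le> v t (Suc (N + n))" by (rule step) simp
    finally show ?case by simp
  qed simp
  moreover have "v t (N + n) \<le> v t n" for n
    by (rule decseqD[OF v_decseq[OF t]]) simp
  ultimately have "\<forall>n. v t N * \<rho> ^ n \<le> v t n" by (meson order_trans)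
  then show ?thesis using v_pos[OF t] by blast
qed

end

section \<open>Spectral gap and domination\<close>

lemma ennreal_mult_left: "0 \<le> a \<Longrightarrow> 0 \<le> b \<Longrightarrow> ennreal a * (ennreal b * z) = ennreal (a * b) * z"
  by (simp add: ennreal_mult mult.assoc)

context kernel_family begin

text \<open>If \<open>r 0 \<le> q\<close>, then \<open>u\<^sub>n / q\<^sup>n\<close> would be decreasing, and the renewal inequality
  \<open>kop_pow_lower_bound\<close> would bound the harmonic series.\<close>

lemma q_less_r: "q < r 0"
proof (rule ccontr)
  assume "\<not> q < r 0"
  then have rq: "r 0 \<le> q" and q: "0 < q" using r_pos[of 0] by auto
  \<comment> \<open>The excess of \<open>K 0 0 0\<close> over q p(0,0), with p(0,0) = 1/2.\<close>
  define \<epsilon> where "\<epsilon> = (\<kappa> 1 - q) / 2"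
  have \<epsilon>: "0 < \<epsilon>" using q_less by (simp add: \<epsilon>_def)
  have k: "ennreal q * pe a b \<le> K 0 a b" for a b
    using q_le[of "1 + a + b"] pk_pos[of a b] q
    by (simp add: K_def ennreal_mult[symmetric] less_imp_le ennreal_leI)
  have k0: "ennreal q * pe 0 0 + ennreal \<epsilon> \<le> K 0 0 0"
  proof -
    have "ennreal q * pe 0 0 + ennreal \<epsilon> = ennreal (q * pk 0 0 + \<epsilon>)"
      using q \<epsilon> pk_pos[of 0 0] by (simp only: ennreal_mult[symmetric] ennreal_plus[symmetric] less_imp_le mult_nonneg_nonneg)
    also have "q * pk 0 0 + \<epsilon> = \<kappa> 1 * pk 0 0" by (simp add: pk_def \<epsilon>_def field_simps)
    finally show ?thesis by (simp add: K_def)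
  qed
  \<comment> \<open>Each of the j + 1 additional steps costs at least a factor q. Hence every term
    of the Duhamel sum at 0 is at least \<open>\<epsilon> / q * u 0 n / (j + 1)\<close>, and
    dividing by \<open>u 0 n\<close> leaves the harmonic sum.\<close>
  have udec: "u 0 n \<le> q ^ Suc j * u 0 (n - 1 - j)" if "j < n" for n j
  proof -
    have "u 0 (Suc j + (n - 1 - j)) \<le> r 0 ^ Suc j * u 0 (n - 1 - j)" by (rule u_add_le) simp
    also have "\<dots> \<le> q ^ Suc j * u 0 (n - 1 - j)"
      using rq r_pos[of 0] u_pos[of 0 "n - 1 - j"] by (intro mult_right_mono power_mono) (auto intro: less_imp_le)
    finally show ?thesis using that by simp
  qed
  have harm: "\<epsilon> / q * (\<Sum>j<n. 1 / (real j + 1)) \<le> 1" for n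
  proof -
    have "(\<Sum>j<n. ennreal (\<epsilon> * q ^ j * u 0 (n - 1 - j) * (1 / (real j + 1)))) =
        (\<Sum>j<n. ennreal \<epsilon> * ennreal q ^ j * x 0 (n - 1 - j) 0 * (kop pe ^^ j) (indicator {0}) 0)"
      using \<epsilon> q u_pos[of 0]
      by (intro sum.cong refl)
        (simp add: kop_pe_pow_indicator psi_def u_eq[symmetric] ennreal_mult[symmetric] ennreal_power less_imp_le)
    also have "\<dots> \<le> x 0 n 0"
      unfolding x_def by (rule kop_pow_lower_bound[OF k k0])
    also have "\<dots> = ennreal (u 0 n)" by (simp add: u_eq)
    finally have "(\<Sum>j<n. \<epsilon> * q ^ j * u 0 (n - 1 - j) * (1 / (real j + 1))) \<le> u 0 n"
      using \<epsilon> q u_pos[of 0] by (subst (asm) sum_ennreal) (auto simp: less_imp_le)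
    moreover have "(\<Sum>j<n. \<epsilon> / q * u 0 n * (1 / (real j + 1))) \<le>
        (\<Sum>j<n. \<epsilon> * q ^ j * u 0 (n - 1 - j) * (1 / (real j + 1)))"
    proof (intro sum_mono mult_right_mono)
      fix j assume "j \<in> {..<n}"
      then have "\<epsilon> / q * u 0 n \<le> \<epsilon> / q * (q ^ Suc j * u 0 (n - 1 - j))"
        using udec[of j n] \<epsilon> q by (intro mult_left_mono) auto
      then show "\<epsilon> / q * u 0 n \<le> \<epsilon> * q ^ j * u 0 (n - 1 - j)" using q by simp
    qed simp
    ultimately have "\<epsilon> / q * u 0 n * (\<Sum>j<n. 1 / (real j + 1)) \<le> u 0 n * 1"
      by (simp add: sum_distrib_left)
    then have "u 0 n * (\<epsilon> / q * (\<Sum>j<n. 1 / (real j + 1))) \<le> u 0 n * 1"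
      by (simp add: mult_ac)
    then show ?thesis using u_pos[of 0 n] by (simp only: mult_le_cancel_left_pos)
  qed
  have "summable (\<lambda>j. 1 / (real j + 1))"
  proof (rule summableI_nonneg_bounded)
    fix n
    show "(\<Sum>j<n. 1 / (real j + 1)) \<le> q / \<epsilon>" using harm[of n] q \<epsilon> by (simp add: field_simps)
  qed auto
  then have "summable (\<lambda>n. inverse (real (Suc n)))" by (simp add: inverse_eq_divide add_ac)
  then have "summable (\<lambda>n. inverse (real n))" by (subst (asm) summable_Suc_iff)
  then show False using not_summable_harmonic[where 'a = real] by (simp add: inverse_eq_divide)
qed

section \<open>Continuity in the killing rate\<close>

lemma K_tendsto: "S \<longlonglongrightarrow> s \<Longrightarrow> (\<lambda>i. K (S i) a b) \<longlonglongrightarrow> K s a b"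
  unfolding K_def by (intro tendsto_intros)

text \<open>Induction on n by dominated convergence: rows of p have mass 1 and dominate the rows of
  every K, and the iterates stay below 1.\<close>

lemma kop_pow_tendsto:
  assumes S: "\<And>i. 0 \<le> S i" "S \<longlonglongrightarrow> s" and f: "\<And>a. (\<lambda>i. f i a) \<longlonglongrightarrow> g a" and bd: "\<And>i a. f i a \<le> 1"
  shows "(\<lambda>i. (kop (K (S i)) ^^ n) (f i) a) \<longlonglongrightarrow> (kop (K s) ^^ n) g a"
proof (induction n arbitrary: a)
  case (Suc n)
  have le1: "(kop (K (S i)) ^^ n) (f i) b \<le> 1" for i b
    using S(1) bd by (rule kop_K_le_const)
  have le1': "(kop (K s) ^^ n) g b \<le> 1" for b
    by (rule LIMSEQ_le_const2[OF Suc]) (use le1 in auto)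
  have "(\<lambda>i. \<integral>\<^sup>+b. K (S i) a b * (kop (K (S i)) ^^ n) (f i) b \<partial>count_space UNIV)
      \<longlonglongrightarrow> (\<integral>\<^sup>+b. K s a b * (kop (K s) ^^ n) g b \<partial>count_space UNIV)"
  proof (rule nn_integral_dominated_convergence[where w = "\<lambda>b. pe a b"])
    show "AE b in count_space UNIV. K (S j) a b * (kop (K (S j)) ^^ n) (f j) b \<le> pe a b" for j
      using mult_mono[OF K_le_pe[OF S(1)[of j]] le1[of j], of a] by (intro AE_I2) simp
    show "(\<integral>\<^sup>+ b. pe a b \<partial>count_space UNIV) < \<infinity>"
      using fun_cong[OF kop_pe_const[of 1], of a] by (simp add: kop_def)
    show "AE b in count_space UNIV. (\<lambda>i. K (S i) a b * (kop (K (S i)) ^^ n) (f i) b) \<longlonglongrightarrow> K s a b * (kop (K s) ^^ n) g b"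
      using Suc S(2) le1' by (auto intro!: tendsto_mult_ennreal K_tendsto K_less_top le_less_trans[OF le1'])
  qed auto
  then show ?case by (simp only: kop_def[symmetric] funpow.simps comp_def)
qed (use f in simp)

lemma u_tendsto:
  assumes S: "\<And>i. 0 \<le> S i" "S \<longlonglongrightarrow> 0"
  shows "(\<lambda>i. u (S i) n) \<longlonglongrightarrow> u 0 n"
proof -
  have "(\<lambda>i. x (S i) n 0) \<longlonglongrightarrow> x 0 n 0"
    unfolding x_def by (rule kop_pow_tendsto[OF S]) (auto simp: indicator_def)
  then have "(\<lambda>i. ennreal (u (S i) n)) \<longlonglongrightarrow> ennreal (u 0 n)"
    using S(1) by (simp add: u_eq)
  then show ?thesis using S(1) u_pos by (subst (asm) tendsto_ennreal_iff) (auto simp: less_imp_le)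
qed

end

text \<open>The parameter \<open>s\<close> dominates the kernel off a finite set and \<open>\<rho>\<close> bounds the growth of the return
  weights from below, uniformly in the killing rate; their order is the spectral gap.\<close>

locale kernel_gap = kernel_family +
  fixes s \<rho> t0 :: real and M N :: nat
  assumes s_pos: "0 < s" and s_less: "s < \<rho>" and t0: "0 < t0" "t0 \<le> 1"
    and K_gap: "0 \<le> t \<Longrightarrow> M \<le> a \<Longrightarrow> K t a b \<le> ennreal s * pe a b"
    and u_gap: "0 \<le> t \<Longrightarrow> t \<le> t0 \<Longrightarrow> N \<le> n \<Longrightarrow> \<rho> * u t n \<le> u t (Suc n)"

text \<open>Choose q < s < \<open>\<rho>\<close> < r 0. At one index N the ratio of return weights
  exceeds \<open>\<rho>\<close> at rate 0, hence, by continuity, at all rates up to some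
  \<open>t0\<close>; as the ratios increase in n, this one index suffices for all later
  ones.\<close>

lemma (in kernel_family) ex_kernel_gap: "\<exists>s \<rho> t0 M N. kernel_gap \<kappa> q s \<rho> t0 M N"
proof -
  obtain s where s: "q < s" "s < r 0" using q_less_r dense by blast
  obtain \<rho> where \<rho>: "s < \<rho>" "\<rho> < r 0" using s dense by blast
  have "\<forall>\<^sub>F n in sequentially. \<kappa> n < s" using \<kappa>_tendsto s(1) by (rule order_tendstoD(2))
  then obtain M where M: "\<And>n. M \<le> n \<Longrightarrow> \<kappa> n < s" by (auto simp: eventually_sequentially)
  have "\<forall>\<^sub>F n in sequentially. \<rho> < u 0 (Suc n) / u 0 n"
    using u_ratio_tendsto[of 0] \<rho>(2) by (intro order_tendstoD(1)) auto
  then obtain N where N: "\<rho> < u 0 (Suc N) / u 0 N" by (auto simp: eventually_sequentially)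
  have "\<exists>t0. 0 < t0 \<and> t0 \<le> 1 \<and> (\<forall>t. 0 \<le> t \<and> t \<le> t0 \<longrightarrow> \<rho> < u t (Suc N) / u t N)"
  proof (rule ccontr)
    assume "\<not> ?thesis"
    then have "\<exists>t. 0 \<le> t \<and> t \<le> 1 / real (Suc i) \<and> \<not> \<rho> < u t (Suc N) / u t N" for i
      by (auto dest!: spec[of _ "1 / real (Suc i)"])
    then obtain S where S: "\<And>i. 0 \<le> S i" "\<And>i. S i \<le> 1 / real (Suc i)" "\<And>i. \<not> \<rho> < u (S i) (Suc N) / u (S i) N"
      by metis
    have S0: "S \<longlonglongrightarrow> 0"
      using S by (intro tendsto_sandwich[OF _ _ tendsto_const lim_1_over_n[THEN LIMSEQ_Suc]]) auto
    have "(\<lambda>i. u (S i) (Suc N) / u (S i) N) \<longlonglongrightarrow> u 0 (Suc N) / u 0 N"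
      using u_pos[of 0 N] by (intro tendsto_divide u_tendsto S S0) auto
    then have "\<forall>\<^sub>F i in sequentially. \<rho> < u (S i) (Suc N) / u (S i) N"
      using N by (rule order_tendstoD(1))
    then show False using S(3) by (auto simp: eventually_sequentially)
  qed
  then obtain t0 where t0: "0 < t0" "t0 \<le> 1" "\<And>t. 0 \<le> t \<Longrightarrow> t \<le> t0 \<Longrightarrow> \<rho> < u t (Suc N) / u t N"
    by blast
  have "kernel_gap \<kappa> q s \<rho> t0 M N"
  proof
    show "0 < s" using s q_nonneg by simp
    show "K t a b \<le> ennreal s * pe a b" if "0 \<le> t" "M \<le> a" for t a b
    proof -
      have "K t a b \<le> ennreal (\<kappa> (1 + a + b)) * pe a b" using that(1) by (rule K_le)
      also have "\<dots> \<le> ennreal s * pe a b"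
        using M[of "1 + a + b"] that(2) by (intro mult_right_mono ennreal_leI) auto
      finally show ?thesis .
    qed
    show "\<rho> * u t n \<le> u t (Suc n)" if "0 \<le> t" "t \<le> t0" "N \<le> n" for t n
    proof -
      have "\<rho> < u t (Suc N) / u t N" using that t0 by simp
      also have "\<dots> \<le> u t (Suc n) / u t n" using incseqD[OF u_ratio_incseq[OF that(1)] that(3)] .
      finally show ?thesis using u_pos[OF that(1), of n] by (simp add: field_simps)
    qed
  qed (use \<rho> t0 in auto)
  then show ?thesis by blast
qed

context kernel_gap begin

text \<open>Chosen so that s p W = \<open>\<rho> * (\<theta> p W) \<le> \<rho> W\<close>; thus W is
  a supersolution of growth \<open>\<rho>\<close> off the finite set.\<close>

definition \<theta> where "\<theta> = s / \<rho>"

lemma \<theta>: "0 < \<theta>" "\<theta> < 1"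
  using s_pos s_less by (auto simp: \<theta>_def)

abbreviation W :: "nat \<Rightarrow> ennreal" where "W \<equiv> SS \<theta>"

lemma W_pos: "0 < W a" by (rule SS_pos'[OF \<theta>(1)])

lemma W_less_top: "W a < \<top>"
  using SS_le[of \<theta> a] \<theta> by (simp add: le_less_trans)

lemma kop_W: "0 \<le> t \<Longrightarrow> M \<le> a \<Longrightarrow> kop (K t) W a \<le> ennreal \<rho> * W a"
proof -
  assume t: "0 \<le> t" and a: "M \<le> a"
  have "kop (K t) W a \<le> (\<integral>\<^sup>+b. ennreal s * (pe a b * W b) \<partial>count_space UNIV)"
    unfolding kop_def using mult_right_mono[OF K_gap[OF t a]]
    by (intro nn_integral_mono) (simp add: mult.assoc[symmetric])
  also have "\<dots> = ennreal s * kop pe W a" by (simp add: kop_def nn_integral_cmult)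
  also have "\<dots> = ennreal \<rho> * (ennreal \<theta> * kop pe W a)"
    using s_pos s_less \<theta> by (subst ennreal_mult_left) (auto simp: \<theta>_def)
  also have "\<dots> \<le> ennreal \<rho> * W a" using kop_pe_SS[of \<theta> a] \<theta> by (intro mult_left_mono) auto
  finally show ?thesis .
qed

lemma \<rho>_le_r: "0 \<le> t \<Longrightarrow> t \<le> t0 \<Longrightarrow> \<rho> \<le> r t"
  using order_trans[OF u_gap[of t N] u_Suc_le[of t N]] u_pos[of t N] by simp

text \<open>W acts as a barrier in an induction starting at n = N. For a >= M, \<open>kop_W\<close>
  and \<open>u_gap\<close> carry the bound from n to n + 1. For a < M one more step returns to 0, so
  \<open>K t 0 a * x t n a\<close> is at most a return weight.\<close>

lemma x_dominated:
  obtains C where "0 < C" "\<And>t n a. 0 \<le> t \<Longrightarrow> t \<le> t0 \<Longrightarrow> x t n a \<le> ennreal (C * u t n) * W a"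
proof -
  define w where "w a = enn2real (W a)" for a
  have w: "0 < w a" "W a = ennreal (w a)" for a
    using W_pos[of a] W_less_top[of a] by (auto simp: w_def enn2real_positive_iff)
  define k where "k a = enn2real (K 1 0 a)" for a
  have k: "0 < k a" "K 1 0 a = ennreal (k a)" for a
    using K_pos[of 1 0 a] K_less_top[of 1 0 a] by (auto simp: k_def enn2real_positive_iff)
  \<comment> \<open>\<open>C1\<close> serves the times n <= N and \<open>C2\<close> the sites a < M.
    Both are computed at killing rate 1, where \<open>u\<close> and \<open>K\<close> are smallest on
    [0, 1], hence they work for all t <= t0.\<close>
  define C1 where "C1 = (\<Sum>n\<le>N. 1 / (\<theta> ^ n * u 1 n))"
  define C2 where "C2 = (\<Sum>a<M. 1 / (k a * w a))"
  define C where "C = C1 + C2"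
  have C1: "0 < C1" unfolding C1_def using \<theta> u_pos[of 1] by (intro sum_pos) auto
  have C2: "0 \<le> C2" unfolding C2_def using k w by (intro sum_nonneg) (simp add: less_imp_le)
  have C1': "1 \<le> C1 * (\<theta> ^ n * u 1 n)" if "n \<le> N" for n
  proof -
    have "1 / (\<theta> ^ n * u 1 n) \<le> C1"
      unfolding C1_def using that \<theta> u_pos[of 1]
      by (intro member_le_sum[where f = "\<lambda>n. 1 / (\<theta> ^ n * u 1 n)"]) (auto simp: less_imp_le)
    then show ?thesis using \<theta> u_pos[of 1 n] by (simp add: field_simps)
  qed
  have C2': "1 \<le> C2 * (k a * w a)" if "a < M" for a
  proof -
    have "1 / (k a * w a) \<le> C2"
      unfolding C2_def using that k w
      by (intro member_le_sum[where f = "\<lambda>a. 1 / (k a * w a)"]) (auto simp: less_imp_le)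
    then show ?thesis using k(1)[of a] w(1)[of a] by (simp add: field_simps)
  qed
  show ?thesis
  proof (rule that[of C])
    show "0 < C" using C1 C2 by (simp add: C_def)
    fix t :: real and n a
    assume t: "0 \<le> t" "t \<le> t0"
    have small: "x t n a \<le> ennreal (C * u t n) * W a" if "n \<le> N" for n a
    proof -
      have "x t n a \<le> ennreal (psi n a / (real n + 1))" by (rule x_le_psi[OF t(1)])
      also have "\<dots> \<le> ennreal (psi n a)" using psi_nonneg[of n a] by (intro ennreal_leI) (simp add: field_simps)
      also have "\<dots> \<le> ennreal ((C * u t n) * (\<theta> ^ n * psi n a))"
      proof (rule ennreal_leI)
        have "u 1 n \<le> u t n" using t t0 by (intro u_mono) auto
        then have "C1 * (\<theta> ^ n * u 1 n) \<le> C * (\<theta> ^ n * u t n)"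
          using C1 C2 \<theta> u_pos[of 1 n] by (intro mult_mono) (auto simp: C_def less_imp_le)
        with C1'[OF that] have "1 \<le> C * u t n * \<theta> ^ n" by (simp add: mult_ac)
        from mult_right_mono[OF this psi_nonneg[of n a]]
        show "psi n a \<le> (C * u t n) * (\<theta> ^ n * psi n a)" by (simp add: mult_ac)
      qed
      also have "\<dots> = ennreal (C * u t n) * ennreal (\<theta> ^ n * psi n a)"
        using \<open>0 < C\<close> u_pos[OF t(1), of n] \<theta> by (intro ennreal_mult) (auto simp: psi_nonneg less_imp_le)
      also have "\<dots> \<le> ennreal (C * u t n) * W a"
        by (intro mult_left_mono SS_ge) auto
      finally show ?thesis .
    qed
    have "x t (N + j) a \<le> ennreal (C * u t (N + j)) * W a" for j a
    proof (induction j arbitrary: a)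
      case 0
      then show ?case using small[of N a] by simp
    next
      case (Suc j)
      define n where "n = N + j"
      show ?case
      proof (cases "M \<le> a")
        case True
        have "x t (Suc n) a \<le> kop (K t) (\<lambda>b. ennreal (C * u t n) * W b) a"
          unfolding x_Suc using Suc by (intro kop_mono) (auto simp: n_def)
        also have "\<dots> = ennreal (C * u t n) * kop (K t) W a" by (simp add: kop_cmult)
        also have "\<dots> \<le> ennreal (C * u t n) * (ennreal \<rho> * W a)"
          by (intro mult_left_mono kop_W t True) auto
        also have "\<dots> = ennreal (C * (\<rho> * u t n)) * W a"
          using \<open>0 < C\<close> s_pos s_less u_pos[OF t(1), of n]
          by (subst ennreal_mult_left) (auto simp: mult_ac less_imp_le)
        also have "\<dots> \<le> ennreal (C * u t (Suc n)) * W a"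
          using u_gap[OF t, of n] \<open>0 < C\<close> by (intro mult_right_mono ennreal_leI mult_left_mono) (auto simp: n_def)
        finally show ?thesis by (simp add: n_def)
      next
        case False
        have "ennreal (k a) * x t (Suc n) a \<le> K t 0 a * x t (Suc n) a"
          unfolding k(2)[symmetric] using t t0 by (intro mult_right_mono K_mono) auto
        also have "\<dots> \<le> x t (Suc (Suc n)) 0" by (rule x_Suc_ge)
        also have "\<dots> \<le> ennreal (u t (Suc n))"
          using decseq_SucD[OF u_decseq[OF t(1)], of "Suc n"] t(1) by (simp add: u_eq[symmetric] ennreal_leI)
        finally have 1: "ennreal (k a) * x t (Suc n) a \<le> ennreal (u t (Suc n))" .
        have "x t (Suc n) a = 1 * x t (Suc n) a" by simp
        also have "\<dots> \<le> ennreal (C2 * (k a * w a)) * x t (Suc n) a"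
          using C2'[of a] False by (intro mult_right_mono) (auto simp: ennreal_ge_1)
        also have "\<dots> = ennreal (C2 * w a) * (ennreal (k a) * x t (Suc n) a)"
          using C2 k(1)[of a] w(1)[of a] by (subst ennreal_mult_left) (auto simp: mult_ac less_imp_le)
        also have "\<dots> \<le> ennreal (C2 * w a) * ennreal (u t (Suc n))" by (intro mult_left_mono 1) auto
        also have "\<dots> \<le> ennreal (C * w a) * ennreal (u t (Suc n))"
          using C1 w(1)[of a] by (intro mult_right_mono ennreal_leI) (auto simp: C_def)
        also have "\<dots> = ennreal (C * u t (Suc n)) * W a"
          using \<open>0 < C\<close> w(1)[of a] u_pos[OF t(1), of "Suc n"]
          by (simp add: w(2) ennreal_mult[symmetric] mult_ac less_imp_le)
        finally show ?thesis by (simp add: n_def)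
      qed
    qed
    from this[of "n - N" a] small[of n a]
    show "x t n a \<le> ennreal (C * u t n) * W a" by (cases "n \<le> N") auto
  qed
qed

end

text \<open>The nonnegative difference g - f has integral 0 against a strictly positive weight;
  finiteness of the pairing is what permits the subtraction.\<close>

lemma ip_eq_imp_eq:
  assumes "\<And>a. f a \<le> g a" "\<And>a. 0 < w a" "\<And>a. w a < \<top>" "ip w f = ip w g" "ip w g < \<top>"
  shows "f = g"
proof
  fix a
  have "ip w f \<noteq> \<top>" using assms by simp
  then have "(\<integral>\<^sup>+a. w a * g a - w a * f a \<partial>count_space UNIV) = 0"
    using assms by (subst nn_integral_diff) (auto simp: ip_def intro!: mult_left_mono)
  then have "w a * g a - w a * f a = 0"
    by (subst (asm) nn_integral_0_iff_AE) (auto simp: AE_count_space)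
  moreover have "w a * g a < \<top>" using ip_ge[of w a g] assms(5) by (rule le_less_trans)
  ultimately have "w a * g a \<le> w a * f a"
    by (simp add: diff_eq_0_iff_ennreal less_top[symmetric])
  then have "g a \<le> f a"
    using assms(2,3)[of a] by (subst (asm) ennreal_mult_le_mult_iff) (auto simp: less_top[symmetric])
  then show "f a = g a" using assms(1)[of a] by (rule antisym[rotated])
qed

context kernel_gap begin

definition C :: real where
  "C = (SOME C. 0 < C \<and> (\<forall>t n a. 0 \<le> t \<longrightarrow> t \<le> t0 \<longrightarrow> x t n a \<le> ennreal (C * u t n) * W a))"

lemma C_pos: "0 < C" and x_le_W: "0 \<le> t \<Longrightarrow> t \<le> t0 \<Longrightarrow> x t n a \<le> ennreal (C * u t n) * W a"
proof -
  have "\<exists>C. 0 < C \<and> (\<forall>t n a. 0 \<le> t \<longrightarrow> t \<le> t0 \<longrightarrow> x t n a \<le> ennreal (C * u t n) * W a)"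
    using x_dominated by metis
  from someI_ex[OF this]
  show "0 < C" "0 \<le> t \<Longrightarrow> t \<le> t0 \<Longrightarrow> x t n a \<le> ennreal (C * u t n) * W a"
    unfolding C_def by blast+
qed

lemma W_weighted_sum: "(\<integral>\<^sup>+a. ennreal (1 + real a) * W a \<partial>count_space UNIV) < \<top>"
  using SS_weighted_sum[of \<theta>] \<theta> by (auto intro: le_less_trans)

lemma W_le: "W a \<le> ennreal (1 / (1 - \<theta>))"
  using SS_le[of \<theta> a] \<theta> by simp

lemma ip_W_finite:
  assumes "\<And>a. f a \<le> ennreal c * ennreal (1 + real a)"
  shows "ip W f < \<top>"
proof -
  have "ip W f \<le> (\<integral>\<^sup>+a. ennreal c * (ennreal (1 + real a) * W a) \<partial>count_space UNIV)"
    unfolding ip_def using mult_left_mono[OF assms, of "W _"] by (intro nn_integral_mono) (simp add: mult_ac)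
  also have "\<dots> < \<top>" using W_weighted_sum by (simp add: nn_integral_cmult ennreal_mult_less_top)
  finally show ?thesis .
qed

lemma ip_W_finite_bounded:
  assumes "\<And>a. f a \<le> ennreal c"
  shows "ip W f < \<top>"
proof (rule ip_W_finite[of _ c])
  fix a
  have "f a \<le> ennreal c * 1" using assms by simp
  also have "\<dots> \<le> ennreal c * ennreal (1 + real a)" by (intro mult_left_mono) (auto simp: ennreal_ge_1)
  finally show "f a \<le> ennreal c * ennreal (1 + real a)" .
qed

lemma ip_W_W: "ip W W < \<top>"
  by (rule ip_W_finite_bounded[OF W_le])

definition D :: real where "D = C\<^sup>2 * enn2real (ip W W)"

lemma D_pos: "0 < D"
proof -
  have "0 < W 0 * W 0" using W_pos[of 0] by (simp add: ennreal_zero_less_mult_iff)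
  also have "\<dots> \<le> ip W W" by (rule ip_ge)
  finally show ?thesis using C_pos ip_W_W by (simp add: D_def enn2real_positive_iff)
qed

text \<open>Since \<open>u t (n + n)\<close> is the pairing of \<open>x t n\<close> with itself,
  domination by \<open>C * u t n * W\<close> gives the doubling inequality with constant
  \<open>D\<close>. Slow decay then keeps \<open>v t\<close> above 1 / D.\<close>

lemma v_lower_bound:
  assumes t: "0 \<le> t" "t \<le> t0"
  shows "1 \<le> D * v t n"
proof (rule doubling_lower_bound[where v = "v t"])
  fix n
  have "ennreal (u t (n + n)) = ip (x t n) (x t n)" by (simp add: ip_x_x u_eq t)
  also have "\<dots> \<le> ip (\<lambda>a. ennreal (C * u t n) * W a) (\<lambda>a. ennreal (C * u t n) * W a)"
    using x_le_W[OF t] by (intro ip_mono)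
  also have "\<dots> = ennreal (C * u t n) * (ennreal (C * u t n) * ip W W)"
    by (simp only: ip_cmult_left ip_cmult_right)
  also have "ip W W = ennreal (enn2real (ip W W))" using ip_W_W by simp
  also have "ennreal (C * u t n) * (ennreal (C * u t n) * ennreal (enn2real (ip W W))) = ennreal (D * (u t n)\<^sup>2)"
    using C_pos u_pos[OF t(1), of n]
    by (subst ennreal_mult_left) (auto simp: D_def power2_eq_square ennreal_mult[symmetric] mult_ac less_imp_le)
  finally have "u t (n + n) \<le> D * (u t n)\<^sup>2"
    using D_pos by (subst (asm) ennreal_le_iff) auto
  then have "u t (n + n) / (r t ^ n)\<^sup>2 \<le> D * (u t n)\<^sup>2 / (r t ^ n)\<^sup>2"
    by (intro divide_right_mono) auto
  then show "v t (n + n) \<le> D * (v t n)\<^sup>2"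
    by (simp add: v_def power_divide power_add power2_eq_square)
qed (use t v_pos D_pos v_slow in \<open>auto simp: v_def u_0\<close>)

definition P :: "real \<Rightarrow> nat \<Rightarrow> nat \<Rightarrow> nat \<Rightarrow> ennreal" where
  "P t n a b = (kop (K t) ^^ n) (indicator {b}) a"

section \<open>Convergence of the normalised kernel powers\<close>

lemma ip_kop_K: "ip f (kop (K t) g) = ip (kop (K t) f) g"
  by (rule ip_kop) (rule K_sym)

lemma ip_kop_pow_K: "ip f ((kop (K t) ^^ n) g) = ip ((kop (K t) ^^ n) f) g"
  by (rule ip_kop_pow) (rule K_sym)

lemma P_sym: "P t n a b = P t n b a"
  using ip_kop_pow_K[where f = "indicator {a}" and g = "indicator {b}"] by (simp add: P_def)

lemma x_eq_P: "x t n a = P t n a 0"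
  by (simp add: x_def P_def)

lemma P_Suc: "P t (Suc n) a b = kop (K t) (\<lambda>a. P t n a b) a"
  by (simp add: P_def[abs_def])

lemma P_le_1: "0 \<le> t \<Longrightarrow> P t n a b \<le> 1"
  unfolding P_def by (rule kop_K_le_const) (auto simp: indicator_def)

lemma kop_pow_eq_P: "(kop (K t) ^^ n) f a = ip (P t n a) f"
proof -
  have "P t n a = (kop (K t) ^^ n) (indicator {a})"
    unfolding fun_eq_iff P_sym[of t n a] by (simp add: P_def)
  then show ?thesis
    using ip_kop_pow_K[where f = "indicator {a}" and g = f] by simp
qed

definition E :: "real \<Rightarrow> nat \<Rightarrow> nat \<Rightarrow> nat \<Rightarrow> ennreal" where
  "E t n a b = ennreal (1 / r t ^ n) * P t n a b"

lemma E_sym: "E t n a b = E t n b a"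
  by (simp add: E_def P_sym[of t n a b])

lemma E_Suc: "0 \<le> t \<Longrightarrow> E t (Suc n) a b = ennreal (1 / r t) * kop (K t) (\<lambda>a. E t n a b) a"
proof -
  assume "0 \<le> t"
  then have "ennreal (1 / r t ^ Suc n) = ennreal (1 / r t) * ennreal (1 / r t ^ n)"
    using r_pos[of t] by (simp add: ennreal_mult[symmetric])
  then show ?thesis by (simp add: E_def P_Suc kop_cmult mult.assoc)
qed

lemma E_0_0: "0 \<le> t \<Longrightarrow> E t n 0 0 = ennreal (v t n)"
  using r_pos[of t] u_pos[of t n] by (simp add: E_def x_eq_P[symmetric] u_eq[symmetric] v_def ennreal_mult[symmetric] less_imp_le)

lemma E_le_W:
  assumes t: "0 \<le> t" "t \<le> t0"
  shows "E t n a 0 \<le> ennreal C * W a"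
proof -
  have "E t n a 0 \<le> ennreal (1 / r t ^ n) * (ennreal (C * u t n) * W a)"
    unfolding E_def x_eq_P[symmetric] by (intro mult_left_mono x_le_W t) auto
  also have "\<dots> = ennreal (C * v t n) * W a"
    using r_pos[OF t(1)] C_pos u_pos[OF t(1), of n] by (subst ennreal_mult_left) (auto simp: v_def less_imp_le)
  also have "\<dots> \<le> ennreal C * W a"
    using v_le_1[OF t(1), of n] C_pos by (intro mult_right_mono ennreal_leI) auto
  finally show ?thesis .
qed

text \<open>Domination is known for the column of 0. Other columns are reached by one extra step
  between b and 0, which costs the factor \<open>K t 0 b\<close>.\<close>

lemma E_le_W':
  assumes t: "0 \<le> t" "t \<le> t0"
  shows "K t 0 b * E t n a b \<le> ennreal C * W a"
proof -
  have "K t 0 b * P t n a b = (kop (K t) ^^ n) (\<lambda>a. K t 0 b * indicator {b} a) a"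
    by (simp add: kop_pow_cmult P_def)
  also have "\<dots> \<le> (kop (K t) ^^ n) (kop (K t) (indicator {0})) a"
    by (intro kop_pow_mono) (auto simp: indicator_def K_sym[of t b 0])
  also have "\<dots> = P t (Suc n) a 0" by (simp add: P_def funpow_swap1)
  finally have "K t 0 b * E t n a b \<le> ennreal (1 / r t ^ n) * P t (Suc n) a 0"
    unfolding E_def by (subst mult.left_commute) (rule mult_left_mono, auto)
  also have "\<dots> = ennreal (r t) * E t (Suc n) a 0"
    using r_pos[OF t(1)] by (simp add: E_def ennreal_mult_left)
  also have "\<dots> \<le> 1 * (ennreal C * W a)"
    using r_le_1[OF t(1)] by (intro mult_mono E_le_W t) (auto simp: ennreal_le_1)
  finally show ?thesis by simp
qed

lemma E_le_W'':
  assumes t: "0 \<le> t" "t \<le> t0"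
  obtains k where "0 \<le> k" "\<And>n a. E t n a b \<le> ennreal k * W a"
proof
  define l where "l = enn2real (K t 0 b)"
  have l: "0 < l" "K t 0 b = ennreal l"
    using K_pos[of t 0 b] K_less_top[of t 0 b] by (auto simp: l_def enn2real_positive_iff)
  fix n a
  have "E t n a b = ennreal (1 / l) * (ennreal l * E t n a b)"
    using l by (subst ennreal_mult_left) auto
  also have "\<dots> \<le> ennreal (1 / l) * (ennreal C * W a)"
    using E_le_W'[OF t, of b n a] l by (intro mult_left_mono) auto
  also have "\<dots> = ennreal (1 / l * C) * W a" using l C_pos by (subst ennreal_mult_left) auto
  finally show "E t n a b \<le> ennreal (1 / l * C) * W a" .
  show "0 \<le> 1 / l * C" using l C_pos by simp
qed

text \<open>Diagonal forms are log-convex in n; normalised by r ^ n they are also bounded, hence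
  decreasing. The point with f a > 0 keeps them strictly positive.\<close>

lemma quadratic_form_tendsto:
  assumes t: "0 \<le> t" and fa: "0 < f a" and bd: "\<And>n. ip f ((kop (K t) ^^ n) f) \<le> ennreal (B * r t ^ n)"
  shows "convergent (\<lambda>n. enn2real (ip f ((kop (K t) ^^ n) f)) / r t ^ n)"
proof -
  define Q where "Q n = enn2real (ip f ((kop (K t) ^^ n) f))" for n
  have pos: "0 < (kop (K t) ^^ n) f a" for n
  proof (induction n)
    case (Suc n)
    have "0 < K t a a * (kop (K t) ^^ n) f a" using Suc K_pos[of t a a] by (simp add: ennreal_zero_less_mult_iff)
    also have "\<dots> \<le> (kop (K t) ^^ Suc n) f a" by (simp add: kop_ge)
    finally show ?case .
  qed (use fa in simp)
  have fin: "ip f ((kop (K t) ^^ n) f) < \<top>" for n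
    using bd[of n] by (rule le_less_trans) simp
  have Q: "ennreal (Q n) = ip f ((kop (K t) ^^ n) f)" for n
    unfolding Q_def by (rule ennreal_enn2real[OF fin])
  have Qpos: "0 < Q n" for n
  proof -
    have "0 < f a * (kop (K t) ^^ n) f a" using fa pos[of n] by (simp add: ennreal_zero_less_mult_iff)
    also have "\<dots> \<le> ip f ((kop (K t) ^^ n) f)" by (rule ip_ge)
    finally show ?thesis using fin[of n] by (simp add: Q_def enn2real_positive_iff)
  qed
  have lc: "(Q (Suc n))\<^sup>2 \<le> Q n * Q (Suc (Suc n))" for n
    using ip_pow_log_convex[OF K_sym K_psd[OF t], of f n] Qpos
    by (simp only: Q[symmetric] ennreal_power ennreal_mult[symmetric] less_imp_le)
      (auto simp: ennreal_le_iff less_imp_le)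
  have QB: "Q n \<le> B * r t ^ n" for n
  proof -
    have "ennreal (Q n) \<le> ennreal (B * r t ^ n)" using bd[of n] by (simp add: Q)
    then show ?thesis using Qpos[of n] by (auto simp: ennreal_le_iff2)
  qed
  have "decseq (\<lambda>n. Q n / r t ^ n)"
  proof (rule log_convex_bounded_decseq)
    show "0 < Q n / r t ^ n" for n using Qpos r_pos[OF t] by simp
    show "(Q (Suc n) / r t ^ Suc n)\<^sup>2 \<le> Q n / r t ^ n * (Q (Suc (Suc n)) / r t ^ Suc (Suc n))" for n
    proof -
      have "(Q (Suc n))\<^sup>2 / (r t ^ Suc n)\<^sup>2 \<le> Q n * Q (Suc (Suc n)) / (r t ^ Suc n)\<^sup>2"
        by (intro divide_right_mono lc) auto
      then show ?thesis by (simp add: power_divide power2_eq_square mult_ac)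
    qed
    show "Q n / r t ^ n \<le> B" for n using QB[of n] r_pos[OF t] by (simp add: field_simps)
  qed
  then have "convergent (\<lambda>n. Q n / r t ^ n)"
    using Qpos r_pos[OF t]
    by (intro Bseq_monoseq_convergent decseq_bounded[of _ 0]) (auto simp: decseq_imp_monoseq less_imp_le)
  then show ?thesis by (simp add: Q_def)
qed

text \<open>Monotonicity is available only for diagonal forms, so the entry (a, b) is recovered by
  polarisation from the forms of the indicators of a and b and of their sum.\<close>

lemma E_convergent:
  assumes t: "0 \<le> t" "t \<le> t0"
  shows "\<exists>l. l < \<top> \<and> (\<lambda>n. E t n a b) \<longlonglongrightarrow> l"
proof -
  define p where "p n a b = enn2real (P t n a b)" for n a b
  have p: "ennreal (p n a b) = P t n a b" for n a b
    unfolding p_def using P_le_1[OF t(1), of n a b] by (intro ennreal_enn2real) (auto intro: le_less_trans)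
  have pnn: "0 \<le> p n a b" for n a b by (simp add: p_def)
  have bd: "\<exists>B\<ge>0. \<forall>n. p n a b \<le> B * r t ^ n" for a b
  proof -
    obtain k where k: "0 \<le> k" "\<And>n a. E t n a b \<le> ennreal k * W a" using E_le_W''[OF t] by blast
    define B where "B = k * (1 / (1 - \<theta>))"
    have "p n a b \<le> B * r t ^ n" for n
    proof -
      have "ennreal (1 / r t ^ n) * ennreal (p n a b) \<le> ennreal k * ennreal (1 / (1 - \<theta>))"
        using k(2)[of n a] W_le[of a] unfolding p E_def by (meson mult_left_mono order_trans zero_le)
      then have "ennreal (1 / r t ^ n * p n a b) \<le> ennreal B"
        using k \<theta> r_pos[OF t(1)] pnn by (simp only: ennreal_mult[symmetric] B_def) (simp add: ennreal_mult[symmetric])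
      then show ?thesis using r_pos[OF t(1)] k \<theta> by (subst (asm) ennreal_le_iff) (auto simp: B_def field_simps)
    qed
    moreover have "0 \<le> B" using k \<theta> by (simp add: B_def)
    ultimately show ?thesis by blast
  qed
  have quad: "ip (\<lambda>c. indicator {a} c + indicator {b} c) ((kop (K t) ^^ n) (\<lambda>c. indicator {a} c + indicator {b} c))
      = ennreal (p n a a + 2 * p n a b + p n b b)" for n
  proof -
    have "p n b a = p n a b" by (simp add: p_def P_sym[of t n b a])
    then show ?thesis
      by (simp add: kop_pow_add ip_add_left ip_add_right P_def[symmetric] p[symmetric] pnn
          ennreal_plus[symmetric] del: ennreal_plus)
  qed
  have diag: "ip (indicator {a}) ((kop (K t) ^^ n) (indicator {a})) = ennreal (p n a a)" for n a
    by (simp add: p P_def)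
  have 1: "convergent (\<lambda>n. p n a a / r t ^ n)" for a
  proof -
    obtain B where "0 \<le> B" "\<And>n. p n a a \<le> B * r t ^ n" using bd by blast
    then have "convergent (\<lambda>n. enn2real (ip (indicator {a}) ((kop (K t) ^^ n) (indicator {a}))) / r t ^ n)"
      by (intro quadratic_form_tendsto[OF t(1), of _ a B]) (auto simp del: ip_indicator_left simp: diag ennreal_leI)
    then show ?thesis unfolding diag by (simp add: pnn)
  qed
  have 2: "convergent (\<lambda>n. (p n a a + 2 * p n a b + p n b b) / r t ^ n)"
  proof -
    obtain B1 where B1: "0 \<le> B1" "\<And>n. p n a a \<le> B1 * r t ^ n" using bd by blast
    obtain B2 where B2: "0 \<le> B2" "\<And>n. p n a b \<le> B2 * r t ^ n" using bd by blast
    obtain B3 where B3: "0 \<le> B3" "\<And>n. p n b b \<le> B3 * r t ^ n" using bd by blast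
    have "p n a a + 2 * p n a b + p n b b \<le> (B1 + 2 * B2 + B3) * r t ^ n" for n
      using B1(2)[of n] B2(2)[of n] B3(2)[of n] by (simp add: algebra_simps)
    then have "convergent (\<lambda>n. enn2real (ip (\<lambda>c. indicator {a} c + indicator {b} c)
        ((kop (K t) ^^ n) (\<lambda>c. indicator {a} c + indicator {b} c))) / r t ^ n)"
      by (intro quadratic_form_tendsto[OF t(1), of _ a "B1 + 2 * B2 + B3"]) (auto simp: quad ennreal_leI less_top add_pos_nonneg)
    then show ?thesis
      unfolding quad using pnn by (simp add: add_nonneg_nonneg del: ennreal_plus)
  qed
  obtain l1 l2 l3 where "(\<lambda>n. p n a a / r t ^ n) \<longlonglongrightarrow> l1" "(\<lambda>n. p n b b / r t ^ n) \<longlonglongrightarrow> l2"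
      "(\<lambda>n. (p n a a + 2 * p n a b + p n b b) / r t ^ n) \<longlonglongrightarrow> l3"
    using 1[of a] 1[of b] 2 by (auto simp: convergent_def)
  then have "(\<lambda>n. ((p n a a + 2 * p n a b + p n b b) / r t ^ n - p n a a / r t ^ n - p n b b / r t ^ n) / 2)
      \<longlonglongrightarrow> (l3 - l1 - l2) / 2"
    by (intro tendsto_intros) auto
  moreover have "((p n a a + 2 * p n a b + p n b b) / r t ^ n - p n a a / r t ^ n - p n b b / r t ^ n) / 2 = p n a b / r t ^ n" for n
    using r_pos[OF t(1)] by (simp add: field_simps)
  ultimately obtain l where "(\<lambda>n. p n a b / r t ^ n) \<longlonglongrightarrow> l" by auto
  then have "(\<lambda>n. ennreal (p n a b / r t ^ n)) \<longlonglongrightarrow> ennreal l" by (rule tendsto_ennrealI)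
  moreover have "ennreal (p n a b / r t ^ n) = E t n a b" for n
    using r_pos[OF t(1)] pnn by (simp add: E_def p[symmetric] ennreal_mult[symmetric])
  ultimately show ?thesis by (intro exI[of _ "ennreal l"]) auto
qed

section \<open>The eigenfunction\<close>

definition H :: "real \<Rightarrow> nat \<Rightarrow> nat \<Rightarrow> ennreal" where
  "H t a b = lim (\<lambda>n. E t n a b)"

abbreviation h :: "real \<Rightarrow> nat \<Rightarrow> ennreal" where
  "h t a \<equiv> H t a 0"

lemma E_tendsto:
  assumes "0 \<le> t" "t \<le> t0"
  shows "(\<lambda>n. E t n a b) \<longlonglongrightarrow> H t a b" and H_less_top: "H t a b < \<top>"
proof -
  obtain l where l: "l < \<top>" "(\<lambda>n. E t n a b) \<longlonglongrightarrow> l" using E_convergent[OF assms] by blast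
  then have "H t a b = l" unfolding H_def by (intro limI)
  with l show "(\<lambda>n. E t n a b) \<longlonglongrightarrow> H t a b" "H t a b < \<top>" by auto
qed

lemma H_sym: "H t a b = H t b a"
  by (simp add: H_def E_sym[of t _ a b])

lemma H_le_W:
  assumes t: "0 \<le> t" "t \<le> t0"
  obtains k where "0 \<le> k" "\<And>a. H t a b \<le> ennreal k * W a"
proof -
  obtain k where k: "0 \<le> k" "\<And>n a. E t n a b \<le> ennreal k * W a" using E_le_W''[OF t] by blast
  show ?thesis
    using k by (intro that[of k]) (auto intro!: LIMSEQ_le_const2[OF E_tendsto(1)[OF t]])
qed

lemma h_le_W: "0 \<le> t \<Longrightarrow> t \<le> t0 \<Longrightarrow> h t a \<le> ennreal C * W a"
  using E_le_W by (intro LIMSEQ_le_const2[OF E_tendsto(1)]) auto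

text \<open>Dominated convergence with majorant k W w. Since W has a finite first moment, the second
  factor may grow linearly.\<close>

lemma ip_tendsto:
  assumes f: "\<And>a. (\<lambda>n. f n a) \<longlonglongrightarrow> f' a" and g: "\<And>a. (\<lambda>n. g n a) \<longlonglongrightarrow> g' a"
    and fb: "\<And>n a. f n a \<le> ennreal k * W a" and gb: "\<And>n a. g n a \<le> w a"
    and w: "\<And>a. w a < \<top>" and fin: "ip W w < \<top>"
  shows "(\<lambda>n. ip (f n) (g n)) \<longlonglongrightarrow> ip f' g'"
  unfolding ip_def
proof (rule nn_integral_dominated_convergence[where w = "\<lambda>a. ennreal k * (W a * w a)"])
  show "AE a in count_space UNIV. f j a * g j a \<le> ennreal k * (W a * w a)" for j
    using mult_mono[OF fb gb] by (simp add: mult.assoc)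
  show "(\<integral>\<^sup>+ a. ennreal k * (W a * w a) \<partial>count_space UNIV) < \<infinity>"
    using fin by (simp add: nn_integral_cmult ip_def ennreal_mult_less_top)
  have f': "f' a \<le> ennreal k * W a" for a by (rule LIMSEQ_le_const2[OF f]) (use fb in auto)
  have g': "g' a \<le> w a" for a by (rule LIMSEQ_le_const2[OF g]) (use gb in auto)
  show "AE a in count_space UNIV. (\<lambda>n. f n a * g n a) \<longlonglongrightarrow> f' a * g' a"
    by (intro AE_I2 tendsto_mult_ennreal f g le_less_trans[OF f'] le_less_trans[OF g'])
      (simp_all add: ennreal_mult_less_top W_less_top w)
qed auto

lemma K_le_1: "0 \<le> t \<Longrightarrow> K t a b \<le> 1"
proof -
  assume t: "0 \<le> t"
  have "K t a b = kop (K t) (indicator {b}) a" by simp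
  also have "\<dots> \<le> 1" using kop_K_le_const[OF t, of "indicator {b}" 1 1] by (simp add: indicator_def)
  finally show ?thesis .
qed

lemma kop_tendsto:
  assumes t: "0 \<le> t" and f: "\<And>a. (\<lambda>n. f n a) \<longlonglongrightarrow> f' a" and fb: "\<And>n a. f n a \<le> ennreal k * W a"
  shows "(\<lambda>n. kop (K t) (f n) a) \<longlonglongrightarrow> kop (K t) f' a"
  unfolding kop_eq_ip ip_commute[of "K t a"]
  by (rule ip_tendsto[where w = "\<lambda>_. 1", OF f tendsto_const fb K_le_1[OF t]])
    (auto intro!: ip_W_finite_bounded[of _ 1])

lemma kop_H:
  assumes t: "0 \<le> t" "t \<le> t0"
  shows "kop (K t) (\<lambda>a. H t a b) a = ennreal (r t) * H t a b"
proof -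
  obtain k where k: "0 \<le> k" "\<And>n a. E t n a b \<le> ennreal k * W a" using E_le_W''[OF t] by blast
  have "(\<lambda>n. kop (K t) (\<lambda>a. E t n a b) a) \<longlonglongrightarrow> kop (K t) (\<lambda>a. H t a b) a"
    by (rule kop_tendsto[OF t(1) E_tendsto(1)[OF t] k(2)])
  moreover have "kop (K t) (\<lambda>a. E t n a b) a = ennreal (r t) * E t (Suc n) a b" for n
    using r_pos[OF t(1)] by (simp add: E_Suc[OF t(1)] ennreal_mult_left)
  moreover have "(\<lambda>n. ennreal (r t) * E t (Suc n) a b) \<longlonglongrightarrow> ennreal (r t) * H t a b"
    by (intro ennreal_tendsto_cmult LIMSEQ_Suc E_tendsto t) auto
  ultimately show ?thesis by (simp add: LIMSEQ_unique)
qed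

lemma kop_h: "0 \<le> t \<Longrightarrow> t \<le> t0 \<Longrightarrow> kop (K t) (h t) = (\<lambda>a. ennreal (r t) * h t a)"
  by (simp add: fun_eq_iff kop_H)

text \<open>The lower bound on \<open>v t\<close> keeps the limit from vanishing. As 1 / D is the
  same for all t, the bound also survives the passage t -> 0 in
  \<open>h_subseq_tendsto\<close>.\<close>

lemma h_0_ge: assumes t: "0 \<le> t" "t \<le> t0" shows "ennreal (1 / D) \<le> h t 0"
proof (rule LIMSEQ_le_const[OF E_tendsto(1)[OF t]])
  show "\<exists>N. \<forall>n\<ge>N. ennreal (1 / D) \<le> E t n 0 0"
  proof (intro exI allI impI)
    fix n
    have "1 / D \<le> v t n" using v_lower_bound[OF t, of n] D_pos by (simp add: field_simps)
    then show "ennreal (1 / D) \<le> E t n 0 0" by (simp add: E_0_0 t ennreal_leI)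
  qed
qed

lemma h_0_pos: "0 \<le> t \<Longrightarrow> t \<le> t0 \<Longrightarrow> 0 < h t 0"
  using h_0_ge[of t] D_pos by (auto intro: less_le_trans[rotated])

lemma pos_of_eigen:
  assumes "kop (K t) f = (\<lambda>a. ennreal c * f a)" "0 < f 0"
  shows "0 < f a"
proof -
  have "0 < K t a 0 * f 0" using assms(2) K_pos[of t a 0] by (simp add: ennreal_zero_less_mult_iff)
  also have "\<dots> \<le> kop (K t) f a" by (rule kop_ge)
  finally show ?thesis by (simp add: assms(1) ennreal_zero_less_mult_iff)
qed

lemma h_pos: "0 \<le> t \<Longrightarrow> t \<le> t0 \<Longrightarrow> 0 < h t a"
  by (rule pos_of_eigen[OF kop_h h_0_pos])

lemma ip_h_finite:
  assumes "0 \<le> t" "t \<le> t0" "ip W f < \<top>"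
  shows "ip (h t) f < \<top>"
proof -
  have "ip (h t) f \<le> ip (\<lambda>a. ennreal C * W a) f" by (intro ip_mono h_le_W assms) auto
  also have "\<dots> < \<top>" using assms(3) by (simp add: ip_cmult_left ennreal_mult_less_top)
  finally show ?thesis .
qed

text \<open>Two columns at time n pair to the entry (0, 0) at time 2n. This fixes the normalisation
  of \<open>h t\<close>, which later singles out the right multiple in limits of
  eigenfunctions.\<close>

lemma ip_h_h: assumes t: "0 \<le> t" "t \<le> t0" shows "ip (h t) (h t) = h t 0"
proof -
  have "(\<lambda>n. ip (\<lambda>a. E t n a 0) (\<lambda>a. E t n a 0)) \<longlonglongrightarrow> ip (h t) (h t)"
    by (rule ip_tendsto[where w = "\<lambda>a. ennreal C * W a", OF E_tendsto(1)[OF t] E_tendsto(1)[OF t] E_le_W[OF t] E_le_W[OF t]])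
      (use ip_W_W W_less_top in \<open>auto simp: ip_cmult_right ennreal_mult_less_top\<close>)
  moreover have "ip (\<lambda>a. E t n a 0) (\<lambda>a. E t n a 0) = E t (n + n) 0 0" for n
  proof -
    have "ip (\<lambda>a. P t n a 0) (\<lambda>a. P t n a 0) = P t (n + n) 0 0"
      using ip_x_x[of t n n] by (simp add: x_eq_P[abs_def])
    moreover have "ennreal (1 / r t ^ n) * ennreal (1 / r t ^ n) = ennreal (1 / r t ^ (n + n))"
      using r_pos[OF t(1)] by (simp add: ennreal_mult[symmetric] power_add)
    ultimately show ?thesis
      unfolding E_def by (simp only: ip_cmult_left ip_cmult_right mult.assoc[symmetric])
  qed
  moreover have "(\<lambda>n. E t (n + n) 0 0) \<longlonglongrightarrow> h t 0"
    using LIMSEQ_subseq_LIMSEQ[OF E_tendsto(1)[OF t], of "\<lambda>n. n + n" 0 0] by (simp add: strict_mono_def comp_def)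
  ultimately show ?thesis by (simp add: LIMSEQ_unique)
qed

text \<open>The maximum of two eigenfunctions is subharmonic; pairing with \<open>h\<close> shows that it is again an
  eigenfunction, and evaluation at \<open>0\<close> forces it to agree with both.\<close>

lemma eigen_unique_le:
  assumes t: "0 \<le> t" "t \<le> t0"
    and f: "kop (K t) f = (\<lambda>a. ennreal (r t) * f a)" and g: "kop (K t) g = (\<lambda>a. ennreal (r t) * g a)"
    and fb: "\<And>a. f a \<le> ennreal k * W a" and gb: "\<And>a. g a \<le> ennreal k * W a"
    and eq: "f 0 = g 0"
  shows "f = g"
proof -
  define m where "m a = max (f a) (g a)" for a
  have mb: "m a \<le> ennreal k * W a" for a using fb gb by (simp add: m_def)
  have fm: "f a \<le> m a" "g a \<le> m a" for a by (auto simp: m_def)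
  have "ip W m \<le> ip W (\<lambda>a. ennreal k * W a)" by (intro ip_mono mb) auto
  also have "\<dots> < \<top>" using ip_W_W by (simp add: ip_cmult_right ennreal_mult_less_top)
  finally have fin: "ip (h t) m < \<top>" by (rule ip_h_finite[OF t])
  have hr: "0 < h t a" "h t a < \<top>" for a using h_pos[OF t] H_less_top[OF t] by auto
  have 1: "(\<lambda>a. ennreal (r t) * m a) = kop (K t) m"
  proof (rule ip_eq_imp_eq[where w = "h t"])
    show "ennreal (r t) * m a \<le> kop (K t) m a" for a
    proof (cases "f a \<le> g a")
      case True
      then have "ennreal (r t) * m a = kop (K t) g a" by (simp add: m_def g max_def)
      also have "\<dots> \<le> kop (K t) m a" by (intro kop_mono fm) auto
      finally show ?thesis .
    next
      case False
      then have "ennreal (r t) * m a = kop (K t) f a" by (simp add: m_def f max_def)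
      also have "\<dots> \<le> kop (K t) m a" by (intro kop_mono fm) auto
      finally show ?thesis .
    qed
    show 2: "ip (h t) (\<lambda>a. ennreal (r t) * m a) = ip (h t) (kop (K t) m)"
      by (simp add: ip_kop_K kop_h[OF t] ip_cmult_left ip_cmult_right)
    show "ip (h t) (kop (K t) m) < \<top>"
      unfolding 2[symmetric] using fin by (simp add: ip_cmult_right ennreal_mult_less_top)
  qed (use hr in auto)
  have Kr: "0 < K t 0 a" "K t 0 a < \<top>" for a using K_pos K_less_top by auto
  have m0: "kop (K t) m 0 < \<top>"
    using mb[of 0] W_less_top[of 0] by (auto simp: 1[symmetric] ennreal_mult_less_top intro: le_less_trans)
  have "f = m"
  proof (rule ip_eq_imp_eq[where w = "K t 0"])
    show "ip (K t 0) f = ip (K t 0) m"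
      using fun_cong[OF f, of 0] fun_cong[OF 1, of 0] eq by (simp add: kop_eq_ip m_def)
    show "ip (K t 0) m < \<top>" using m0 by (simp add: kop_eq_ip)
  qed (use fm Kr in auto)
  moreover have "g = m"
  proof (rule ip_eq_imp_eq[where w = "K t 0"])
    show "ip (K t 0) g = ip (K t 0) m"
      using fun_cong[OF g, of 0] fun_cong[OF 1, of 0] eq by (simp add: kop_eq_ip m_def)
    show "ip (K t 0) m < \<top>" using m0 by (simp add: kop_eq_ip)
  qed (use fm Kr in auto)
  ultimately show ?thesis by simp
qed

lemma eigen_unique:
  assumes t: "0 \<le> t" "t \<le> t0"
    and f: "kop (K t) f = (\<lambda>a. ennreal (r t) * f a)" and fb: "\<And>a. f a \<le> ennreal k * W a"
  shows "f = (\<lambda>a. f 0 / h t 0 * h t a)"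
proof (rule eigen_unique_le[OF t f _ , where k = "max k (enn2real (f 0 / h t 0) * C)"])
  have "f 0 \<le> ennreal k * W 0" by (rule fb)
  also have "\<dots> < \<top>" using W_less_top[of 0] by (simp add: ennreal_mult_less_top)
  finally have f0: "f 0 < \<top>" .
  have fin: "f 0 / h t 0 < \<top>"
  proof -
    obtain y where "0 < y" "h t 0 = ennreal y"
      using h_0_pos[OF t] H_less_top[OF t, of 0 0] by (cases "h t 0") auto
    with f0 show ?thesis
      by (simp add: divide_ennreal_def inverse_ennreal ennreal_mult_less_top)
  qed
  show "kop (K t) (\<lambda>a. f 0 / h t 0 * h t a) = (\<lambda>a. ennreal (r t) * (f 0 / h t 0 * h t a))"
    by (simp add: kop_cmult kop_h[OF t] mult.left_commute)
  show "f a \<le> ennreal (max k (enn2real (f 0 / h t 0) * C)) * W a" for a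
    by (rule order_trans[OF fb]) (intro mult_right_mono ennreal_leI, auto)
  show "f 0 / h t 0 * h t a \<le> ennreal (max k (enn2real (f 0 / h t 0) * C)) * W a" for a
  proof -
    have "f 0 / h t 0 * h t a \<le> ennreal (enn2real (f 0 / h t 0)) * (ennreal C * W a)"
      using fin by (intro mult_mono h_le_W t) auto
    also have "\<dots> = ennreal (enn2real (f 0 / h t 0) * C) * W a"
      using C_pos by (subst ennreal_mult_left) auto
    also have "\<dots> \<le> ennreal (max k (enn2real (f 0 / h t 0) * C)) * W a"
      by (intro mult_right_mono ennreal_leI) auto
    finally show ?thesis .
  qed
  show "f 0 = f 0 / h t 0 * h t 0"
    using h_0_pos[OF t] H_less_top[OF t, of 0 0]
    by (simp add: ennreal_divide_times ennreal_times_divide[symmetric] ennreal_divide_self)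
qed

text \<open>Every column of the limit is an eigenfunction below a multiple of W, hence a multiple of
  \<open>h t\<close>; symmetry identifies its value at 0.\<close>

lemma H_eq: assumes t: "0 \<le> t" "t \<le> t0" shows "H t a b = h t b / h t 0 * h t a"
proof -
  obtain k where "0 \<le> k" "\<And>a. H t a b \<le> ennreal k * W a" using H_le_W[OF t] by blast
  then have "(\<lambda>a. H t a b) = (\<lambda>a. H t 0 b / h t 0 * h t a)"
    by (intro eigen_unique[OF t]) (auto simp: kop_H[OF t])
  then show ?thesis by (simp add: fun_eq_iff H_sym[of t 0 b])
qed

end

section \<open>Derivative of the growth rate\<close>

lemma bounded_functions_convergent_subseq:
  fixes f :: "nat \<Rightarrow> nat \<Rightarrow> real"
  assumes "\<And>i a. \<bar>f i a\<bar> \<le> B"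
  shows "\<exists>\<sigma>. strict_mono \<sigma> \<and> (\<forall>a. convergent (\<lambda>i. f (\<sigma> i) a))"
proof -
  interpret nat: subseqs "\<lambda>a s. convergent (\<lambda>i. f (s i) a)"
  proof
    fix n and s :: "nat \<Rightarrow> nat" assume "strict_mono s"
    have sc: "seq_compact (cball 0 B :: real set)"
      using compact_cball compact_imp_seq_compact by blast
    have mem: "\<forall>i. f (s i) n \<in> cball 0 B" using assms by simp
    obtain l r' where "l \<in> cball 0 B" "strict_mono r'" "((\<lambda>i. f (s i) n) \<circ> r') \<longlonglongrightarrow> l"
      by (rule seq_compactE[OF sc mem])
    then show "\<exists>r'. strict_mono r' \<and> convergent (\<lambda>i. f ((s \<circ> r') i) n)"
      by (auto simp: convergent_def comp_def)
  qed
  have "convergent (\<lambda>i. f (nat.diagseq i) a)" for a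
  proof -
    have "convergent (\<lambda>i. f ((nat.diagseq \<circ> (+) (Suc a)) i) a)"
    proof (rule nat.diagseq_holds)
      fix r' s :: "nat \<Rightarrow> nat" and n assume "strict_mono r'" "convergent (\<lambda>i. f (s i) n)"
      then show "convergent (\<lambda>i. f ((s \<circ> r') i) n)"
        using convergent_subseq_convergent[of "\<lambda>i. f (s i) n" r'] by (simp add: comp_def)
    qed
    then have "convergent (\<lambda>i. f (nat.diagseq (i + Suc a)) a)" by (simp add: add_ac)
    then show ?thesis
      using convergent_ignore_initial_segment[of "\<lambda>i. f (nat.diagseq i) a" "Suc a"] by (simp add: add_ac)
  qed
  then show ?thesis using nat.subseq_diagseq by blast
qed

lemma LIMSEQ_if_subseq_subseq:
  fixes X :: "nat \<Rightarrow> 'a::topological_space"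
  assumes "\<And>\<sigma> :: nat \<Rightarrow> nat. strict_mono \<sigma> \<Longrightarrow> \<exists>\<tau> :: nat \<Rightarrow> nat. strict_mono \<tau> \<and> (\<lambda>i. X (\<sigma> (\<tau> i))) \<longlonglongrightarrow> L"
  shows "X \<longlonglongrightarrow> L"
proof (rule ccontr)
  assume "\<not> ?thesis"
  then obtain U where U: "open U" "L \<in> U" "\<not> eventually (\<lambda>i. X i \<in> U) sequentially"
    by (auto simp: tendsto_def)
  then have "\<exists>\<^sub>F i in sequentially. X i \<notin> U" by (simp add: frequently_def)
  then have inf: "infinite {i. X i \<notin> U}" by (simp add: frequently_cofinite flip: cofinite_eq_sequentially)
  define \<sigma> where "\<sigma> = enumerate {i. X i \<notin> U}"
  have "strict_mono \<sigma>" unfolding \<sigma>_def using inf by (rule strict_mono_enumerate)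
  from assms[OF this] obtain \<tau> where "(\<lambda>i. X (\<sigma> (\<tau> i))) \<longlonglongrightarrow> L" by blast
  then have "eventually (\<lambda>i. X (\<sigma> (\<tau> i)) \<in> U) sequentially" using U(1,2) by (rule topological_tendstoD)
  moreover have "X (\<sigma> i) \<notin> U" for i using enumerate_in_set[OF inf, of i] by (simp add: \<sigma>_def)
  ultimately show False by simp
qed

lemma one_minus_exp_quotient_tendsto:
  fixes S :: "nat \<Rightarrow> real"
  assumes "\<And>i. 0 < S i" "S \<longlonglongrightarrow> 0"
  shows "(\<lambda>i. (1 - exp (- S i * m)) / S i) \<longlonglongrightarrow> m"
proof -
  have "((\<lambda>t. exp (- t * m)) has_real_derivative - m) (at 0)"
    by (auto intro!: derivative_eq_intros)
  then have "((\<lambda>t. - ((exp (- t * m) - 1) / t)) \<longlongrightarrow> - (- m)) (at 0)"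
    by (intro tendsto_minus) (simp add: has_field_derivative_iff)
  then have "((\<lambda>t. (1 - exp (- t * m)) / t) \<longlongrightarrow> m) (at 0)" by (simp add: minus_divide_left)
  moreover have "filterlim S (at 0) sequentially"
    using assms by (auto simp: filterlim_at less_imp_neq[symmetric] intro!: always_eventually)
  ultimately show ?thesis by (rule filterlim_compose)
qed

definition times_id :: "(nat \<Rightarrow> ennreal) \<Rightarrow> nat \<Rightarrow> ennreal" where
  "times_id f a = ennreal (real a) * f a"

context kernel_gap begin

text \<open>For all n, \<open>r t ^ n \<le> D * u t n \<le> D * u 0 n \<le> D * r 0 ^ n\<close>; a
  constant D cannot compensate a larger growth rate.\<close>

lemma r_le_r0:
  assumes t: "0 \<le> t" "t \<le> t0"
  shows "r t \<le> r 0"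
proof (rule ccontr)
  assume "\<not> r t \<le> r 0"
  then have "1 < r t / r 0" using r_pos[of 0] by simp
  then obtain n where n: "D < (r t / r 0) ^ n" using real_arch_pow by blast
  have "r t ^ n \<le> D * u t n"
    using v_lower_bound[OF t, of n] r_pos[OF t(1)] by (simp add: v_def field_simps)
  also have "\<dots> \<le> D * r 0 ^ n"
    using u_mono[of 0 t n] u_le_r_pow[of 0 n] t D_pos by (intro mult_left_mono) auto
  finally have "(r t / r 0) ^ n \<le> D" using r_pos[of 0] by (simp add: power_divide field_simps)
  with n show False by simp
qed

text \<open>Lower semicontinuity comes from the supremum of continuous ratios, the upper bound from
  \<open>r_le_r0\<close>.\<close>

lemma r_tendsto:
  assumes S: "\<And>i. 0 \<le> S i" "\<And>i. S i \<le> t0" "S \<longlonglongrightarrow> 0"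
  shows "(\<lambda>i. r (S i)) \<longlonglongrightarrow> r 0"
proof (rule order_tendstoI)
  fix c assume "c < r 0"
  then have "\<forall>\<^sub>F n in sequentially. c < u 0 (Suc n) / u 0 n"
    using u_ratio_tendsto[of 0] by (intro order_tendstoD(1)) auto
  then obtain n where n: "c < u 0 (Suc n) / u 0 n" by (auto simp: eventually_sequentially)
  have "(\<lambda>i. u (S i) (Suc n) / u (S i) n) \<longlonglongrightarrow> u 0 (Suc n) / u 0 n"
    using u_pos[of 0 n] by (intro tendsto_divide u_tendsto S) auto
  then have "\<forall>\<^sub>F i in sequentially. c < u (S i) (Suc n) / u (S i) n" using n by (rule order_tendstoD(1))
  then show "\<forall>\<^sub>F i in sequentially. c < r (S i)"
    by eventually_elim (use u_ratio_le[OF S(1)] in \<open>blast intro: less_le_trans\<close>)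
next
  fix c assume "r 0 < c"
  then show "\<forall>\<^sub>F i in sequentially. r (S i) < c"
    using r_le_r0[OF S(1,2)] by (intro always_eventually) (auto intro: le_less_trans)
qed

text \<open>Any pointwise limit l along a subsequence is an eigenfunction at rate 0 below a multiple
  of W, so l = c h. The identity \<open>ip l l = l 0\<close> inherited from \<open>ip_h_h\<close>,
  together with l 0 > 0, forces c = 1.\<close>

lemma h_subseq_tendsto:
  assumes S: "\<And>i. 0 \<le> S i" "\<And>i. S i \<le> t0" "S \<longlonglongrightarrow> 0"
  shows "\<exists>\<sigma>. strict_mono \<sigma> \<and> (\<forall>a. (\<lambda>i. h (S (\<sigma> i)) a) \<longlonglongrightarrow> h 0 a)"
proof -
  have z: "0 \<le> (0::real)" "0 \<le> t0" using t0 by auto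
  define f where "f i a = enn2real (h (S i) a)" for i a
  have f: "h (S i) a = ennreal (f i a)" for i a
    using H_less_top[OF S(1,2)] by (simp add: f_def)
  have "h (S i) a \<le> ennreal (C * (1 / (1 - \<theta>)))" for i a
  proof -
    have "h (S i) a \<le> ennreal C * ennreal (1 / (1 - \<theta>))"
      using h_le_W[OF S(1,2), of i a] W_le[of a] by (meson mult_left_mono order_trans zero_le)
    then show ?thesis using C_pos \<theta> by (simp add: ennreal_mult[symmetric] less_imp_le)
  qed
  then have "\<bar>f i a\<bar> \<le> C * (1 / (1 - \<theta>))" for i a
    using C_pos \<theta> unfolding f by (subst (asm) ennreal_le_iff) (auto simp: f_def)
  from bounded_functions_convergent_subseq[of f, OF this]
  obtain \<sigma> where \<sigma>: "strict_mono \<sigma>" "\<And>a. convergent (\<lambda>i. f (\<sigma> i) a)" by blast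
  define l where "l a = ennreal (lim (\<lambda>i. f (\<sigma> i) a))" for a
  have l: "(\<lambda>i. h (S (\<sigma> i)) a) \<longlonglongrightarrow> l a" for a
    unfolding f l_def using \<sigma>(2)[of a] by (intro tendsto_ennrealI) (simp add: convergent_LIMSEQ_iff)
  have lW: "l a \<le> ennreal C * W a" for a
    by (rule LIMSEQ_le_const2[OF l]) (use h_le_W[OF S(1,2)] in auto)
  have S\<sigma>: "(\<lambda>i. S (\<sigma> i)) \<longlonglongrightarrow> 0"
    using LIMSEQ_subseq_LIMSEQ[OF S(3) \<sigma>(1)] by (simp add: comp_def)
  have eig: "kop (K 0) l a = ennreal (r 0) * l a" for a
  proof (rule LIMSEQ_unique)
    show "(\<lambda>i. kop (K (S (\<sigma> i))) (h (S (\<sigma> i))) a) \<longlonglongrightarrow> kop (K 0) l a"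
      unfolding kop_eq_ip ip_commute[of "K _ a"]
      by (rule ip_tendsto[where w = "\<lambda>_. 1", OF l K_tendsto[OF S\<sigma>] h_le_W[OF S(1,2)] K_le_1[OF S(1)]])
        (auto intro!: ip_W_finite_bounded[of _ 1])
    have "l a < \<top>" by (simp add: l_def)
    then show "(\<lambda>i. kop (K (S (\<sigma> i))) (h (S (\<sigma> i))) a) \<longlonglongrightarrow> ennreal (r 0) * l a"
      unfolding kop_H[OF S(1,2)]
      using LIMSEQ_subseq_LIMSEQ[OF r_tendsto[OF S] \<sigma>(1)]
      by (intro tendsto_mult_ennreal tendsto_ennrealI l) (auto simp: comp_def)
  qed
  have ll: "ip l l = l 0"
  proof (rule LIMSEQ_unique)
    show "(\<lambda>i. ip (h (S (\<sigma> i))) (h (S (\<sigma> i)))) \<longlonglongrightarrow> ip l l"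
      by (rule ip_tendsto[where w = "\<lambda>a. ennreal C * W a", OF l l h_le_W[OF S(1,2)] h_le_W[OF S(1,2)]])
        (use ip_W_W W_less_top in \<open>auto simp: ip_cmult_right ennreal_mult_less_top\<close>)
    show "(\<lambda>i. ip (h (S (\<sigma> i))) (h (S (\<sigma> i)))) \<longlonglongrightarrow> l 0"
      unfolding ip_h_h[OF S(1,2)] by (rule l)
  qed
  define c where "c = enn2real (h 0 0)"
  have c: "0 < c" "h 0 0 = ennreal c"
    using h_0_pos[OF z] H_less_top[OF z, of 0 0] by (auto simp: c_def enn2real_positive_iff)
  define d where "d = enn2real (l 0)"
  have "ennreal (1 / D) \<le> l 0"
    by (rule LIMSEQ_le_const[OF l]) (use h_0_ge[OF S(1,2)] in auto)
  then have l0: "0 < l 0" using D_pos by (auto intro: less_le_trans[rotated])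
  have d: "0 < d" "l 0 = ennreal d"
    using l0 by (auto simp: d_def l_def enn2real_positive_iff)
  have l_eq: "l = (\<lambda>a. l 0 / h 0 0 * h 0 a)"
    by (rule eigen_unique[OF z _ lW]) (simp add: fun_eq_iff eig)
  have "ip l l = (l 0 / h 0 0) * ((l 0 / h 0 0) * ip (h 0) (h 0))"
    by (subst (1 2) l_eq) (simp only: ip_cmult_left ip_cmult_right)
  also have "\<dots> = ennreal (d / c * (d / c * c))"
    using c d by (simp add: ip_h_h[OF z] divide_ennreal ennreal_mult[symmetric])
  finally have "ennreal d = ennreal (d / c * (d / c * c))" unfolding ll d(2) .
  then have "d = c" using c(1) d(1) by (subst (asm) ennreal_inj) (auto simp: field_simps)
  then have "l a = h 0 a" for a
    using c d by (subst l_eq) (simp add: divide_ennreal)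
  then show ?thesis using \<sigma>(1) l by auto
qed

text \<open>The difference quotient (K 0 - K t) / t, written as a product so that
  \<open>K_split\<close> is an additive identity in \<open>ennreal\<close>.\<close>

definition Kd :: "real \<Rightarrow> nat \<Rightarrow> nat \<Rightarrow> ennreal" where
  "Kd t a b = ennreal ((1 - exp (- t * real (1 + a + b))) / t) * K 0 a b"

text \<open>Minus the derivative of \<open>K t\<close> at t = 0; it is both the limit and an upper
  bound of \<open>Kd t\<close>.\<close>

definition L :: "nat \<Rightarrow> nat \<Rightarrow> ennreal" where
  "L a b = ennreal (real (1 + a + b)) * K 0 a b"

lemma Kd_le_L: "0 < t \<Longrightarrow> Kd t a b \<le> L a b"
proof -
  assume t: "0 < t"
  have "(1 - exp (- t * real (1 + a + b))) / t \<le> real (1 + a + b)"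
    using exp_ge_add_one_self[of "- t * real (1 + a + b)"] t by (simp add: field_simps)
  then show ?thesis unfolding Kd_def L_def by (intro mult_right_mono ennreal_leI) auto
qed

lemma Kd_tendsto:
  assumes "\<And>i. 0 < S i" "S \<longlonglongrightarrow> 0"
  shows "(\<lambda>i. Kd (S i) a b) \<longlonglongrightarrow> L a b"
  unfolding Kd_def L_def
  by (intro tendsto_mult_ennreal tendsto_ennrealI tendsto_const one_minus_exp_quotient_tendsto assms)
    (auto simp: K_less_top)

lemma K_split: "0 < t \<Longrightarrow> K 0 a b = K t a b + ennreal t * Kd t a b"
proof -
  assume t: "0 < t"
  define k where "k = \<kappa> (1 + a + b) * pk a b"
  have k: "0 \<le> k" using \<kappa>_pos[of "1 + a + b"] pk_pos[of a b] by (simp add: k_def)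
  have K: "K t a b = ennreal (exp (- t * real (1 + a + b)) * k)" "K 0 a b = ennreal k" for t
    by (auto simp: K_def k_def mult.assoc)
  have "ennreal t * Kd t a b = ennreal (t * ((1 - exp (- t * real (1 + a + b))) / t) * k)"
  proof -
    have "ennreal t * (ennreal y * ennreal k) = ennreal (t * y * k)" if "0 \<le> y" for y
      using that t k by (simp add: ennreal_mult mult.assoc)
    then show ?thesis unfolding Kd_def K using t by simp
  qed
  also have "t * ((1 - exp (- t * real (1 + a + b))) / t) * k = (1 - exp (- t * real (1 + a + b))) * k"
    using t by simp
  finally have e: "ennreal t * Kd t a b = ennreal ((1 - exp (- t * real (1 + a + b))) * k)" .
  show ?thesis
  proof -
    have "ennreal k = ennreal (y * k) + ennreal ((1 - y) * k)" if "0 \<le> y" "y \<le> 1" for y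
      using that k by (subst ennreal_plus[symmetric]) (auto simp: algebra_simps mult_left_le)
    then show ?thesis
      using t unfolding K(2) K(1)[of t] e by simp
  qed
qed

lemma kop_K_split: "0 < t \<Longrightarrow> kop (K 0) f a = kop (K t) f a + ennreal t * kop (Kd t) f a"
proof -
  assume t: "0 < t"
  have "kop (K 0) f a = (\<integral>\<^sup>+b. K t a b * f b + ennreal t * (Kd t a b * f b) \<partial>count_space UNIV)"
    unfolding kop_def by (intro nn_integral_cong) (simp add: K_split[OF t] distrib_right mult.assoc)
  then show ?thesis by (simp add: kop_def nn_integral_add nn_integral_cmult)
qed

lemma kop_L: "kop L f a = kop (K 0) f a + ennreal (real a) * kop (K 0) f a + kop (K 0) (times_id f) a"
proof -
  have "kop L f a = (\<integral>\<^sup>+b. K 0 a b * f b + ennreal (real a) * (K 0 a b * f b) + K 0 a b * times_id f b \<partial>count_space UNIV)"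
    unfolding kop_def by (intro nn_integral_cong) (simp add: L_def times_id_def algebra_simps)
  then show ?thesis by (simp add: kop_def nn_integral_add nn_integral_cmult)
qed

text \<open>The factor 1 + a + b splits the form: the coordinate a is absorbed by f and the
  coordinate b by g.\<close>

lemma ip_kop_L: "ip f (kop L g) = ip f (kop (K 0) g) + ip (times_id f) (kop (K 0) g) + ip f (kop (K 0) (times_id g))"
proof -
  have "ip f (kop L g) = ip f (\<lambda>a. kop (K 0) g a + times_id (kop (K 0) g) a + kop (K 0) (times_id g) a)"
    by (simp add: kop_L[abs_def] times_id_def)
  also have "\<dots> = ip f (kop (K 0) g) + ip f (times_id (kop (K 0) g)) + ip f (kop (K 0) (times_id g))"
    by (simp add: ip_add_right)
  also have "ip f (times_id (kop (K 0) g)) = ip (times_id f) (kop (K 0) g)"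
    by (simp add: ip_def times_id_def mult_ac)
  finally show ?thesis .
qed

section \<open>Integrability against the derivative kernel\<close>

lemma sum_times_id_W: "(\<integral>\<^sup>+a. times_id W a \<partial>count_space UNIV) < \<top>"
proof -
  have "(\<integral>\<^sup>+a. times_id W a \<partial>count_space UNIV) \<le> (\<integral>\<^sup>+a. ennreal (1 + real a) * W a \<partial>count_space UNIV)"
    unfolding times_id_def by (intro nn_integral_mono mult_right_mono ennreal_leI) auto
  then show ?thesis using W_weighted_sum by (rule le_less_trans)
qed

lemma kop_L_W_le: "\<exists>c\<ge>0. \<forall>a. kop L W a \<le> ennreal c * ennreal (1 + real a)"
proof -
  define c1 where "c1 = 1 / (1 - \<theta>)"
  define c2 where "c2 = enn2real (\<integral>\<^sup>+a. times_id W a \<partial>count_space UNIV)"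
  have c: "0 \<le> c1" "0 \<le> c2" using \<theta> by (auto simp: c1_def c2_def)
  have 1: "kop (K 0) W a \<le> ennreal c1" for a
    using kop_K_le_const[of 0 W "ennreal c1" 1 a] W_le by (simp add: c1_def)
  have 2: "kop (K 0) (times_id W) a \<le> ennreal c2" for a
  proof -
    have "kop (K 0) (times_id W) a \<le> (\<integral>\<^sup>+b. times_id W b \<partial>count_space UNIV)"
      unfolding kop_def using mult_right_mono[OF K_le_1[of 0]] by (intro nn_integral_mono) simp
    also have "\<dots> = ennreal c2" using sum_times_id_W by (simp add: c2_def)
    finally show ?thesis .
  qed
  have "kop L W a \<le> ennreal (c1 + c2) * ennreal (1 + real a)" for a
  proof -
    have "kop L W a \<le> ennreal c1 + ennreal (real a) * ennreal c1 + ennreal c2"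
      unfolding kop_L by (intro add_mono mult_left_mono 1 2) auto
    also have "\<dots> = ennreal (c1 + real a * c1 + c2)"
      using c by (simp add: ennreal_mult[symmetric] flip: ennreal_plus)
    also have "\<dots> \<le> ennreal ((c1 + c2) * (1 + real a))"
      using c by (intro ennreal_leI) (simp add: algebra_simps)
    also have "\<dots> = ennreal (c1 + c2) * ennreal (1 + real a)"
      using c by (intro ennreal_mult) auto
    finally show ?thesis .
  qed
  then show ?thesis using c by (intro exI[of _ "c1 + c2"]) auto
qed

lemma kop_L_W_less_top: "kop L W a < \<top>"
proof -
  obtain c where "\<forall>a. kop L W a \<le> ennreal c * ennreal (1 + real a)" using kop_L_W_le by blast
  then have "kop L W a \<le> ennreal c * ennreal (1 + real a)" by blast
  also have "\<dots> < \<top>" by (simp add: ennreal_mult_less_top del: ennreal_plus)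
  finally show ?thesis .
qed

lemma ip_W_kop_L_W: "ip W (kop L W) < \<top>"
  using kop_L_W_le ip_W_finite by blast

text \<open>The mean of the coordinate under the probability weights proportional to the square of
  \<open>h 0\<close>: the denominator is \<open>ip (h 0) (h 0)\<close> by
  \<open>ip_h_h\<close>.\<close>

definition mean :: real where
  "mean = enn2real (ip (times_id (h 0)) (h 0)) / enn2real (h 0 0)"

lemma ip_times_id_h: "ip (times_id (h 0)) (h 0) < \<top>"
proof -
  have "ip (times_id (h 0)) (h 0) \<le> ip (\<lambda>a. ennreal C * times_id W a) (\<lambda>a. ennreal (C * (1 / (1 - \<theta>))))"
  proof (rule ip_mono)
    have h: "h 0 a \<le> ennreal C * W a" for a using h_le_W[of 0] t0 by simp
    show "times_id (h 0) a \<le> ennreal C * times_id W a" for a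
      using mult_left_mono[OF h, of "ennreal (real a)"] by (simp add: times_id_def mult.left_commute)
    show "h 0 a \<le> ennreal (C * (1 / (1 - \<theta>)))" for a
    proof -
      have "h 0 a \<le> ennreal C * ennreal (1 / (1 - \<theta>))"
        using h[of a] W_le[of a] by (meson mult_left_mono order_trans zero_le)
      then show ?thesis using C_pos \<theta> by (simp add: ennreal_mult[symmetric] less_imp_le)
    qed
  qed
  also have "\<dots> = ennreal C * ((\<integral>\<^sup>+a. times_id W a \<partial>count_space UNIV) * ennreal (C * (1 / (1 - \<theta>))))"
    by (simp only: ip_cmult_left) (simp add: ip_def nn_integral_multc)
  also have "\<dots> < \<top>" using sum_times_id_W by (simp add: ennreal_mult_less_top)
  finally show ?thesis .
qed

text \<open>Each of the three terms of \<open>ip_kop_L\<close> has one K acting on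
  \<open>h 0\<close>, possibly after using symmetry, and so yields a factor \<open>r 0\<close>; the
  two coordinate terms coincide.\<close>

lemma ip_h_kop_L_h: "ip (h 0) (kop L (h 0)) = ennreal (r 0 * enn2real (h 0 0) * (1 + 2 * mean))"
proof -
  have z: "0 \<le> (0::real)" "0 \<le> t0" using t0 by auto
  define c where "c = enn2real (h 0 0)"
  have c: "0 < c" "h 0 0 = ennreal c"
    using h_0_pos[OF z] H_less_top[OF z, of 0 0] by (auto simp: c_def enn2real_positive_iff)
  define m where "m = enn2real (ip (times_id (h 0)) (h 0))"
  have m: "0 \<le> m" "ip (times_id (h 0)) (h 0) = ennreal m" using ip_times_id_h by (auto simp: m_def)
  have r: "0 < r 0" by (rule r_pos) simp
  have "ip (h 0) (kop L (h 0)) = ennreal (r 0) * ennreal c + ennreal (r 0) * ennreal m + ennreal (r 0) * ennreal m"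
    unfolding ip_kop_L ip_kop_K[of "h 0" 0 "times_id (h 0)"]
    by (simp only: kop_h[OF z] ip_cmult_left ip_cmult_right ip_h_h[OF z] c(2) m(2) ip_commute[of "h 0" "times_id (h 0)"])
  also have "\<dots> = ennreal (r 0 * c + r 0 * m + r 0 * m)"
    using r c m by (simp add: ennreal_mult[symmetric] flip: ennreal_plus)
  also have "r 0 * c + r 0 * m + r 0 * m = r 0 * c * (1 + 2 * mean)"
    using c by (simp add: mean_def m_def[symmetric] c_def[symmetric] field_simps)
  finally show ?thesis by (simp add: c_def)
qed

text \<open>Pairing the eigenfunctions at rates \<open>t\<close> and \<open>0\<close> gives
  \<open>(r 0 - r t) \<langle>h t, h 0\<rangle> = \<langle>h t, (K 0 - K t) h 0\<rangle>\<close>.\<close>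

lemma r_quotient_tendsto:
  assumes S: "\<And>i. 0 < S i" "\<And>i. S i \<le> t0" "S \<longlonglongrightarrow> 0"
  shows "(\<lambda>i. (r 0 - r (S i)) / S i) \<longlonglongrightarrow> r 0 * (1 + 2 * mean)"
proof (rule LIMSEQ_if_subseq_subseq)
  fix \<sigma> :: "nat \<Rightarrow> nat" assume \<sigma>: "strict_mono \<sigma>"
  have z: "0 \<le> (0::real)" "0 \<le> t0" using t0 by auto
  have "(\<lambda>i. S (\<sigma> i)) \<longlonglongrightarrow> 0" using LIMSEQ_subseq_LIMSEQ[OF S(3) \<sigma>] by (simp add: comp_def)
  \<comment> \<open>Eigenfunctions are known to converge only along subsequences, which is enough
    because the limit of the quotient is the same for each of them.\<close>
  then have "\<exists>\<tau>. strict_mono \<tau> \<and> (\<forall>a. (\<lambda>i. h (S (\<sigma> (\<tau> i))) a) \<longlonglongrightarrow> h 0 a)"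
    using S by (intro h_subseq_tendsto) (auto intro: less_imp_le)
  then obtain \<tau> where \<tau>: "strict_mono \<tau>" "\<And>a. (\<lambda>i. h (S (\<sigma> (\<tau> i))) a) \<longlonglongrightarrow> h 0 a" by blast
  define T where "T i = S (\<sigma> (\<tau> i))" for i
  have T: "0 < T i" "0 \<le> T i" "T i \<le> t0" for i using S by (auto simp: T_def less_imp_le)
  have T0: "T \<longlonglongrightarrow> 0"
    using LIMSEQ_subseq_LIMSEQ[OF S(3) strict_mono_o[OF \<sigma> \<tau>(1)]] by (simp add: comp_def T_def[abs_def])
  have hT: "(\<lambda>i. h (T i) a) \<longlonglongrightarrow> h 0 a" for a using \<tau>(2) by (simp add: T_def)
  define c where "c = enn2real (h 0 0)"
  have c: "0 < c" "h 0 0 = ennreal c"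
    using h_0_pos[OF z] H_less_top[OF z, of 0 0] by (auto simp: c_def enn2real_positive_iff)
  have I: "(\<lambda>i. ip (h (T i)) (h 0)) \<longlonglongrightarrow> ennreal c"
    unfolding c(2)[symmetric] ip_h_h[OF z, symmetric]
    by (rule ip_tendsto[where w = "\<lambda>a. ennreal C * W a", OF hT tendsto_const h_le_W[OF T(2,3)] h_le_W[OF z]])
      (use ip_W_W W_less_top in \<open>auto simp: ip_cmult_right ennreal_mult_less_top\<close>)
  have KdL: "(\<lambda>i. kop (Kd (T i)) (h 0) a) \<longlonglongrightarrow> kop L (h 0) a" for a
    unfolding kop_eq_ip ip_commute[of _ "h 0"]
    by (rule ip_tendsto[where w = "L a", OF tendsto_const Kd_tendsto[OF T(1) T0] h_le_W[OF z] Kd_le_L[OF T(1)]])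
      (use kop_L_W_less_top[of a] in \<open>auto simp: kop_eq_ip ip_commute L_def K_less_top ennreal_mult_less_top\<close>)
  have J: "(\<lambda>i. ip (h (T i)) (kop (Kd (T i)) (h 0))) \<longlonglongrightarrow> ennreal (r 0 * c * (1 + 2 * mean))"
    unfolding c_def ip_h_kop_L_h[symmetric]
  proof (rule ip_tendsto[where w = "\<lambda>a. ennreal C * kop L W a", OF hT KdL h_le_W[OF T(2,3)]])
    show "kop (Kd (T n)) (h 0) a \<le> ennreal C * kop L W a" for n a
    proof -
      have "kop (Kd (T n)) (h 0) a \<le> kop L (\<lambda>a. ennreal C * W a) a"
        by (intro kop_mono Kd_le_L T h_le_W z)
      then show ?thesis by (simp add: kop_cmult)
    qed
  qed (use ip_W_kop_L_W kop_L_W_less_top in \<open>auto simp: ip_cmult_right ennreal_mult_less_top\<close>)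
  define Ir where "Ir i = enn2real (ip (h (T i)) (h 0))" for i
  define Jr where "Jr i = enn2real (ip (h (T i)) (kop (Kd (T i)) (h 0)))" for i
  have Ir: "Ir \<longlonglongrightarrow> c" unfolding Ir_def using I c(1) by (intro tendsto_enn2real) auto
  have "0 \<le> mean" by (simp add: mean_def)
  then have Jr: "Jr \<longlonglongrightarrow> r 0 * c * (1 + 2 * mean)"
    unfolding Jr_def using J c(1) r_pos[of 0] by (intro tendsto_enn2real) auto
  have "(\<lambda>i. Jr i / Ir i) \<longlonglongrightarrow> r 0 * c * (1 + 2 * mean) / c"
    using c(1) by (intro tendsto_divide Jr Ir) auto
  then have lim: "(\<lambda>i. Jr i / Ir i) \<longlonglongrightarrow> r 0 * (1 + 2 * mean)" using c(1) by simp
  \<comment> \<open>All terms of the perturbation identity are finite, so it can be solved for the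
    quotient in the reals.\<close>
  have eq: "(r 0 - r (T i)) / T i = Jr i / Ir i" for i
  proof -
    have Wfin: "ip W (h 0) < \<top>" 
      using ip_h_finite[OF z, of W] ip_W_W by (simp add: ip_commute)
    have Ifin: "ip (h (T i)) (h 0) < \<top>" by (rule ip_h_finite[OF T(2,3) Wfin])
    have Ieq: "ip (h (T i)) (h 0) = ennreal (Ir i)" using Ifin by (simp add: Ir_def)
    have "0 < h (T i) 0 * h 0 0" using h_0_pos[OF T(2,3)] h_0_pos[OF z] by (simp add: ennreal_zero_less_mult_iff)
    also have "\<dots> \<le> ip (h (T i)) (h 0)" by (rule ip_ge)
    finally have Ipos: "0 < Ir i" using Ifin by (simp add: Ir_def enn2real_positive_iff)
    have "ennreal (r 0) * ip (h (T i)) (h 0) = ip (h (T i)) (kop (K 0) (h 0))"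
      by (simp add: kop_h[OF z] ip_cmult_right)
    also have "\<dots> = ip (h (T i)) (kop (K (T i)) (h 0)) + ennreal (T i) * ip (h (T i)) (kop (Kd (T i)) (h 0))"
    proof -
      have "kop (K 0) (h 0) = (\<lambda>a. kop (K (T i)) (h 0) a + ennreal (T i) * kop (Kd (T i)) (h 0) a)"
        by (rule ext) (rule kop_K_split[OF T(1)])
      then show ?thesis by (simp only: ip_add_right ip_cmult_right)
    qed
    also have "ip (h (T i)) (kop (K (T i)) (h 0)) = ennreal (r (T i)) * ip (h (T i)) (h 0)"
      by (simp add: ip_kop_K kop_h[OF T(2,3)] ip_cmult_left)
    finally have e: "ennreal (r 0) * ennreal (Ir i) = ennreal (r (T i)) * ennreal (Ir i) + ennreal (T i) * ip (h (T i)) (kop (Kd (T i)) (h 0))"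
      by (simp add: Ieq)
    have "ennreal (T i) * ip (h (T i)) (kop (Kd (T i)) (h 0)) \<le> ennreal (r 0) * ennreal (Ir i)"
      unfolding e by simp
    also have "\<dots> < \<top>" by (simp add: ennreal_mult_less_top)
    finally have "ip (h (T i)) (kop (Kd (T i)) (h 0)) < \<top>" using T(1)[of i] by (auto simp: ennreal_mult_less_top)
    then have Jeq: "ip (h (T i)) (kop (Kd (T i)) (h 0)) = ennreal (Jr i)" by (simp add: Jr_def)
    have Jnn: "0 \<le> Jr i" by (simp add: Jr_def)
    have "ennreal (r 0 * Ir i) = ennreal (r (T i) * Ir i + T i * Jr i)"
      using e Ipos Jnn T(1)[of i] r_pos[of 0] r_pos[OF T(2)[of i]]
      by (simp add: Jeq ennreal_mult less_imp_le)
    then have "r 0 * Ir i = r (T i) * Ir i + T i * Jr i"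
      using Ipos Jnn T(1)[of i] r_pos[of 0] r_pos[OF T(2)[of i]] by (subst (asm) ennreal_inj) (auto simp: less_imp_le)
    then show ?thesis using Ipos T(1)[of i] by (simp add: field_simps)
  qed
  have "(\<lambda>i. (r 0 - r (S (\<sigma> (\<tau> i)))) / S (\<sigma> (\<tau> i))) \<longlonglongrightarrow> r 0 * (1 + 2 * mean)"
    using lim unfolding eq[symmetric] T_def .
  then show "\<exists>\<tau>. strict_mono \<tau> \<and> (\<lambda>i. (r 0 - r (S (\<sigma> (\<tau> i)))) / S (\<sigma> (\<tau> i))) \<longlonglongrightarrow> r 0 * (1 + 2 * mean)"
    using \<tau>(1) by blast
qed

lemma ln_r_has_derivative:
  "((\<lambda>t. - ln (r t)) has_real_derivative 1 + 2 * mean) (at_right 0)"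
proof -
  have "((\<lambda>t. (r t - r 0) / (t - 0)) \<longlongrightarrow> - (r 0 * (1 + 2 * mean))) (at_right 0)"
  proof (rule tendsto_at_right_sequentially[OF t0(1)])
    fix S assume "\<And>n. 0 < S n" "\<And>n. S n < t0" "S \<longlonglongrightarrow> 0"
    then have "(\<lambda>i. - ((r 0 - r (S i)) / S i)) \<longlonglongrightarrow> - (r 0 * (1 + 2 * mean))"
      by (intro tendsto_minus r_quotient_tendsto) (auto intro: less_imp_le)
    then show "(\<lambda>n. (r (S n) - r 0) / (S n - 0)) \<longlonglongrightarrow> - (r 0 * (1 + 2 * mean))"
      by (simp add: minus_divide_left)
  qed
  then have "(r has_real_derivative - (r 0 * (1 + 2 * mean))) (at_right 0)"
    by (simp add: has_field_derivative_iff)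
  from DERIV_chain2[OF DERIV_ln[OF r_pos[of 0]] this]
  have "((\<lambda>t. ln (r t)) has_real_derivative inverse (r 0) * - (r 0 * (1 + 2 * mean))) (at_right 0)" by simp
  from DERIV_minus[OF this] show ?thesis using r_pos[of 0] by (simp add: mult.assoc[symmetric])
qed

lemma mean_pos: "0 < mean"
proof -
  have z: "0 \<le> (0::real)" "0 \<le> t0" using t0 by auto
  have "0 < times_id (h 0) 1 * h 0 1"
    using h_pos[OF z, of 1] by (simp add: times_id_def ennreal_zero_less_mult_iff)
  also have "\<dots> \<le> ip (times_id (h 0)) (h 0)" by (rule ip_ge)
  finally show ?thesis
    using ip_times_id_h h_0_pos[OF z] H_less_top[OF z, of 0 0] by (simp add: mean_def enn2real_positive_iff)
qed

end

section \<open>Asymptotics of first moments\<close>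

text \<open>At most 2 J of the n terms have j < J or n - j < J; these are bounded, and all others
  are close to l.\<close>

lemma double_Cesaro:
  fixes F :: "nat \<Rightarrow> nat \<Rightarrow> real"
  assumes bd: "\<And>j m. \<bar>F j m - l\<bar> \<le> B"
    and lim: "\<And>\<epsilon>. 0 < \<epsilon> \<Longrightarrow> \<exists>J. \<forall>j\<ge>J. \<forall>m\<ge>J. \<bar>F j m - l\<bar> < \<epsilon>"
  shows "(\<lambda>n. (\<Sum>j<n. F j (n - j)) / real n) \<longlonglongrightarrow> l"
proof (rule LIMSEQ_I)
  fix \<epsilon> :: real assume \<epsilon>: "0 < \<epsilon>"
  obtain J where J: "\<And>j m. J \<le> j \<Longrightarrow> J \<le> m \<Longrightarrow> \<bar>F j m - l\<bar> < \<epsilon> / 2"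
    using lim[of "\<epsilon> / 2"] \<epsilon> by auto
  have B: "0 \<le> B" using bd[of 0 0] by linarith
  \<comment> \<open>Beyond this N the exceptional terms contribute 2 B J < n
    \<open>\<epsilon>\<close> / 2.\<close>
  obtain N where N: "4 * B * real J / \<epsilon> < real N" using reals_Archimedean2 by blast
  have "norm ((\<Sum>j<n. F j (n - j)) / real n - l) < \<epsilon>" if n: "n \<ge> Suc N" for n
  proof -
    have "\<bar>(\<Sum>j<n. F j (n - j)) - real n * l\<bar> = \<bar>\<Sum>j<n. (F j (n - j) - l)\<bar>"
      by (simp add: sum_subtractf)
    also have "\<dots> \<le> (\<Sum>j<n. \<bar>F j (n - j) - l\<bar>)" by (rule sum_abs)
    also have "\<dots> \<le> (\<Sum>j<n. \<epsilon> / 2 + B * (of_bool (j < J) + of_bool (n - j < J)))"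
    proof (rule sum_mono)
      fix j assume "j \<in> {..<n}"
      show "\<bar>F j (n - j) - l\<bar> \<le> \<epsilon> / 2 + B * (of_bool (j < J) + of_bool (n - j < J))"
        using J[of j "n - j"] bd[of j "n - j"] B \<epsilon> by (cases "j < J"; cases "n - j < J") auto
    qed
    also have "\<dots> = real n * (\<epsilon> / 2) + B * (real (card {j. j < n \<and> j < J}) + real (card {j. j < n \<and> n - j < J}))"
    proof -
      have "(\<Sum>j<n. of_bool (R j)) = real (card {j. j < n \<and> R j})" for R
        by (simp add: lessThan_def Collect_conj_eq)
      then show ?thesis by (simp add: sum.distrib sum_distrib_left[symmetric])
    qed
    also have "\<dots> \<le> real n * (\<epsilon> / 2) + B * (real J + real J)"
    proof -
      have "card {j. j < n \<and> j < J} \<le> card {..<J}" by (rule card_mono) auto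
      moreover have "card {j. j < n \<and> n - j < J} \<le> card ((\<lambda>m. n - m) ` {..<J})"
      proof (rule card_mono)
        show "{j. j < n \<and> n - j < J} \<subseteq> (\<lambda>m. n - m) ` {..<J}"
        proof
          fix j assume "j \<in> {j. j < n \<and> n - j < J}"
          then have "j = n - (n - j)" "n - j \<in> {..<J}" by auto
          then show "j \<in> (\<lambda>m. n - m) ` {..<J}" by (rule image_eqI)
        qed
      qed simp
      moreover have "card ((\<lambda>m. n - m) ` {..<J}) \<le> J" using card_image_le[of "{..<J}" "\<lambda>m. n - m"] by simp
      ultimately show ?thesis using B by (intro add_mono mult_left_mono) auto
    qed
    also have "\<dots> < real n * \<epsilon>"
    proof -
      have "4 * B * real J < real N * \<epsilon>" using N \<epsilon> by (simp add: field_simps)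
      also have "\<dots> \<le> real n * \<epsilon>" using n \<epsilon> by (intro mult_right_mono) auto
      finally show ?thesis by (simp add: field_simps)
    qed
    finally show ?thesis using n by (simp add: field_simps abs_less_iff)
  qed
  then show "\<exists>no. \<forall>n\<ge>no. norm ((\<Sum>j<n. F j (n - j)) / real n - l) < \<epsilon>" by blast
qed

text \<open>Failure for every J yields a sequence of violating pairs whose two indices both tend to
  infinity.\<close>

lemma double_limit_from_sequences:
  fixes F :: "nat \<Rightarrow> nat \<Rightarrow> real"
  assumes "\<And>j m. filterlim j at_top sequentially \<Longrightarrow> filterlim m at_top sequentially \<Longrightarrow> (\<lambda>i. F (j i) (m i)) \<longlonglongrightarrow> l"
    and \<epsilon>: "0 < \<epsilon>"
  shows "\<exists>J. \<forall>j\<ge>J. \<forall>m\<ge>J. \<bar>F j m - l\<bar> < \<epsilon>"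
proof (rule ccontr)
  assume "\<not> ?thesis"
  then have "\<forall>J. \<exists>j m. J \<le> j \<and> J \<le> m \<and> \<not> \<bar>F j m - l\<bar> < \<epsilon>" by blast
  then obtain j m where jm: "\<And>J. J \<le> j J" "\<And>J. J \<le> m J" "\<And>J. \<not> \<bar>F (j J) (m J) - l\<bar> < \<epsilon>"
    by metis
  have "filterlim j at_top sequentially" "filterlim m at_top sequentially"
    using jm(1,2) by (auto intro: filterlim_at_top_mono[OF filterlim_ident] always_eventually)
  then have "(\<lambda>i. F (j i) (m i)) \<longlonglongrightarrow> l" by (rule assms)
  from LIMSEQ_D[OF this \<epsilon>] jm(3) show False by auto
qed

context kernel_gap begin

section \<open>Partition functions with a boundary weight G\<close>

lemma ip_x_le_W: "0 \<le> t \<Longrightarrow> t \<le> t0 \<Longrightarrow> ip (x t n) f \<le> ennreal (C * r t ^ n) * ip W f"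
proof -
  assume t: "0 \<le> t" "t \<le> t0"
  have "x t n a \<le> ennreal (C * r t ^ n) * W a" for a
    using x_le_W[OF t, of n a] u_le_r_pow[OF t(1), of n] C_pos
    by (elim order_trans) (intro mult_right_mono ennreal_leI mult_left_mono, auto)
  then show ?thesis by (subst ip_cmult_left[symmetric]) (intro ip_mono, auto)
qed

lemma kop_pow_0_eq_ip: "(kop (K t) ^^ n) f 0 = ip (x t n) f"
  using ip_x[of t n 0 f] by simp

lemma Z_tendsto:
  assumes t: "0 \<le> t" "t \<le> t0" and G: "\<And>a. G a \<le> 1"
  shows "(\<lambda>n. ennreal (1 / r t ^ n) * (kop (K t) ^^ n) G 0) \<longlonglongrightarrow> ip (h t) G"
proof -
  have "ennreal (1 / r t ^ n) * (kop (K t) ^^ n) G 0 = ip (\<lambda>a. E t n a 0) G" for n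
    by (simp add: kop_pow_0_eq_ip E_def x_eq_P[symmetric] ip_cmult_left)
  moreover have "(\<lambda>n. ip (\<lambda>a. E t n a 0) G) \<longlonglongrightarrow> ip (h t) G"
    by (rule ip_tendsto[where w = "\<lambda>_. 1", OF E_tendsto(1)[OF t] tendsto_const E_le_W[OF t] G])
      (auto intro!: ip_W_finite_bounded[of _ 1])
  ultimately show ?thesis by simp
qed

lemma ip_h_G:
  assumes t: "0 \<le> t" "t \<le> t0" and G: "\<And>a. G a \<le> 1" "G 0 = 1"
  shows "0 < ip (h t) G" "ip (h t) G < \<top>"
proof -
  have "0 < h t 0 * G 0" using h_0_pos[OF t] G by simp
  also have "\<dots> \<le> ip (h t) G" by (rule ip_ge)
  finally show "0 < ip (h t) G" .
  show "ip (h t) G < \<top>" using G by (intro ip_h_finite[OF t] ip_W_finite_bounded[of _ 1]) auto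
qed

text \<open>Divided by r ^ n the partition function tends to the positive number
  \<open>ip (h t) G\<close>, whose logarithm disappears after division by n.\<close>

lemma ln_Z_tendsto:
  assumes t: "0 \<le> t" "t \<le> t0" and G: "\<And>a. G a \<le> 1" "G 0 = 1"
  shows "(\<lambda>n. ln (enn2real ((kop (K t) ^^ n) G 0)) / real n) \<longlonglongrightarrow> ln (r t)"
proof -
  define z where "z n = enn2real ((kop (K t) ^^ n) G 0)" for n
  have fin: "(kop (K t) ^^ n) G 0 < \<top>" for n
    by (rule le_less_trans[OF kop_K_le_const[where f = G and c = 1, OF t(1) G(1)]]) simp
  have z: "(kop (K t) ^^ n) G 0 = ennreal (z n)" for n using fin[of n] by (simp add: z_def)
  have zpos: "0 < z n" for n
  proof -
    have "0 < x t n 0 * G 0" using x_0_pos[of t n] G by simp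
    also have "\<dots> \<le> (kop (K t) ^^ n) G 0" unfolding kop_pow_0_eq_ip by (rule ip_ge)
    finally show ?thesis using fin[of n] by (simp add: z_def enn2real_positive_iff)
  qed
  define c where "c = enn2real (ip (h t) G)"
  have c: "0 < c" "ip (h t) G = ennreal c"
    using ip_h_G[where G = G, OF t G] by (auto simp: c_def enn2real_positive_iff)
  have "(\<lambda>n. ennreal (z n / r t ^ n)) \<longlonglongrightarrow> ennreal c"
    using Z_tendsto[where G = G, OF t G(1)] r_pos[OF t(1)] zpos
    by (simp add: z c(2) ennreal_mult[symmetric] less_imp_le)
  then have "(\<lambda>n. z n / r t ^ n) \<longlonglongrightarrow> c"
    using zpos r_pos[OF t(1)] c by (subst (asm) tendsto_ennreal_iff) (auto simp: less_imp_le)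
  then have "(\<lambda>n. ln (z n / r t ^ n)) \<longlonglongrightarrow> ln c" using c by (intro tendsto_ln) auto
  moreover have "(\<lambda>n. 1 / real n) \<longlonglongrightarrow> 0" by (rule lim_1_over_n)
  ultimately have "(\<lambda>n. ln (z n / r t ^ n) * (1 / real n) + ln (r t)) \<longlonglongrightarrow> ln c * 0 + ln (r t)"
    by (intro tendsto_add tendsto_mult tendsto_const)
  moreover have "z n \<noteq> 0" for n using zpos[of n] by simp
  then have "\<forall>\<^sub>F n in sequentially. ln (z n / r t ^ n) * (1 / real n) + ln (r t) = ln (z n) / real n"
    by (intro eventually_mono[OF eventually_gt_at_top[of 0]]) (use zpos r_pos[OF t(1)] in \<open>simp add: ln_div ln_realpow field_simps\<close>)
  ultimately show ?thesis unfolding z_def[symmetric] by (auto intro: Lim_transform_eventually)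
qed

text \<open>The bound must be uniform in the site as well, although G need not decay. For a >= M the
  kernel has row mass at most s < r 0 and preserves the bound A; each a < M is reached from 0 in one
  step, where \<open>ip_x_le_W\<close> applies.\<close>

lemma g_bounded:
  assumes G: "\<And>a. G a \<le> 1"
  obtains A where "0 < A" "\<And>n a. ennreal (1 / r 0 ^ n) * (kop (K 0) ^^ n) G a \<le> ennreal A"
proof -
  have z: "0 \<le> (0::real)" "0 \<le> t0" using t0 by auto
  have r: "0 < r 0" "\<rho> \<le> r 0" using r_pos[of 0] \<rho>_le_r[OF z] by auto
  define k where "k a = enn2real (K 0 0 a)" for a
  have k: "0 < k a" "K 0 0 a = ennreal (k a)" for a
    using K_pos[of 0 0 a] K_less_top[of 0 0 a] by (auto simp: k_def enn2real_positive_iff)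
  define w where "w = enn2real (ip W G)"
  have w: "0 \<le> w" "ip W G = ennreal w"
    using ip_W_finite_bounded[of G 1] G by (auto simp: w_def)
  define A where "A = 1 + (\<Sum>a<M. C * r 0 * w / k a)"
  have nn: "0 \<le> C * r 0 * w / k a" for a using C_pos r w k(1)[of a] by simp
  have A: "1 \<le> A" unfolding A_def using nn by (simp add: sum_nonneg)
  have "ennreal (1 / r 0 ^ n) * (kop (K 0) ^^ n) G a \<le> ennreal A" for n a
  proof (induction n arbitrary: a)
    case 0
    then show ?case using G[of a] A by (simp add: order_trans[OF _ ennreal_leI[OF A]])
  next
    case (Suc n)
    show ?case
    proof (cases "M \<le> a")
      case True
      have "ennreal (1 / r 0 ^ Suc n) * (kop (K 0) ^^ Suc n) G a
          = ennreal (1 / r 0) * kop (K 0) (\<lambda>b. ennreal (1 / r 0 ^ n) * (kop (K 0) ^^ n) G b) a"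
        unfolding kop_cmult using r by (subst ennreal_mult_left) auto
      also have "\<dots> \<le> ennreal (1 / r 0) * kop (\<lambda>a b. ennreal s * pe a b) (\<lambda>_. ennreal A) a"
      proof (rule mult_left_mono)
        show "kop (K 0) (\<lambda>b. ennreal (1 / r 0 ^ n) * (kop (K 0) ^^ n) G b) a \<le> kop (\<lambda>a b. ennreal s * pe a b) (\<lambda>_. ennreal A) a"
          using K_gap[of 0 a] True Suc by (intro kop_row_mono) auto
      qed simp
      also have "\<dots> = ennreal (1 / r 0) * (ennreal s * kop pe (\<lambda>_. ennreal A) a)"
        by (simp add: kop_def mult.assoc nn_integral_cmult)
      also have "\<dots> = ennreal (1 / r 0 * s) * ennreal A"
        using r s_pos by (subst ennreal_mult_left) (auto simp: kop_pe_const)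
      also have "\<dots> \<le> 1 * ennreal A"
        using r s_less s_pos by (intro mult_right_mono) (auto simp: field_simps)
      finally show ?thesis by simp
    next
      case False
      have "ennreal (k a) * (kop (K 0) ^^ Suc n) G a \<le> (kop (K 0) ^^ Suc (Suc n)) G 0"
        unfolding k(2)[symmetric] using kop_ge[of "K 0" 0 a "(kop (K 0) ^^ Suc n) G"] by simp
      also have "\<dots> \<le> ennreal (C * r 0 ^ Suc (Suc n)) * ennreal w"
        unfolding kop_pow_0_eq_ip w(2)[symmetric] by (rule ip_x_le_W[OF z])
      finally have 1: "ennreal (k a) * (kop (K 0) ^^ Suc n) G a \<le> ennreal (C * r 0 ^ Suc (Suc n)) * ennreal w" .
      have "ennreal (1 / r 0 ^ Suc n) * (kop (K 0) ^^ Suc n) G a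
          = ennreal (1 / r 0 ^ Suc n * (1 / k a)) * (ennreal (k a) * (kop (K 0) ^^ Suc n) G a)"
        using k(1)[of a] r by (subst ennreal_mult_left) auto
      also have "\<dots> \<le> ennreal (1 / r 0 ^ Suc n * (1 / k a)) * (ennreal (C * r 0 ^ Suc (Suc n)) * ennreal w)"
        by (intro mult_left_mono 1) auto
      also have "\<dots> = ennreal (1 / r 0 ^ Suc n * (1 / k a) * (C * r 0 ^ Suc (Suc n) * w))"
        using k(1)[of a] r C_pos w by (simp add: ennreal_mult[symmetric] less_imp_le)
      also have "1 / r 0 ^ Suc n * (1 / k a) * (C * r 0 ^ Suc (Suc n) * w) = C * r 0 * w / k a"
        using k(1)[of a] r by (simp add: field_simps)
      also have "\<dots> \<le> (\<Sum>a<M. C * r 0 * w / k a)"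
        using False nn by (intro member_le_sum) auto
      also have "\<dots> \<le> A" by (simp add: A_def)
      finally show ?thesis by (simp add: ennreal_leI)
    qed
  qed
  with A show ?thesis by (intro that[of A]) auto
qed

lemma g_tendsto:
  assumes G: "\<And>a. G a \<le> 1"
  shows "(\<lambda>n. ennreal (1 / r 0 ^ n) * (kop (K 0) ^^ n) G a) \<longlonglongrightarrow> h 0 a / h 0 0 * ip (h 0) G"
proof -
  have z: "0 \<le> (0::real)" "0 \<le> t0" using t0 by auto
  obtain k where k: "0 \<le> k" "\<And>n b. E 0 n b a \<le> ennreal k * W b" using E_le_W''[OF z] by blast
  have "(\<lambda>n. ip (\<lambda>b. E 0 n b a) G) \<longlonglongrightarrow> ip (\<lambda>b. H 0 b a) G"
    by (rule ip_tendsto[where w = "\<lambda>_. 1", OF E_tendsto(1)[OF z] tendsto_const k(2) G])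
      (auto intro!: ip_W_finite_bounded[of _ 1])
  moreover have "ip (\<lambda>b. E 0 n b a) G = ennreal (1 / r 0 ^ n) * (kop (K 0) ^^ n) G a" for n
    unfolding E_sym[of 0 n _ a] by (simp add: E_def kop_pow_eq_P ip_cmult_left)
  moreover have "ip (\<lambda>b. H 0 b a) G = h 0 a / h 0 0 * ip (h 0) G"
    by (subst H_eq[OF z]) (rule ip_cmult_left)
  ultimately show ?thesis by simp
qed

text \<open>The contribution of the coordinate after j of j + m steps, that is, of the down-steps
  across one bond, on the scale \<open>r 0 ^ (j + m)\<close> of the partition function.\<close>

definition cross :: "(nat \<Rightarrow> ennreal) \<Rightarrow> nat \<Rightarrow> nat \<Rightarrow> real" where
  "cross G j m = enn2real (ip (times_id (x 0 j)) ((kop (K 0) ^^ m) G)) / r 0 ^ (j + m)"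

text \<open>After normalisation \<open>x 0 j\<close> tends to \<open>h 0\<close>, and the m-th
  iterate of G tends to the multiple \<open>ip (h 0) G / h 0 0\<close> of \<open>h 0\<close>. The
  former is dominated by W and the latter is bounded, so the pairing converges as both indices
  grow.\<close>

lemma cross:
  assumes G: "\<And>a. G a \<le> 1"
  shows cross_eq: "ip (times_id (x 0 j)) ((kop (K 0) ^^ m) G) = ennreal (cross G j m * r 0 ^ (j + m))"
    and cross_bounded: "\<exists>B. \<forall>j m. cross G j m \<le> B"
    and cross_nonneg: "0 \<le> cross G j m"
    and cross_tendsto: "filterlim J at_top sequentially \<Longrightarrow> filterlim Q at_top sequentially \<Longrightarrow>
      (\<lambda>i. cross G (J i) (Q i)) \<longlonglongrightarrow> mean * enn2real (ip (h 0) G)"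
proof -
  have z: "0 \<le> (0::real)" "0 \<le> t0" using t0 by auto
  have r: "0 < r 0" using r_pos[of 0] by simp
  define g where "g n a = ennreal (1 / r 0 ^ n) * (kop (K 0) ^^ n) G a" for n a
  obtain A where A: "0 < A" "\<And>n a. g n a \<le> ennreal A" using g_bounded[of G, OF G] unfolding g_def by blast
  have eq: "ip (\<lambda>a. E 0 j a 0) (times_id (g m)) = ennreal (1 / r 0 ^ (j + m)) * ip (times_id (x 0 j)) ((kop (K 0) ^^ m) G)" for j m
  proof -
    have "ip (\<lambda>a. E 0 j a 0) (times_id (g m)) = ennreal (1 / r 0 ^ j) * (ennreal (1 / r 0 ^ m) * ip (times_id (x 0 j)) ((kop (K 0) ^^ m) G))"
      by (simp only: ip_cmult_left[symmetric] ip_cmult_right[symmetric])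
        (simp add: ip_def E_def g_def times_id_def x_eq_P mult_ac)
    also have "\<dots> = ennreal (1 / r 0 ^ (j + m)) * ip (times_id (x 0 j)) ((kop (K 0) ^^ m) G)"
      using r by (subst ennreal_mult_left) (auto simp: power_add)
    finally show ?thesis .
  qed
  define B where "B = enn2real (ennreal C * ip W (\<lambda>a. ennreal (real a) * ennreal A))"
  have finA: "ip W (\<lambda>a. ennreal (real a) * ennreal A) < \<top>"
  proof (rule ip_W_finite[of _ A])
    show "ennreal (real a) * ennreal A \<le> ennreal A * ennreal (1 + real a)" for a
      by (subst mult.commute) (intro mult_left_mono ennreal_leI, auto)
  qed
  have B: "ennreal C * ip W (\<lambda>a. ennreal (real a) * ennreal A) = ennreal B" "0 \<le> B"
    using finA by (auto simp: B_def ennreal_mult_less_top)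
  have bd: "ip (\<lambda>a. E 0 j a 0) (times_id (g m)) \<le> ennreal B" for j m
    unfolding B(1)[symmetric] ip_cmult_left[symmetric]
    using E_le_W[OF z] mult_left_mono[OF A(2)] by (intro ip_mono) (auto simp: times_id_def)
  have fin: "ip (times_id (x 0 j)) ((kop (K 0) ^^ m) G) < \<top>" for j m
    using le_less_trans[OF bd[of j m], of \<top>] r unfolding eq by (auto simp: ennreal_mult_less_top)
  show eq': "ip (times_id (x 0 j)) ((kop (K 0) ^^ m) G) = ennreal (cross G j m * r 0 ^ (j + m))" for j m
    using fin[of j m] r by (simp add: cross_def)
  show nn: "0 \<le> cross G j m" for j m using r by (simp add: cross_def)
  have c: "ip (\<lambda>a. E 0 j a 0) (times_id (g m)) = ennreal (cross G j m)" for j m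
    unfolding eq eq' using r nn[of j m] by (simp add: ennreal_mult[symmetric])
  have "cross G j m \<le> B" for j m
    using bd[of j m] B(2) unfolding c by (simp add: ennreal_le_iff)
  then show "\<exists>B. \<forall>j m. cross G j m \<le> B" by blast
  assume JQ: "filterlim J at_top sequentially" "filterlim Q at_top sequentially"
  have "(\<lambda>i. ip (\<lambda>a. E 0 (J i) a 0) (times_id (g (Q i)))) \<longlonglongrightarrow> ip (h 0) (times_id (\<lambda>a. h 0 a / h 0 0 * ip (h 0) G))"
  proof (rule ip_tendsto[where k = C and w = "\<lambda>a. ennreal (real a) * ennreal A"])
    show "(\<lambda>i. E 0 (J i) a 0) \<longlonglongrightarrow> h 0 a" for a by (rule filterlim_compose[OF E_tendsto(1)[OF z] JQ(1)])
    show "(\<lambda>i. times_id (g (Q i)) a) \<longlonglongrightarrow> times_id (\<lambda>a. h 0 a / h 0 0 * ip (h 0) G) a" for a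
      unfolding times_id_def g_def
      by (intro ennreal_tendsto_cmult filterlim_compose[OF g_tendsto[of G, OF G] JQ(2)]) auto
  qed (use E_le_W[OF z] A(2) finA in \<open>auto simp: times_id_def ennreal_mult_less_top intro!: mult_left_mono\<close>)
  moreover have "ip (h 0) (times_id (\<lambda>a. h 0 a / h 0 0 * ip (h 0) G)) = ennreal (mean * enn2real (ip (h 0) G))"
  proof -
    define c where "c = enn2real (h 0 0)"
    have c: "0 < c" "h 0 0 = ennreal c"
      using h_0_pos[OF z] H_less_top[OF z, of 0 0] by (auto simp: c_def enn2real_positive_iff)
    define m where "m = enn2real (ip (times_id (h 0)) (h 0))"
    have m: "0 \<le> m" "ip (times_id (h 0)) (h 0) = ennreal m" using ip_times_id_h by (auto simp: m_def)
    have Gf: "ip (h 0) G = ennreal (enn2real (ip (h 0) G))"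
      using ip_h_finite[OF z ip_W_finite_bounded[of G 1]] G by simp
    have "ip (h 0) (times_id (\<lambda>a. h 0 a / h 0 0 * ip (h 0) G)) = ip (times_id (h 0)) (\<lambda>a. (inverse (h 0 0) * ip (h 0) G) * h 0 a)"
      by (simp add: ip_def times_id_def divide_ennreal_def mult_ac)
    also have "\<dots> = (inverse (ennreal c) * ennreal (enn2real (ip (h 0) G))) * ennreal m"
      unfolding ip_cmult_right m(2) c(2) by (subst Gf) (rule refl)
    also have "\<dots> = ennreal (inverse c * enn2real (ip (h 0) G) * m)"
      using c m by (simp add: inverse_ennreal ennreal_mult[symmetric])
    finally show ?thesis using c by (simp add: mean_def m_def[symmetric] c_def[symmetric] field_simps)
  qed
  ultimately have "(\<lambda>i. ennreal (cross G (J i) (Q i))) \<longlonglongrightarrow> ennreal (mean * enn2real (ip (h 0) G))"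
    by (simp add: c)
  then show "(\<lambda>i. cross G (J i) (Q i)) \<longlonglongrightarrow> mean * enn2real (ip (h 0) G)"
    using nn mean_pos by (subst (asm) tendsto_ennreal_iff) auto
qed

text \<open>Leibniz rule for minus the derivative at t = 0 of the y-th power of \<open>K t\<close>
  applied to a fixed G: the factor number j is replaced by \<open>L\<close>.\<close>

definition first_moment :: "(nat \<Rightarrow> ennreal) \<Rightarrow> nat \<Rightarrow> ennreal" where
  "first_moment G y = (\<Sum>j<y. ip (x 0 j) (kop L ((kop (K 0) ^^ (y - 1 - j)) G)))"

text \<open>The summand 1 of 1 + a + b gives y copies of the partition function. In the term j, a is
  the coordinate after j steps and b the one after j + 1 steps, whence the shifted indices in the
  last sum.\<close>

lemma first_moment_eq:
  assumes G: "\<And>a. G a \<le> 1"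
  shows "first_moment G y = of_nat y * (kop (K 0) ^^ y) G 0
    + ennreal ((\<Sum>j<y. cross G j (y - j)) * r 0 ^ y) + ennreal ((\<Sum>j<y. cross G (Suc j) (y - j - 1)) * r 0 ^ y)"
proof -
  have r: "0 < r 0" using r_pos[of 0] by simp
  have "ip (x 0 j) (kop L ((kop (K 0) ^^ (y - 1 - j)) G)) = (kop (K 0) ^^ y) G 0
      + ennreal (cross G j (y - j) * r 0 ^ y) + ennreal (cross G (Suc j) (y - j - 1) * r 0 ^ y)" if "j < y" for j
  proof -
    define n where "n = y - 1 - j"
    have n: "Suc n = y - j" "n = y - j - 1" "j + Suc n = y" "Suc j + n = y" using that by (auto simp: n_def)
    have K: "kop (K 0) ((kop (K 0) ^^ n) G) = (kop (K 0) ^^ Suc n) G" by simp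
    have "ip (x 0 j) (kop L ((kop (K 0) ^^ n) G)) = ip (x 0 j) ((kop (K 0) ^^ Suc n) G)
        + ip (times_id (x 0 j)) ((kop (K 0) ^^ Suc n) G) + ip (x 0 (Suc j)) (times_id ((kop (K 0) ^^ n) G))"
      unfolding ip_kop_L K by (simp only: x_Suc ip_kop_K[symmetric])
    also have "ip (x 0 j) ((kop (K 0) ^^ Suc n) G) = (kop (K 0) ^^ y) G 0"
      unfolding ip_x n(3) ..
    also have "ip (x 0 (Suc j)) (times_id ((kop (K 0) ^^ n) G)) = ip (times_id (x 0 (Suc j))) ((kop (K 0) ^^ n) G)"
      by (simp add: ip_def times_id_def mult_ac)
    finally show ?thesis
      unfolding n_def[symmetric] cross_eq[of G, OF G] n(3,4) by (simp add: n(1)[symmetric])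
  qed
  then have "first_moment G y = (\<Sum>j<y. (kop (K 0) ^^ y) G 0 + ennreal (cross G j (y - j) * r 0 ^ y)
      + ennreal (cross G (Suc j) (y - j - 1) * r 0 ^ y))"
    unfolding first_moment_def by (intro sum.cong) auto
  also have "\<dots> = of_nat y * (kop (K 0) ^^ y) G 0 + ennreal (\<Sum>j<y. cross G j (y - j) * r 0 ^ y)
      + ennreal (\<Sum>j<y. cross G (Suc j) (y - j - 1) * r 0 ^ y)"
    using cross_nonneg[of G, OF G] r by (simp add: sum.distrib sum_ennreal)
  finally show ?thesis by (simp add: sum_distrib_right)
qed

text \<open>The two sums in \<open>first_moment_eq\<close> are Cesaro sums of \<open>cross\<close>,
  each with limit mean times \<open>ip (h 0) G\<close>. The gap between the bounds on T is O(r 0 ^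
  y), the order of the partition function, so it vanishes after the additional division by
  y.\<close>

lemma mean_time_tendsto:
  assumes G: "\<And>a. G a \<le> 1" "G 0 = 1" and c: "0 \<le> c"
    and lower: "\<And>y. first_moment G y \<le> T y"
    and upper: "\<And>y. T y \<le> first_moment G y + ennreal c * ip (x 0 y) (\<lambda>a. ennreal (real a))"
  shows "(\<lambda>y. T y / (kop (K 0) ^^ y) G 0 / ennreal (real y)) \<longlonglongrightarrow> ennreal (1 + 2 * mean)"
proof -
  have z: "0 \<le> (0::real)" "0 \<le> t0" using t0 by auto
  have r: "0 < r 0" using r_pos[of 0] by simp
  define g where "g = enn2real (ip (h 0) G)"
  have g: "0 < g" "ip (h 0) G = ennreal g" using ip_h_G[where G = G, OF z G] by (auto simp: g_def enn2real_positive_iff)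
  define z where "z n = enn2real ((kop (K 0) ^^ n) G 0)" for n
  have fin: "(kop (K 0) ^^ n) G 0 < \<top>" for n
    using kop_K_le_const[of 0 G 1 n 0] G(1) by (auto intro: le_less_trans)
  have zeq: "(kop (K 0) ^^ n) G 0 = ennreal (z n)" for n using fin[of n] by (simp add: z_def)
  have zpos: "0 < z n" for n
  proof -
    have "0 < x 0 n 0 * G 0" using x_0_pos[of 0 n] G by simp
    also have "\<dots> \<le> (kop (K 0) ^^ n) G 0" unfolding kop_pow_0_eq_ip by (rule ip_ge)
    finally show ?thesis using fin[of n] by (simp add: z_def enn2real_positive_iff)
  qed
  have "(\<lambda>n. ennreal (z n / r 0 ^ n)) \<longlonglongrightarrow> ennreal g"
    using Z_tendsto[of 0 G] t0 G(1) r zpos by (simp add: zeq g(2) ennreal_mult[symmetric] less_imp_le)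
  then have zlim: "(\<lambda>n. z n / r 0 ^ n) \<longlonglongrightarrow> g"
    using zpos r g by (subst (asm) tendsto_ennreal_iff) (auto simp: less_imp_le)
  obtain B where B: "\<And>j m. cross G j m \<le> B" using cross_bounded[of G, OF G(1)] by blast
  have mg: "0 < mean * g" using mean_pos g by simp
  have bd: "\<bar>cross G j m - mean * g\<bar> \<le> B + mean * g" for j m
    using cross_nonneg[of G j m, OF G(1)] B[of j m] mg by linarith
  have dl: "\<exists>J. \<forall>j\<ge>J. \<forall>m\<ge>J. \<bar>cross G j m - mean * g\<bar> < \<epsilon>" if "0 < \<epsilon>" for \<epsilon>
    unfolding g_def by (rule double_limit_from_sequences[OF cross_tendsto[of G, OF G(1)] that])
  have dl': "\<exists>J. \<forall>j\<ge>J. \<forall>m\<ge>J. \<bar>cross G (Suc j) (m - 1) - mean * g\<bar> < \<epsilon>" if \<epsilon>: "0 < \<epsilon>" for \<epsilon>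
  proof -
    obtain J where "\<forall>j\<ge>J. \<forall>m\<ge>J. \<bar>cross G j m - mean * g\<bar> < \<epsilon>" using dl[OF \<epsilon>] by blast
    then show ?thesis by (intro exI[of _ "Suc J"]) auto
  qed
  define X where "X y = z y + (\<Sum>j<y. cross G j (y - j)) / real y * r 0 ^ y + (\<Sum>j<y. cross G (Suc j) (y - j - 1)) / real y * r 0 ^ y" for y
  have Xlim: "(\<lambda>y. X y / r 0 ^ y) \<longlonglongrightarrow> g + mean * g + mean * g"
  proof -
    have "(\<lambda>y. z y / r 0 ^ y + (\<Sum>j<y. cross G j (y - j)) / real y + (\<Sum>j<y. cross G (Suc j) (y - j - 1)) / real y) \<longlonglongrightarrow> g + mean * g + mean * g"
      by (intro tendsto_add zlim double_Cesaro[OF bd dl] double_Cesaro[OF bd dl'])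
    then show ?thesis using r by (simp add: X_def add_divide_distrib)
  qed
  define e where "e = enn2real (ip W (\<lambda>a. ennreal (real a)))"
  have e: "ip W (\<lambda>a. ennreal (real a)) = ennreal e" "0 \<le> e"
  proof -
    have "ip W (\<lambda>a. ennreal (real a)) < \<top>"
      by (rule ip_W_finite[of _ 1]) (auto simp del: ennreal_plus intro!: ennreal_leI)
    then show "ip W (\<lambda>a. ennreal (real a)) = ennreal e" by (simp add: e_def)
  qed (simp add: e_def)
  have fm: "first_moment G y = ennreal (real y * X y)" if "0 < y" for y
  proof -
    have "first_moment G y = ennreal (real y * z y + (\<Sum>j<y. cross G j (y - j)) * r 0 ^ y + (\<Sum>j<y. cross G (Suc j) (y - j - 1)) * r 0 ^ y)"
      unfolding first_moment_eq[of G, OF G(1)] zeq ennreal_of_nat_eq_real_of_nat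
      using zpos[of y] r cross_nonneg[of G, OF G(1)]
      by (simp add: ennreal_mult[symmetric] sum_nonneg less_imp_le flip: ennreal_plus)
    also have "real y * z y + (\<Sum>j<y. cross G j (y - j)) * r 0 ^ y + (\<Sum>j<y. cross G (Suc j) (y - j - 1)) * r 0 ^ y = real y * X y"
      using that by (simp add: X_def field_simps)
    finally show ?thesis .
  qed
  have Xnn: "0 \<le> X y" for y
    unfolding X_def using zpos[of y] r cross_nonneg[of G, OF G(1)]
    by (intro add_nonneg_nonneg mult_nonneg_nonneg divide_nonneg_nonneg sum_nonneg) (auto simp: less_imp_le)
  have lo: "ennreal (X y / z y) \<le> T y / (kop (K 0) ^^ y) G 0 / ennreal (real y)" if "0 < y" for y
  proof -
    have "ennreal (X y / z y) = ennreal (real y * X y) / ennreal (z y) / ennreal (real y)"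
      using that zpos[of y] Xnn[of y] by (simp add: divide_ennreal)
    also have "\<dots> \<le> T y / (kop (K 0) ^^ y) G 0 / ennreal (real y)"
      using lower[of y] unfolding zeq fm[OF that] by (intro divide_right_mono_ennreal)
    finally show ?thesis .
  qed
  have up: "T y / (kop (K 0) ^^ y) G 0 / ennreal (real y) \<le> ennreal (X y / z y + c * C * e * (r 0 ^ y / z y) / real y)" if "0 < y" for y
  proof -
    have "T y \<le> first_moment G y + ennreal c * (ennreal (C * r 0 ^ y) * ennreal e)"
      by (rule order_trans[OF upper]) (unfold e(1)[symmetric], intro add_left_mono mult_left_mono ip_x_le_W, use t0 in auto)
    also have "\<dots> = ennreal (real y * X y + c * (C * r 0 ^ y * e))"
      unfolding fm[OF that] using Xnn[of y] c C_pos r e(2)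
      by (simp add: ennreal_mult[symmetric] less_imp_le flip: ennreal_plus)
    finally have "T y / (kop (K 0) ^^ y) G 0 / ennreal (real y) \<le> ennreal (real y * X y + c * (C * r 0 ^ y * e)) / ennreal (z y) / ennreal (real y)"
      unfolding zeq by (intro divide_right_mono_ennreal)
    also have "\<dots> = ennreal ((real y * X y + c * (C * r 0 ^ y * e)) / z y / real y)"
      using that zpos[of y] Xnn[of y] c C_pos r e(2) by (simp add: divide_ennreal del: ennreal_plus)
    also have "(real y * X y + c * (C * r 0 ^ y * e)) / z y / real y = X y / z y + c * C * e * (r 0 ^ y / z y) / real y"
      using that zpos[of y] by (simp add: field_simps)
    finally show ?thesis .
  qed
  have Xz: "(\<lambda>y. X y / z y) \<longlonglongrightarrow> 1 + 2 * mean"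
  proof -
    have "(\<lambda>y. (X y / r 0 ^ y) / (z y / r 0 ^ y)) \<longlonglongrightarrow> (g + mean * g + mean * g) / g"
      using g by (intro tendsto_divide Xlim zlim) auto
    moreover have "(g + mean * g + mean * g) / g = 1 + 2 * mean" using g by (simp add: field_simps)
    ultimately show ?thesis using r by simp
  qed
  have "(\<lambda>y. X y / z y + c * C * e * (r 0 ^ y / z y) / real y) \<longlonglongrightarrow> (1 + 2 * mean) + c * C * e * (1 / g) * 0"
  proof -
    have "(\<lambda>y. 1 / (z y / r 0 ^ y)) \<longlonglongrightarrow> 1 / g" using g by (intro tendsto_divide zlim tendsto_const) auto
    then have "(\<lambda>y. r 0 ^ y / z y) \<longlonglongrightarrow> 1 / g" by simp
    then have "(\<lambda>y. X y / z y + c * C * e * (r 0 ^ y / z y) * (1 / real y)) \<longlonglongrightarrow> (1 + 2 * mean) + c * C * e * (1 / g) * 0"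
      by (intro tendsto_add tendsto_mult tendsto_const Xz lim_1_over_n)
    then show ?thesis by simp
  qed
  then have "(\<lambda>y. ennreal (X y / z y + c * C * e * (r 0 ^ y / z y) / real y)) \<longlonglongrightarrow> ennreal (1 + 2 * mean)"
    by (intro tendsto_ennrealI) simp
  then show ?thesis
    by (rule tendsto_sandwich[rotated -1, where f = "\<lambda>y. ennreal (X y / z y)", OF _ _ _ tendsto_ennrealI[OF Xz]])
      (use lo up in \<open>auto intro: eventually_sequentiallyI[of 1]\<close>)
qed

text \<open>Size biasing turns row a of p into a multiple of row a + 1, so that the row sums of
  \<open>L\<close> grow only linearly.\<close>

lemma pk_weighted: "real (1 + a + b) * pk a b = 2 * real (a + 1) * pk (a + 1) b"
proof -
  have "(a + b + 1) * ((a + b) choose a) = ((a + b + 1) choose (a + 1)) * (a + 1)"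
    using Suc_times_binomial_eq[of "a + b" a] by simp
  then have "real ((a + b + 1) * ((a + b) choose a)) = real (((a + b + 1) choose (a + 1)) * (a + 1))"
    by (simp only:)
  then have e: "real (a + b + 1) * real ((a + b) choose a) = real (a + 1) * real ((a + b + 1) choose (a + 1))"
    by (simp only: of_nat_mult mult.commute)
  have "1 + a + b = a + b + 1" "a + 1 + b = a + b + 1" by auto
  then have "real (1 + a + b) * pk a b = real (a + b + 1) * real ((a + b) choose a) / 2 ^ (a + b + 1)"
    and "2 * real (a + 1) * pk (a + 1) b = real (a + 1) * real ((a + b + 1) choose (a + 1)) / 2 ^ (a + b + 1)"
    by (simp_all only: pk_def) (simp_all add: field_simps del: binomial_Suc_Suc)
  then show ?thesis using e by simp
qed

lemma L_row_sum: "(\<integral>\<^sup>+b. L a b \<partial>count_space UNIV) \<le> ennreal 2 * ennreal (1 + real a)"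
proof -
  have "(\<integral>\<^sup>+b. L a b \<partial>count_space UNIV) \<le> (\<integral>\<^sup>+b. ennreal (2 * real (a + 1)) * pe (a + 1) b \<partial>count_space UNIV)"
  proof (intro nn_integral_mono)
    fix b
    have "L a b \<le> ennreal (real (1 + a + b)) * pe a b"
      unfolding L_def by (intro mult_left_mono K_le_pe) auto
    also have "\<dots> = ennreal (real (1 + a + b) * pk a b)" by (simp only: ennreal_mult' of_nat_0_le_iff)
    also have "\<dots> = ennreal (2 * real (a + 1)) * pe (a + 1) b"
      unfolding pk_weighted by (rule ennreal_mult') simp
    finally show "L a b \<le> ennreal (2 * real (a + 1)) * pe (a + 1) b" .
  qed
  also have "\<dots> = ennreal (2 * real (a + 1)) * kop pe (\<lambda>_. 1) (a + 1)"
    by (simp add: nn_integral_cmult kop_def)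
  also have "\<dots> = ennreal 2 * ennreal (1 + real a)"
    unfolding kop_pe_const by (simp add: ennreal_mult add_ac)
  finally show ?thesis .
qed

text \<open>Telescoping: the factors \<open>K 0\<close> are exchanged for \<open>K t\<close> one at
  a time, each exchange costing t \<open>Kd t\<close>.\<close>

lemma kop_K0_pow_split:
  assumes t: "0 < t"
  shows "i \<le> y \<Longrightarrow> (kop (K 0) ^^ i) ((kop (K t) ^^ (y - i)) G) 0 = (kop (K t) ^^ y) G 0
    + ennreal t * (\<Sum>j<i. ip (x 0 j) (kop (Kd t) ((kop (K t) ^^ (y - 1 - j)) G)))"
proof (induction i)
  case (Suc i)
  define f where "f = (kop (K t) ^^ (y - Suc i)) G"
  have f: "(kop (K t) ^^ (y - i)) G = kop (K t) f"
    using Suc.prems by (simp add: f_def Suc_diff_Suc flip: funpow.simps(2)[unfolded comp_def, THEN fun_cong])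
  have "kop (K 0) f = (\<lambda>a. kop (K t) f a + ennreal t * kop (Kd t) f a)"
    by (rule ext) (rule kop_K_split[OF t])
  then have "(kop (K 0) ^^ Suc i) f 0 = (kop (K 0) ^^ i) (kop (K t) f) 0 + ennreal t * (kop (K 0) ^^ i) (kop (Kd t) f) 0"
    by (simp only: funpow_Suc_right comp_def kop_pow_add kop_pow_cmult)
  also have "(kop (K 0) ^^ i) (kop (Kd t) f) 0 = ip (x 0 i) (kop (Kd t) f)"
    by (rule kop_pow_0_eq_ip)
  also have "(kop (K 0) ^^ i) (kop (K t) f) 0 = (kop (K t) ^^ y) G 0
      + ennreal t * (\<Sum>j<i. ip (x 0 j) (kop (Kd t) ((kop (K t) ^^ (y - 1 - j)) G)))"
    using Suc by (simp add: f)
  finally show ?case by (simp add: f_def distrib_left add.assoc)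
qed simp

text \<open>\<open>H1\<close> and \<open>H2\<close> describe T as the least A with Z(0) <= Z(t) + t
  A for all small t, where both kernel and boundary weight depend on t. The upper bound exhibits
  such an A, with the Lipschitz error of G as second summand. The lower bound counts only the change
  of the kernel and then lets t tend to 0.\<close>

lemma first_moment_bounds:
  fixes G :: "real \<Rightarrow> nat \<Rightarrow> ennreal"
  assumes G1: "\<And>a. G 0 a \<le> 1"
    and Gle: "\<And>t a. 0 < t \<Longrightarrow> t \<le> t0 \<Longrightarrow> G t a \<le> G 0 a"
    and Gge: "\<And>t a. 0 < t \<Longrightarrow> t \<le> t0 \<Longrightarrow> G 0 a \<le> G t a + ennreal (c * t * real a)"
    and c: "0 \<le> c"
    and H1: "\<And>t. 0 < t \<Longrightarrow> t \<le> t0 \<Longrightarrow> (kop (K 0) ^^ y) (G 0) 0 \<le> (kop (K t) ^^ y) (G t) 0 + ennreal t * T"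
    and H2: "\<And>A. (\<And>t. 0 < t \<Longrightarrow> t \<le> t0 \<Longrightarrow> (kop (K 0) ^^ y) (G 0) 0 \<le> (kop (K t) ^^ y) (G t) 0 + ennreal t * A) \<Longrightarrow> T \<le> A"
  shows "first_moment (G 0) y \<le> T"
    and "T \<le> first_moment (G 0) y + ennreal c * ip (x 0 y) (\<lambda>a. ennreal (real a))"
proof -
  define \<Sigma> where "\<Sigma> t = (\<Sum>j<y. ip (x 0 j) (kop (Kd t) ((kop (K t) ^^ (y - 1 - j)) (G t))))" for t
  have split: "(kop (K 0) ^^ y) (G t) 0 = (kop (K t) ^^ y) (G t) 0 + ennreal t * \<Sigma> t" if "0 < t" for t
    using kop_K0_pow_split[OF that, of y y "G t"] by (simp add: \<Sigma>_def)
  have Gt1: "G t a \<le> 1" if "0 < t" "t \<le> t0" for t a using Gle[OF that] G1 by (rule order_trans)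
  show "T \<le> first_moment (G 0) y + ennreal c * ip (x 0 y) (\<lambda>a. ennreal (real a))"
  proof (rule H2)
    fix t assume t: "0 < t" "t \<le> t0"
    have "(kop (K 0) ^^ y) (G 0) 0 \<le> (kop (K 0) ^^ y) (\<lambda>a. G t a + ennreal (c * t) * ennreal (real a)) 0"
      using Gge[OF t] c t by (intro kop_pow_mono) (auto simp: ennreal_mult'')
    also have "\<dots> = (kop (K 0) ^^ y) (G t) 0 + ennreal (c * t) * ip (x 0 y) (\<lambda>a. ennreal (real a))"
      by (simp add: kop_pow_add kop_pow_cmult kop_pow_0_eq_ip)
    also have "\<dots> = (kop (K t) ^^ y) (G t) 0 + ennreal t * (\<Sigma> t + ennreal c * ip (x 0 y) (\<lambda>a. ennreal (real a)))"
      using t c by (simp add: split distrib_left ennreal_mult mult_ac add_ac)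
    also have "\<Sigma> t \<le> first_moment (G 0) y"
      unfolding \<Sigma>_def first_moment_def
    proof (intro sum_mono ip_mono order_refl)
      fix j a assume "j \<in> {..<y}"
      show "kop (Kd t) ((kop (K t) ^^ (y - 1 - j)) (G t)) a \<le> kop L ((kop (K 0) ^^ (y - 1 - j)) (G 0)) a"
        using t by (intro kop_mono Kd_le_L kop_pow_mono K_mono Gle) auto
    qed
    finally show "(kop (K 0) ^^ y) (G 0) 0 \<le> (kop (K t) ^^ y) (G t) 0
        + ennreal t * (first_moment (G 0) y + ennreal c * ip (x 0 y) (\<lambda>a. ennreal (real a)))"
      by (simp add: add_left_mono mult_left_mono)
  qed
  \<comment> \<open>With the boundary weight frozen at \<open>G t \<le> G 0\<close> the change of
    the kernel alone stays below t T; the common finite term is cancelled.\<close>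
  have \<Sigma>T: "\<Sigma> t \<le> T" if t: "0 < t" "t \<le> t0" for t
  proof -
    have "(kop (K t) ^^ y) (G t) 0 + ennreal t * \<Sigma> t \<le> (kop (K 0) ^^ y) (G 0) 0"
      unfolding split[OF t(1), symmetric] by (intro kop_pow_mono Gle t) auto
    also have "\<dots> \<le> (kop (K t) ^^ y) (G t) 0 + ennreal t * T" by (rule H1[OF t])
    finally have "(kop (K t) ^^ y) (G t) 0 + ennreal t * \<Sigma> t \<le> (kop (K t) ^^ y) (G t) 0 + ennreal t * T" .
    moreover have "(kop (K t) ^^ y) (G t) 0 \<noteq> \<top>"
      using kop_K_le_const[where f = "G t" and c = 1 and t = t and n = y and a = 0] Gt1[OF t] t
      by (auto simp: top_unique)
    ultimately have "ennreal t * \<Sigma> t \<le> ennreal t * T" by (simp add: ennreal_add_left_cancel_le)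
    then show ?thesis using t by (subst (asm) ennreal_mult_le_mult_iff) auto
  qed
  define S where "S i = t0 / real (Suc i)" for i
  have S: "0 < S i" "S i \<le> t0" "0 \<le> S i" for i
    using t0 by (auto simp: S_def field_simps)
  have S0: "S \<longlonglongrightarrow> 0"
    unfolding S_def using LIMSEQ_Suc[OF lim_const_over_n[of t0]] by simp
  have Glim: "(\<lambda>i. G (S i) a) \<longlonglongrightarrow> G 0 a" for a
  proof (rule tendsto_sandwich)
    show "\<forall>\<^sub>F i in sequentially. G 0 a - ennreal (c * S i * real a) \<le> G (S i) a"
      using Gge[OF S(1,2)] by (intro always_eventually allI) (simp add: ennreal_minus_le_iff add.commute)
    show "\<forall>\<^sub>F i in sequentially. G (S i) a \<le> G 0 a" using Gle[OF S(1,2)] by (intro always_eventually) auto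
    have "(\<lambda>i. ennreal (c * S i * real a)) \<longlonglongrightarrow> ennreal (c * 0 * real a)"
      by (intro tendsto_intros tendsto_ennrealI S0)
    then have "(\<lambda>i. G 0 a - ennreal (c * S i * real a)) \<longlonglongrightarrow> G 0 a - ennreal (c * 0 * real a)"
      using G1[of a] by (intro tendsto_diff_ennreal tendsto_const) (auto simp: top_unique)
    then show "(\<lambda>i. G 0 a - ennreal (c * S i * real a)) \<longlonglongrightarrow> G 0 a" by simp
  qed auto
  have "(\<lambda>i. \<Sigma> (S i)) \<longlonglongrightarrow> first_moment (G 0) y"
    unfolding \<Sigma>_def first_moment_def
  proof (intro tendsto_sum)
    fix j assume "j \<in> {..<y}"
    define n where "n = y - 1 - j"
    have p: "(\<lambda>i. (kop (K (S i)) ^^ n) (G (S i)) b) \<longlonglongrightarrow> (kop (K 0) ^^ n) (G 0) b" for b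
      using Gt1[OF S(1,2)] by (intro kop_pow_tendsto S S0 Glim)
    have le1: "(kop (K (S i)) ^^ n) (G (S i)) b \<le> 1" for i b
      using S(3) Gt1[OF S(1,2)] by (rule kop_K_le_const)
    have fin: "(kop (K 0) ^^ n) (G 0) b < \<top>" for b
      by (rule le_less_trans[OF kop_K_le_const[where c = 1, OF order_refl G1]]) simp
    have Lfin: "(\<integral>\<^sup>+b. L a b \<partial>count_space UNIV) < \<top>" for a
      by (rule le_less_trans[OF L_row_sum]) (simp add: ennreal_mult_less_top del: ennreal_plus)
    have bd: "Kd (S i) a b * (kop (K (S i)) ^^ n) (G (S i)) b \<le> L a b" for i a b
      using mult_mono[OF Kd_le_L[OF S(1)] le1] by simp
    have q: "(\<lambda>i. kop (Kd (S i)) ((kop (K (S i)) ^^ n) (G (S i))) a) \<longlonglongrightarrow> kop L ((kop (K 0) ^^ n) (G 0)) a" for a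
      unfolding kop_def[of "Kd _"] kop_def[of L]
    proof (rule nn_integral_dominated_convergence[where w = "L a"])
      show "AE b in count_space UNIV. (\<lambda>i. Kd (S i) a b * (kop (K (S i)) ^^ n) (G (S i)) b) \<longlonglongrightarrow> L a b * (kop (K 0) ^^ n) (G 0) b"
        by (intro AE_I2 tendsto_mult_ennreal Kd_tendsto S S0 p fin) (simp add: L_def ennreal_mult_less_top K_less_top)
    qed (use bd Lfin in auto)
    show "(\<lambda>i. ip (x 0 j) (kop (Kd (S i)) ((kop (K (S i)) ^^ (y - 1 - j)) (G (S i)))))
        \<longlonglongrightarrow> ip (x 0 j) (kop L ((kop (K 0) ^^ (y - 1 - j)) (G 0)))"
      unfolding n_def[symmetric]
    proof (rule ip_tendsto[OF tendsto_const q])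
      show "x 0 j a \<le> ennreal (C * u 0 j) * W a" for a using t0 by (intro x_le_W) auto
      show "kop (Kd (S i)) ((kop (K (S i)) ^^ n) (G (S i))) a \<le> (\<integral>\<^sup>+b. L a b \<partial>count_space UNIV)" for i a
        unfolding kop_def[of "Kd _"] using bd by (intro nn_integral_mono)
      show "ip W (\<lambda>a. \<integral>\<^sup>+b. L a b \<partial>count_space UNIV) < \<top>" by (rule ip_W_finite[OF L_row_sum])
    qed (rule Lfin)
  qed
  then show "first_moment (G 0) y \<le> T"
    by (rule LIMSEQ_le_const2) (use \<Sigma>T S in auto)
qed

end

section \<open>Crossing weights in a fixed environment\<close>

text \<open>The total weight of walks from x that reach y within N steps, where each visit to a site
  before y contributes its factor \<open>w\<close>. It is encoded by the first-step recursion, so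
  that facts about crossings become inductions on N.\<close>

fun hit_upto :: "(int \<Rightarrow> ennreal) \<Rightarrow> int \<Rightarrow> nat \<Rightarrow> int \<Rightarrow> ennreal" where
  "hit_upto w y 0 x = (if x = y then 1 else 0)"
| "hit_upto w y (Suc N) x = (if x = y then 1 else w x * (hit_upto w y N (x - 1) + hit_upto w y N (x + 1)) / 2)"

definition hit :: "(int \<Rightarrow> ennreal) \<Rightarrow> int \<Rightarrow> int \<Rightarrow> ennreal" where
  "hit w y x = (SUP N. hit_upto w y N x)"

lemma hit_upto_target [simp]: "hit_upto w y N y = 1"
  by (cases N) auto

lemma hit_target [simp]: "hit w y y = 1"
  by (simp add: hit_def)

lemma divide_2_mono: "a \<le> b \<Longrightarrow> a / 2 \<le> b / (2::ennreal)"
  by (rule divide_right_mono_ennreal)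

lemma hit_upto_mono_weight: "(\<And>z. w z \<le> w' z) \<Longrightarrow> hit_upto w y N x \<le> hit_upto w' y N x"
  by (induction N arbitrary: x) (auto intro!: divide_2_mono mult_mono add_mono)

lemma hit_upto_Suc_le: "hit_upto w y N x \<le> hit_upto w y (Suc N) x"
proof (induction N arbitrary: x)
  case (Suc N)
  show ?case
  proof (cases "x = y")
    case False
    then have "hit_upto w y (Suc N) x = w x * (hit_upto w y N (x - 1) + hit_upto w y N (x + 1)) / 2" by simp
    also have "\<dots> \<le> w x * (hit_upto w y (Suc N) (x - 1) + hit_upto w y (Suc N) (x + 1)) / 2"
      by (intro divide_2_mono mult_left_mono add_mono Suc) auto
    also have "\<dots> = hit_upto w y (Suc (Suc N)) x"
      using False by (simp only: hit_upto.simps(2)[of w y "Suc N" x] if_False)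
    finally show ?thesis .
  qed simp
qed auto

lemma hit_upto_incseq: "incseq (\<lambda>N. hit_upto w y N x)"
  by (rule incseq_SucI) (rule hit_upto_Suc_le)

lemma hit_upto_le_hit: "hit_upto w y N x \<le> hit w y x"
  unfolding hit_def by (rule SUP_upper) simp

lemma hit_upto_tendsto: "(\<lambda>N. hit_upto w y N x) \<longlonglongrightarrow> hit w y x"
  unfolding hit_def by (rule LIMSEQ_SUP) (rule hit_upto_incseq)

lemma hit_upto_le_1: "(\<And>z. w z \<le> 1) \<Longrightarrow> hit_upto w y N x \<le> 1"
proof (induction N arbitrary: x)
  case (Suc N)
  then have "w x * (hit_upto w y N (x - 1) + hit_upto w y N (x + 1)) / 2 \<le> 1 * (1 + 1) / 2"
    by (intro divide_2_mono mult_mono add_mono) auto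
  also have "\<dots> = 1" by (simp add: ennreal_divide_self)
  finally show ?case by simp
qed auto

lemma hit_le_1: "(\<And>z. w z \<le> 1) \<Longrightarrow> hit w y x \<le> 1"
  unfolding hit_def by (intro SUP_least hit_upto_le_1)

lemma hit_mono: "(\<And>z. w z \<le> w' z) \<Longrightarrow> hit w y x \<le> hit w' y x"
  unfolding hit_def by (intro SUP_mono') (rule hit_upto_mono_weight)

lemma hit_step: "x \<noteq> y \<Longrightarrow> (\<And>z. w z \<le> 1) \<Longrightarrow> hit w y x = w x * (hit w y (x - 1) + hit w y (x + 1)) / 2"
proof (rule LIMSEQ_unique)
  assume x: "x \<noteq> y" and w: "\<And>z. w z \<le> 1"
  show "(\<lambda>N. hit_upto w y (Suc N) x) \<longlonglongrightarrow> hit w y x"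
    by (intro LIMSEQ_Suc hit_upto_tendsto)
  have "(\<lambda>N. (w x / 2) * (hit_upto w y N (x - 1) + hit_upto w y N (x + 1))) \<longlonglongrightarrow> (w x / 2) * (hit w y (x - 1) + hit w y (x + 1))"
  proof (intro ennreal_tendsto_cmult tendsto_add hit_upto_tendsto)
    have "w x / 2 \<le> 1 / 2" using w by (rule divide_2_mono)
    also have "1 / 2 = ennreal (1 / 2)" using divide_ennreal[of 1 2] by simp
    also have "\<dots> < \<top>" by (rule ennreal_less_top)
    finally show "w x / 2 < \<top>" .
  qed
  then show "(\<lambda>N. hit_upto w y (Suc N) x) \<longlonglongrightarrow> w x * (hit w y (x - 1) + hit w y (x + 1)) / 2"
    using x by (simp add: ennreal_divide_times ennreal_times_divide mult_ac)
qed

lemma hit_upto_cong: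
  assumes "\<And>z. z < y \<Longrightarrow> w z = w' z"
  shows "x \<le> y \<Longrightarrow> hit_upto w y N x = hit_upto w' y N x"
  by (induction N arbitrary: x) (auto simp: assms)

lemma hit_cong: "(\<And>z. z < y \<Longrightarrow> w z = w' z) \<Longrightarrow> x \<le> y \<Longrightarrow> hit w y x = hit w' y x"
  unfolding hit_def using hit_upto_cong[of y w w' x] by simp

text \<open>Nearest-neighbour steps force a walk from x to z through the intermediate y; this is the
  strong Markov property there. Each inequality is an induction on the time horizon of one factor,
  followed by a limit.\<close>

lemma hit_mult:
  assumes w: "\<And>z. w z \<le> 1" and yz: "y \<le> z" and xy: "x \<le> y"
  shows "hit w z x = hit w y x * hit w z y"
proof (rule antisym)
  have "hit_upto w z N x \<le> hit w y x * hit w z y" if "x \<le> y" for N x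
    using that
  proof (induction N arbitrary: x)
    case 0
    then show ?case using yz by auto
  next
    case (Suc N)
    show ?case
    proof (cases "x = y")
      case True
      then show ?thesis using hit_upto_le_hit[of w z "Suc N" y] by simp
    next
      case False
      then have "x \<noteq> z" using Suc.prems yz by auto
      then have "hit_upto w z (Suc N) x = w x * (hit_upto w z N (x - 1) + hit_upto w z N (x + 1)) / 2" by simp
      also have "\<dots> \<le> w x * (hit w y (x - 1) * hit w z y + hit w y (x + 1) * hit w z y) / 2"
        using Suc False by (intro divide_2_mono mult_left_mono add_mono) auto
      also have "\<dots> = hit w y x * hit w z y"
        using False w by (subst hit_step[of x y]) (auto simp: divide_ennreal_def distrib_right distrib_left mult_ac)
      finally show ?thesis .
    qed
  qed
  then show "hit w z x \<le> hit w y x * hit w z y"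
    unfolding hit_def[of w z x] using xy by (intro SUP_least)
  have "hit_upto w y N x * hit w z y \<le> hit w z x" if "x \<le> y" for N x
    using that
  proof (induction N arbitrary: x)
    case (Suc N)
    show ?case
    proof (cases "x = y")
      case False
      then have "x \<noteq> z" using Suc.prems yz by auto
      have "hit_upto w y (Suc N) x * hit w z y = w x * (hit_upto w y N (x - 1) * hit w z y + hit_upto w y N (x + 1) * hit w z y) / 2"
        using False by (simp add: divide_ennreal_def distrib_right distrib_left mult_ac)
      also have "\<dots> \<le> w x * (hit w z (x - 1) + hit w z (x + 1)) / 2"
        using Suc False by (intro divide_2_mono mult_left_mono add_mono) auto
      also have "\<dots> = hit w z x" using \<open>x \<noteq> z\<close> w by (subst hit_step[of x z]) auto
      finally show ?thesis .
    qed simp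
  qed auto
  then have "(\<lambda>N. hit_upto w y N x) \<longlonglongrightarrow> hit w y x \<Longrightarrow> hit w y x * hit w z y \<le> hit w z x"
    using xy hit_le_1[of w z y, OF w]
    by (intro LIMSEQ_le_const2[of "\<lambda>N. hit_upto w y N x * hit w z y"])
      (auto intro!: tendsto_mult_ennreal le_less_trans[OF hit_le_1[of w, OF w]] le_less_trans[of "hit w z y" 1])
  then show "hit w y x * hit w z y \<le> hit w z x" using hit_upto_tendsto by blast
qed

text \<open>The crossing weight of the bond from \<open>z\<close> to \<open>z + 1\<close>; it is a continued fraction in the
  weights at \<open>z, z - 1, \<dots>\<close>.\<close>

definition cross_weight :: "(int \<Rightarrow> ennreal) \<Rightarrow> int \<Rightarrow> ennreal" where
  "cross_weight w z = hit w (z + 1) z"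

lemma cross_weight_le_1: "(\<And>z. w z \<le> 1) \<Longrightarrow> cross_weight w z \<le> 1"
  unfolding cross_weight_def by (rule hit_le_1)

lemma cross_weight_mono: "(\<And>z. w z \<le> w' z) \<Longrightarrow> cross_weight w z \<le> cross_weight w' z"
  unfolding cross_weight_def by (rule hit_mono)

lemma cross_weight_cong: "(\<And>i. i \<le> z \<Longrightarrow> w i = w' i) \<Longrightarrow> cross_weight w z = cross_weight w' z"
  unfolding cross_weight_def by (rule hit_cong) auto

lemma hit_eq_prod:
  assumes w: "\<And>z. w z \<le> 1"
  shows "hit w (int n) 0 = (\<Prod>z<n. cross_weight w (int z))"
proof (induction n)
  case (Suc n)
  have "hit w (int (Suc n)) 0 = hit w (int n) 0 * hit w (int (Suc n)) (int n)"
    by (rule hit_mult[OF w]) auto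
  then show ?case using Suc by (simp add: cross_weight_def add.commute)
qed simp

text \<open>From z the walk steps right and is done, or steps left and must cross the bond from z -
  1 and then the bond from z again.\<close>

lemma cross_weight_rec:
  assumes w: "\<And>z. w z \<le> 1"
  shows "cross_weight w z = w z * (cross_weight w (z - 1) * cross_weight w z + 1) / 2"
proof -
  have "hit w (z + 1) (z - 1) = hit w z (z - 1) * hit w (z + 1) z"
    by (rule hit_mult[OF w]) auto
  then show ?thesis
    unfolding cross_weight_def using hit_step[of z "z + 1" w] w by simp
qed

text \<open>The recursion is linear in the unknown weight, c (2 - e s) = e. It is solved in the
  reals, where the denominator is at least 1.\<close>

lemma cross_weight_real:
  fixes w :: "int \<Rightarrow> ennreal" and z :: int
  assumes w: "\<And>z. w z \<le> 1"
  defines "e \<equiv> enn2real (w z)" and "s \<equiv> enn2real (cross_weight w (z - 1))"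
  shows "enn2real (cross_weight w z) = e / (2 - e * s)"
    and "0 \<le> e" "e \<le> 1" "0 \<le> s" "s \<le> 1" "1 \<le> 2 - e * s"
proof -
  define c where "c = enn2real (cross_weight w z)"
  have fin: "w z < \<top>" "cross_weight w z < \<top>" for z
    using w[of z] cross_weight_le_1[of w z, OF w] by (auto intro: le_less_trans)
  have eq: "w z = ennreal e" "cross_weight w (z - 1) = ennreal s" "cross_weight w z = ennreal c"
    using fin by (auto simp: e_def s_def c_def)
  show e: "0 \<le> e" "e \<le> 1" "0 \<le> s" "s \<le> 1"
    using w[of z] cross_weight_le_1[of w "z - 1", OF w] by (auto simp: e_def s_def enn2real_leI)
  have c: "0 \<le> c" by (simp add: c_def)
  have es: "e * s \<le> 1" using e by (simp add: mult_le_one)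
  then show "1 \<le> 2 - e * s" by simp
  have "ennreal c = ennreal e * (ennreal s * ennreal c + 1) / 2"
    using cross_weight_rec[of w z, OF w] unfolding eq .
  also have "\<dots> = ennreal (e * (s * c + 1) / 2)"
    using e c by (simp add: ennreal_mult[symmetric] divide_ennreal[symmetric] flip: ennreal_1 ennreal_plus)
  finally have "c = e * (s * c + 1) / 2" using e c by (subst (asm) ennreal_inj) auto
  then have "c * (2 - e * s) = e" by (simp add: field_simps)
  then show "enn2real (cross_weight w z) = e / (2 - e * s)"
    unfolding c_def[symmetric] using es by (simp add: field_simps)
qed

text \<open>Expansion of (e / (2 - e s))^(d + 1) in powers of e s, by \<open>kop_pe_power\<close>.
  The exponent 1 + d + b is the number of visits to z when b of the departures go left.\<close>

lemma cross_weight_power: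
  assumes w: "\<And>z. w z \<le> 1"
  shows "cross_weight w z ^ (d + 1) = (\<integral>\<^sup>+b. pe d b * (w z ^ (1 + d + b) * cross_weight w (z - 1) ^ b) \<partial>count_space UNIV)"
proof -
  define e where "e = enn2real (w z)"
  define s where "s = enn2real (cross_weight w (z - 1))"
  note r = cross_weight_real[of w z, OF w, folded e_def s_def]
  have fin: "w z < \<top>" "cross_weight w z < \<top>" for z
    using w[of z] cross_weight_le_1[of w z, OF w] by (auto intro: le_less_trans)
  have eq: "w z = ennreal e" "cross_weight w (z - 1) = ennreal s"
    using fin by (auto simp: e_def s_def)
  have eq': "cross_weight w z = ennreal (e / (2 - e * s))"
    using ennreal_enn2real[OF fin(2)[of z]] by (simp only: r(1))
  have "(\<integral>\<^sup>+b. pe d b * (w z ^ (1 + d + b) * cross_weight w (z - 1) ^ b) \<partial>count_space UNIV)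
      = (\<integral>\<^sup>+b. ennreal (e ^ (d + 1)) * (pe d b * ennreal ((e * s) ^ b)) \<partial>count_space UNIV)"
    unfolding eq using r(2-5) pk_pos
    by (intro nn_integral_cong)
      (simp add: ennreal_power ennreal_mult[symmetric] less_imp_le power_add power_mult_distrib mult_ac)
  also have "\<dots> = ennreal (e ^ (d + 1)) * kop pe (\<lambda>b. ennreal ((e * s) ^ b)) d"
    by (simp add: kop_def nn_integral_cmult)
  also have "\<dots> = ennreal (e ^ (d + 1) * (1 / (2 - e * s)) ^ (d + 1))"
    using r(2-6) by (subst kop_pe_power) (auto simp: ennreal_mult[symmetric])
  also have "\<dots> = cross_weight w z ^ (d + 1)"
    unfolding eq' using r(2-6) by (subst ennreal_power) (auto simp: power_divide)
  finally show ?thesis ..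
qed

lemma measurable_hit_upto [measurable]:
  assumes [measurable]: "\<And>z. (\<lambda>\<omega>. w \<omega> z) \<in> borel_measurable M"
  shows "(\<lambda>\<omega>. hit_upto (w \<omega>) y N x) \<in> borel_measurable M"
proof (induction N arbitrary: x)
  case (Suc N)
  note Suc [measurable]
  show ?case by (cases "x = y") (simp_all)
qed simp

lemma measurable_cross_weight [measurable]:
  assumes [measurable]: "\<And>z. (\<lambda>\<omega>. w \<omega> z) \<in> borel_measurable M"
  shows "(\<lambda>\<omega>. cross_weight (w \<omega>) z) \<in> borel_measurable M"
  unfolding cross_weight_def hit_def by measurable

section \<open>Path weights of the simple random walk\<close>

definition walk :: "int \<Rightarrow> (nat \<Rightarrow> int) \<Rightarrow> nat \<Rightarrow> int" where
  "walk x \<xi> n = x + (\<Sum>i<n. \<xi> i)"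

text \<open>On paths that never reach y the length is an arbitrary number; the integrals below are
  guarded by finiteness of the hitting time.\<close>

definition stopped_prod :: "(int \<Rightarrow> ennreal) \<Rightarrow> int \<Rightarrow> (nat \<Rightarrow> int) \<Rightarrow> ennreal" where
  "stopped_prod w y s = (\<Prod>n<the_enat (hit_time y s). w (s n))"

lemma hit_time_0: "s 0 = y \<Longrightarrow> hit_time y s = 0"
  using hit_time_le_enat_iff[of y s 0] by (simp add: zero_enat_def[symmetric])

lemma hit_time_Suc:
  assumes "s 0 \<noteq> y"
  shows "hit_time y s = eSuc (hit_time y (\<lambda>n. s (Suc n)))"
proof -
  define a where "a = hit_time y s"
  define b where "b = hit_time y (\<lambda>n. s (Suc n))"
  have 0: "\<not> a \<le> enat 0" using assms by (simp add: a_def hit_time_le_enat_iff)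
  have ab: "a \<le> enat (Suc n) \<longleftrightarrow> b \<le> enat n" for n
  proof -
    have "(\<exists>m\<le>Suc n. s m = y) \<longleftrightarrow> (\<exists>m\<le>n. s (Suc m) = y)"
      using assms by (metis Suc_le_mono not0_implies_Suc)
    then show ?thesis by (simp add: a_def b_def hit_time_le_enat_iff)
  qed
  have "a = eSuc b"
  proof (cases b)
    case (enat k)
    then have "a \<le> enat (Suc k)" using ab[of k] by simp
    then obtain m where m: "a = enat m" "m \<le> Suc k" by (cases a) auto
    with 0 obtain j where j: "m = Suc j" by (cases m) auto
    then have "k \<le> j" using ab[of j] m enat by simp
    then show ?thesis using m j enat by (simp add: eSuc_enat)
  next
    case infinity
    then have "\<not> a \<le> enat (Suc n)" for n using ab[of n] by simp
    have "a \<noteq> enat m" for m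
      using 0 \<open>\<And>n. \<not> a \<le> enat (Suc n)\<close> by (cases m) auto
    then have "a = \<infinity>" by (cases a) auto
    then show ?thesis by (simp add: infinity)
  qed
  then show ?thesis by (simp add: a_def b_def)
qed

lemma stopped_prod_Suc:
  assumes "s 0 \<noteq> y" "hit_time y s < \<infinity>"
  shows "stopped_prod w y s = w (s 0) * stopped_prod w y (\<lambda>n. s (Suc n))"
proof -
  obtain k where "hit_time y (\<lambda>n. s (Suc n)) = enat k"
    using assms hit_time_Suc[of s y, OF assms(1)] by (cases "hit_time y (\<lambda>n. s (Suc n))") auto
  then show ?thesis
    using hit_time_Suc[of s y, OF assms(1)] by (simp add: stopped_prod_def eSuc_enat prod.lessThan_Suc_shift del: prod.lessThan_Suc)
qed

lemma measurable_stopped_prod [measurable]: "stopped_prod w y \<in> borel_measurable path_space"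
proof -
  have [measurable]: "(\<lambda>s. w (s n)) \<in> borel_measurable path_space" for n
    by (rule measurable_compose[OF measurable_path_component]) simp
  show ?thesis
    unfolding stopped_prod_def
    by (rule measurable_compose_countable[where g = "\<lambda>s. the_enat (hit_time y s)" and f = "\<lambda>k s. \<Prod>n<k. w (s n)"]) measurable
qed

text \<open>Markov property at time 1: the first increment is split off the product space and the
  remaining increments drive the shifted walk.\<close>

lemma nn_integral_srw_step:
  assumes [measurable]: "F \<in> borel_measurable path_space"
    and F: "\<And>s. s 0 = x \<Longrightarrow> F s = c * f (\<lambda>n. s (Suc n))"
    and [measurable]: "f \<in> borel_measurable path_space"
  shows "(\<integral>\<^sup>+s. F s \<partial>srw x) = c * ((\<integral>\<^sup>+s. f s \<partial>srw (x - 1)) + (\<integral>\<^sup>+s. f s \<partial>srw (x + 1))) / 2"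
proof -
  define p where "p = pmf_of_set {-1, 1 :: int}"
  interpret sequence_space "measure_pmf p" by unfold_locales
  have srw: "(\<integral>\<^sup>+s. g s \<partial>srw x) = (\<integral>\<^sup>+\<xi>. g (walk x \<xi>) \<partial>S)" if [measurable]: "g \<in> borel_measurable path_space" for g x
    unfolding srw_def p_def[symmetric] walk_def[abs_def]
    by (rule nn_integral_distr[OF measurable_walk]) (use that in simp)
  have walk [measurable]: "walk x \<in> S \<rightarrow>\<^sub>M path_space" for x
    using measurable_walk[of x p] unfolding walk_def[abs_def] .
  have cn: "(\<lambda>(a, \<xi>). case_nat a \<xi>) \<in> measure_pmf p \<Otimes>\<^sub>M S \<rightarrow>\<^sub>M S" by measurable
  have 1: "(\<lambda>\<xi>. F (walk x \<xi>)) \<in> borel_measurable S" by measurable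
  have "(\<integral>\<^sup>+s. F s \<partial>srw x) = (\<integral>\<^sup>+\<xi>. F (walk x \<xi>) \<partial>distr (measure_pmf p \<Otimes>\<^sub>M S) S (\<lambda>(a, \<xi>). case_nat a \<xi>))"
    by (simp add: srw PiM_iter)
  also have "\<dots> = (\<integral>\<^sup>+q. F (walk x (case_nat (fst q) (snd q))) \<partial>(measure_pmf p \<Otimes>\<^sub>M S))"
    by (subst nn_integral_distr[OF cn]) (use 1 in \<open>simp_all add: case_prod_beta\<close>)
  also have "\<dots> = (\<integral>\<^sup>+a. \<integral>\<^sup>+\<xi>. F (walk x (case_nat a \<xi>)) \<partial>S \<partial>measure_pmf p)"
    using measurable_compose[OF cn 1] by (subst P.nn_integral_fst[symmetric]) (auto simp: case_prod_beta)
  also have "\<dots> = (\<integral>\<^sup>+a. \<integral>\<^sup>+\<xi>. c * f (walk (x + a) \<xi>) \<partial>S \<partial>measure_pmf p)"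
  proof (intro nn_integral_cong)
    fix a \<xi>
    have "(\<lambda>n. walk x (case_nat a \<xi>) (Suc n)) = walk (x + a) \<xi>"
      by (simp add: walk_def fun_eq_iff sum.lessThan_Suc_shift del: sum.lessThan_Suc)
    moreover have "walk x (case_nat a \<xi>) 0 = x" by (simp add: walk_def)
    ultimately show "F (walk x (case_nat a \<xi>)) = c * f (walk (x + a) \<xi>)" using F by metis
  qed
  also have "\<dots> = (\<integral>\<^sup>+a. c * (\<integral>\<^sup>+s. f s \<partial>srw (x + a)) \<partial>measure_pmf p)"
    by (simp add: srw nn_integral_cmult)
  also have "\<dots> = c * ((\<integral>\<^sup>+s. f s \<partial>srw (x - 1)) + (\<integral>\<^sup>+s. f s \<partial>srw (x + 1))) / 2"
    unfolding p_def by (subst nn_integral_pmf_of_set) (auto simp: distrib_left)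
  finally show ?thesis .
qed

text \<open>First-step analysis: the integral obeys the recursion of \<open>hit_upto\<close>, and at
  the target the product is empty.\<close>

lemma nn_integral_stopped_prod_upto:
  "(\<integral>\<^sup>+s. (if hit_time y s \<le> enat N then stopped_prod w y s else 0) \<partial>srw x) = hit_upto w y N x"
proof (induction N arbitrary: x)
  have start: "AE s in srw x. s 0 = x" for x
  proof -
    have "{s \<in> space path_space. s 0 = x} \<in> sets path_space" by measurable
    then show ?thesis unfolding srw_def by (subst AE_distr_iff) (auto simp: measurable_walk)
  qed
  have target: "(\<integral>\<^sup>+s. (if hit_time y s \<le> enat N then stopped_prod w y s else 0) \<partial>srw y) = 1" for N
  proof -
    interpret prob_space "srw y" by (rule prob_space_srw)
    have "(\<integral>\<^sup>+s. (if hit_time y s \<le> enat N then stopped_prod w y s else 0) \<partial>srw y) = (\<integral>\<^sup>+s. 1 \<partial>srw y)"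
      using start[of y] by (intro nn_integral_cong_AE) (auto elim!: eventually_mono simp: hit_time_0 stopped_prod_def zero_enat_def)
    then show ?thesis using emeasure_space_1 by simp
  qed
  {
    case 0
    show ?case
    proof (cases "x = y")
      case False
      have "(\<integral>\<^sup>+s. (if hit_time y s \<le> enat 0 then stopped_prod w y s else 0) \<partial>srw x) = (\<integral>\<^sup>+s. 0 \<partial>srw x)"
        using start[of x] False
        by (intro nn_integral_cong_AE) (auto elim!: eventually_mono simp: hit_time_le_enat_iff)
      then show ?thesis using False by simp
    qed (simp add: target)
  next
    case (Suc N)
    show ?case
    proof (cases "x = y")
      case False
      have "(\<integral>\<^sup>+s. (if hit_time y s \<le> enat (Suc N) then stopped_prod w y s else 0) \<partial>srw x) =
        w x * ((\<integral>\<^sup>+s. (if hit_time y s \<le> enat N then stopped_prod w y s else 0) \<partial>srw (x - 1)) +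
          (\<integral>\<^sup>+s. (if hit_time y s \<le> enat N then stopped_prod w y s else 0) \<partial>srw (x + 1))) / 2"
      proof (rule nn_integral_srw_step)
        fix s :: "nat \<Rightarrow> int" assume s: "s 0 = x"
        with False have ht: "hit_time y s = eSuc (hit_time y (\<lambda>n. s (Suc n)))" by (intro hit_time_Suc) auto
        then have le: "hit_time y s \<le> enat (Suc N) \<longleftrightarrow> hit_time y (\<lambda>n. s (Suc n)) \<le> enat N"
          by (simp flip: eSuc_enat)
        have "hit_time y s \<le> enat (Suc N) \<Longrightarrow> hit_time y s < \<infinity>"
          by (cases "hit_time y s") auto
        then show "(if hit_time y s \<le> enat (Suc N) then stopped_prod w y s else 0) =
          w x * (if hit_time y (\<lambda>n. s (Suc n)) \<le> enat N then stopped_prod w y (\<lambda>n. s (Suc n)) else 0)"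
          using stopped_prod_Suc[of s y w] s False unfolding le[symmetric] by auto
      qed measurable
      then show ?thesis using False by (simp add: Suc)
    qed (simp add: target)
  }
qed

lemma nn_integral_stopped_prod:
  "(\<integral>\<^sup>+s. (if hit_time y s < \<infinity> then stopped_prod w y s else 0) \<partial>srw x) = hit w y x"
proof -
  have "(if hit_time y s < \<infinity> then stopped_prod w y s else 0) =
      (SUP N. if hit_time y s \<le> enat N then stopped_prod w y s else 0)" for s
  proof (cases "hit_time y s")
    case (enat k)
    show ?thesis
    proof (rule antisym)
      show "(if hit_time y s < \<infinity> then stopped_prod w y s else 0)
          \<le> (SUP N. if hit_time y s \<le> enat N then stopped_prod w y s else 0)"
        by (rule SUP_upper2[of k]) (auto simp: enat)
      show "(SUP N. if hit_time y s \<le> enat N then stopped_prod w y s else 0)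
          \<le> (if hit_time y s < \<infinity> then stopped_prod w y s else 0)"
        by (rule SUP_least) (auto simp: enat)
    qed
  next
    case infinity
    then show ?thesis by simp
  qed
  then have "(\<integral>\<^sup>+s. (if hit_time y s < \<infinity> then stopped_prod w y s else 0) \<partial>srw x) =
      (\<integral>\<^sup>+s. (SUP N. if hit_time y s \<le> enat N then stopped_prod w y s else 0) \<partial>srw x)" by simp
  also have "\<dots> = (SUP N. \<integral>\<^sup>+s. (if hit_time y s \<le> enat N then stopped_prod w y s else 0) \<partial>srw x)"
  proof (rule nn_integral_monotone_convergence_SUP)
    show "incseq (\<lambda>N s. if hit_time y s \<le> enat N then stopped_prod w y s else 0)"
      by (auto simp: incseq_def le_fun_def intro: order_trans)
  qed measurable
  finally show ?thesis by (simp add: nn_integral_stopped_prod_upto hit_def)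
qed

section \<open>From potentials to multiplicative weights\<close>

lemma exp_minus_add: "0 \<le> a \<Longrightarrow> 0 \<le> b \<Longrightarrow> exp_minus (a + b) = exp_minus a * exp_minus b"
  by (cases a; cases b) (auto simp: exp_minus_def exp_add[symmetric] ennreal_mult[symmetric])

lemma exp_minus_0: "exp_minus 0 = 1"
  by (simp add: exp_minus_def)

lemma exp_minus_le_1: "0 \<le> a \<Longrightarrow> exp_minus a \<le> 1"
  by (cases a) (auto simp: exp_minus_def ennreal_le_1)

lemma exp_minus_sum:
  assumes "\<And>i. 0 \<le> f i"
  shows "exp_minus (\<Sum>i<n. f i) = (\<Prod>i<(n::nat). exp_minus (f i))"
  by (induction n) (auto simp: exp_minus_0 exp_minus_add assms sum_nonneg)

lemma path_weight_eq:
  assumes "\<And>z. 0 \<le> V z \<omega>"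
  shows "path_weight V y \<omega> s = (if hit_time y s < \<infinity> then stopped_prod (\<lambda>z. exp_minus (V z \<omega>)) y s else 0)"
  by (simp add: path_weight_def stopped_prod_def exp_minus_sum assms)

lemma nn_integral_path_weight:
  assumes "\<And>z. 0 \<le> V z \<omega>"
  shows "(\<integral>\<^sup>+s. path_weight V y \<omega> s \<partial>srw x) = hit (\<lambda>z. exp_minus (V z \<omega>)) y x"
  unfolding path_weight_eq[of V \<omega>, OF assms] by (rule nn_integral_stopped_prod)

text \<open>Every step before the hitting time collects one factor exp (- t). On paths that miss y
  both sides vanish, so the value of \<open>the_enat\<close> at infinity is harmless.\<close>

lemma path_weight_shift:
  assumes V: "\<And>z. 0 \<le> V z \<omega>" and t: "0 \<le> t"
  shows "path_weight (\<lambda>z \<omega>. ereal t + V z \<omega>) y \<omega> s = ennreal (exp (- t * real (the_enat (hit_time y s)))) * path_weight V y \<omega> s"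
proof -
  have "exp_minus (ereal t + V z \<omega>) = ennreal (exp (- t)) * exp_minus (V z \<omega>)" for z
    using V t by (subst exp_minus_add) (auto simp: exp_minus_def)
  moreover have "0 \<le> ereal t + V z \<omega>" for z using V t by simp
  ultimately show ?thesis
    by (simp add: path_weight_eq V stopped_prod_def prod.distrib ennreal_power exp_of_nat_mult[symmetric] mult.commute)
qed

section \<open>Averaging over the environment\<close>

text \<open>Nonnegativity is imposed everywhere rather than almost surely; the general case is
  reduced to this one by passing to the positive part of V.\<close>

locale environment = prob_space M for M :: "'w measure" +
  fixes V :: "int \<Rightarrow> 'w \<Rightarrow> ereal"
  assumes indep: "indep_vars (\<lambda>_. borel) V UNIV"
    and ident: "distr M borel (V z) = distr M borel (V 0)"
    and nonneg: "0 \<le> V z \<omega>"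
    and prob_zero: "measure M {\<omega> \<in> space M. V 0 \<omega> = 0} < 1"
    and prob_pos: "0 < measure M {\<omega> \<in> space M. 0 < V 0 \<omega> \<and> V 0 \<omega> < \<infinity>}"
begin

lemma V_measurable [measurable]: "V z \<in> borel_measurable M"
  using indep unfolding indep_vars_def by auto

definition wt :: "real \<Rightarrow> int \<Rightarrow> 'w \<Rightarrow> ennreal" where
  "wt t z \<omega> = ennreal (exp (- t)) * exp_minus (V z \<omega>)"

definition \<kappa> :: "nat \<Rightarrow> real" where
  "\<kappa> k = enn2real (\<integral>\<^sup>+\<omega>. exp_minus (V 0 \<omega>) ^ k \<partial>M)"

definition q :: real where
  "q = measure M {\<omega> \<in> space M. V 0 \<omega> = 0}"

lemma wt_measurable [measurable]: "wt t z \<in> borel_measurable M"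
  unfolding wt_def by measurable

lemma exp_minus_V_le_1: "exp_minus (V z \<omega>) \<le> 1"
  by (rule exp_minus_le_1) (rule nonneg)

lemma wt_le_1: "0 \<le> t \<Longrightarrow> wt t z \<omega> \<le> 1"
  using mult_mono[of "ennreal (exp (- t))" 1 "exp_minus (V z \<omega>)" 1] exp_minus_V_le_1
  by (simp add: wt_def ennreal_le_1)

lemma wt_eq: "0 \<le> t \<Longrightarrow> wt t z \<omega> = exp_minus (ereal t + V z \<omega>)"
  unfolding wt_def by (subst exp_minus_add) (auto simp: nonneg exp_minus_def[of "ereal t"])

lemma wt_0: "wt t z \<omega> = ennreal (exp (- t)) * wt 0 z \<omega>"
  by (simp add: wt_def)

lemma \<kappa>_eq: "(\<integral>\<^sup>+\<omega>. exp_minus (V 0 \<omega>) ^ k \<partial>M) = ennreal (\<kappa> k)" and \<kappa>_le: "\<kappa> k \<le> 1"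
proof -
  have "(\<integral>\<^sup>+\<omega>. exp_minus (V 0 \<omega>) ^ k \<partial>M) \<le> (\<integral>\<^sup>+\<omega>. 1 \<partial>M)"
    using exp_minus_V_le_1 by (intro nn_integral_mono power_le_one) auto
  then have le: "(\<integral>\<^sup>+\<omega>. exp_minus (V 0 \<omega>) ^ k \<partial>M) \<le> 1" by (simp add: emeasure_space_1)
  then show "(\<integral>\<^sup>+\<omega>. exp_minus (V 0 \<omega>) ^ k \<partial>M) = ennreal (\<kappa> k)"
    by (simp add: \<kappa>_def le_less_trans[OF le])
  show "\<kappa> k \<le> 1" unfolding \<kappa>_def using le by (intro enn2real_leI) auto
qed

lemma \<kappa>_nonneg: "0 \<le> \<kappa> k"
  by (simp add: \<kappa>_def)

lemma nn_integral_wt_power: "(\<integral>\<^sup>+\<omega>. wt t z \<omega> ^ k \<partial>M) = ennreal (exp (- t * real k) * \<kappa> k)"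
proof -
  have "(\<integral>\<^sup>+\<omega>. exp_minus (V z \<omega>) ^ k \<partial>M) = (\<integral>\<^sup>+v. exp_minus v ^ k \<partial>distr M borel (V z))"
    by (subst nn_integral_distr) auto
  also have "\<dots> = (\<integral>\<^sup>+v. exp_minus v ^ k \<partial>distr M borel (V 0))" by (simp add: ident[of z])
  also have "\<dots> = ennreal (\<kappa> k)" by (subst nn_integral_distr) (auto simp: \<kappa>_eq)
  finally have "(\<integral>\<^sup>+\<omega>. wt t z \<omega> ^ k \<partial>M) = ennreal (exp (- t)) ^ k * ennreal (\<kappa> k)"
    by (simp add: wt_def power_mult_distrib nn_integral_cmult)
  also have "ennreal (exp (- t)) ^ k = ennreal (exp (- t * real k))"
    using exp_of_nat_mult[of k "- t"] by (simp add: ennreal_power mult.commute)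
  finally show ?thesis by (simp add: ennreal_mult \<kappa>_nonneg)
qed

lemma exp_minus_V_pos_iff: "0 < exp_minus (V z \<omega>) \<longleftrightarrow> V z \<omega> < \<infinity>"
  using nonneg[of z \<omega>] by (cases "V z \<omega>") (auto simp: exp_minus_def)

lemma exp_minus_V_eq_1_iff: "exp_minus (V z \<omega>) = 1 \<longleftrightarrow> V z \<omega> = 0"
  using nonneg[of z \<omega>] by (cases "V z \<omega>") (auto simp: exp_minus_def zero_ereal_def)

lemma not_AE_trivial: "\<not> (AE \<omega> in M. \<not> (0 < V 0 \<omega> \<and> V 0 \<omega> < \<infinity>))"
proof
  assume "AE \<omega> in M. \<not> (0 < V 0 \<omega> \<and> V 0 \<omega> < \<infinity>)"
  then have "measure M {\<omega> \<in> space M. 0 < V 0 \<omega> \<and> V 0 \<omega> < \<infinity>} = 0"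
    by (subst prob_eq_0) auto
  then show False using prob_pos by simp
qed

lemma \<kappa>_pos: "0 < \<kappa> k"
proof (rule ccontr)
  assume "\<not> 0 < \<kappa> k"
  then have "(\<integral>\<^sup>+\<omega>. exp_minus (V 0 \<omega>) ^ k \<partial>M) = 0" by (simp add: \<kappa>_eq ennreal_neg)
  then have "AE \<omega> in M. exp_minus (V 0 \<omega>) ^ k = 0" by (subst (asm) nn_integral_0_iff_AE) auto
  then have "AE \<omega> in M. \<not> (0 < V 0 \<omega> \<and> V 0 \<omega> < \<infinity>)"
  proof eventually_elim
    fix \<omega> assume "exp_minus (V 0 \<omega>) ^ k = 0"
    then have "exp_minus (V 0 \<omega>) = 0" by simp
    then show "\<not> (0 < V 0 \<omega> \<and> V 0 \<omega> < \<infinity>)" using exp_minus_V_pos_iff[of 0 \<omega>] by simp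
  qed
  with not_AE_trivial show False by simp
qed

lemma \<kappa>_decseq: "decseq \<kappa>"
proof (rule decseq_SucI)
  fix k
  have "ennreal (\<kappa> (Suc k)) \<le> ennreal (\<kappa> k)"
    unfolding \<kappa>_eq[symmetric] using mult_right_mono[OF exp_minus_V_le_1] by (intro nn_integral_mono) simp
  then show "\<kappa> (Suc k) \<le> \<kappa> k" using \<kappa>_nonneg by simp
qed

text \<open>The powers exp (- k V) decrease to the indicator of V = 0.\<close>

lemma \<kappa>_tendsto: "\<kappa> \<longlonglongrightarrow> q"
proof -
  have "(\<lambda>k. \<integral>\<^sup>+\<omega>. exp_minus (V 0 \<omega>) ^ k \<partial>M) \<longlonglongrightarrow> (\<integral>\<^sup>+\<omega>. indicator {\<omega> \<in> space M. V 0 \<omega> = 0} \<omega> \<partial>M)"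
  proof (rule nn_integral_dominated_convergence[where w = "\<lambda>_. 1"])
    show "AE \<omega> in M. (\<lambda>k. exp_minus (V 0 \<omega>) ^ k) \<longlonglongrightarrow> indicator {\<omega> \<in> space M. V 0 \<omega> = 0} \<omega>"
    proof (rule AE_I2)
      fix \<omega> assume "\<omega> \<in> space M"
      show "(\<lambda>k. exp_minus (V 0 \<omega>) ^ k) \<longlonglongrightarrow> indicator {\<omega> \<in> space M. V 0 \<omega> = 0} \<omega>"
      proof (cases "V 0 \<omega> = 0")
        case True
        then show ?thesis using \<open>\<omega> \<in> space M\<close> by (simp add: exp_minus_0)
      next
        case False
        define e where "e = enn2real (exp_minus (V 0 \<omega>))"
        have e: "exp_minus (V 0 \<omega>) = ennreal e" "0 \<le> e" "e \<le> 1"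
          using exp_minus_V_le_1[of 0 \<omega>] by (auto simp: e_def enn2real_leI le_less_trans[OF exp_minus_V_le_1])
        moreover have "e \<noteq> 1" using exp_minus_V_eq_1_iff[of 0 \<omega>] False e by auto
        ultimately have "(\<lambda>k. ennreal (e ^ k)) \<longlonglongrightarrow> ennreal 0"
          by (intro tendsto_ennrealI LIMSEQ_power_zero) auto
        then show ?thesis using False e by (simp add: ennreal_power)
      qed
    qed
    show "AE \<omega> in M. exp_minus (V 0 \<omega>) ^ k \<le> 1" for k
      using exp_minus_V_le_1 by (intro AE_I2 power_le_one) auto
  qed (auto simp: emeasure_space_1)
  also have "(\<integral>\<^sup>+\<omega>. indicator {\<omega> \<in> space M. V 0 \<omega> = 0} \<omega> \<partial>M) = ennreal q"
    by (simp add: q_def emeasure_eq_measure)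
  finally show ?thesis
    unfolding \<kappa>_eq using \<kappa>_nonneg by (subst (asm) tendsto_ennreal_iff) (auto simp: q_def)
qed

text \<open>Equality would make exp (- V) equal to the indicator of V = 0 almost surely, that is, V
  would take only the values 0 and infinity.\<close>

lemma q_less: "q < \<kappa> 1"
proof -
  have 1: "q \<le> \<kappa> 1" using \<kappa>_decseq \<kappa>_tendsto by (rule decseq_ge)
  have "q \<noteq> \<kappa> 1"
  proof
    assume eq: "q = \<kappa> 1"
    have ind: "(\<integral>\<^sup>+\<omega>. indicator {\<omega> \<in> space M. V 0 \<omega> = 0} \<omega> \<partial>M) = ennreal q"
      by (simp add: q_def emeasure_eq_measure)
    have "(\<integral>\<^sup>+\<omega>. exp_minus (V 0 \<omega>) - indicator {\<omega> \<in> space M. V 0 \<omega> = 0} \<omega> \<partial>M) =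
      (\<integral>\<^sup>+\<omega>. exp_minus (V 0 \<omega>) \<partial>M) - (\<integral>\<^sup>+\<omega>. indicator {\<omega> \<in> space M. V 0 \<omega> = 0} \<omega> \<partial>M)"
    proof (rule nn_integral_diff)
      show "AE \<omega> in M. indicator {\<omega> \<in> space M. V 0 \<omega> = 0} \<omega> \<le> exp_minus (V 0 \<omega>)"
        by (rule AE_I2) (auto simp: indicator_def exp_minus_0)
    qed (unfold ind, auto)
    also have "\<dots> = ennreal (\<kappa> 1) - ennreal q"
      unfolding ind using \<kappa>_eq[of 1] by simp
    also have "\<dots> = 0" by (simp add: eq)
    finally have "AE \<omega> in M. exp_minus (V 0 \<omega>) - indicator {\<omega> \<in> space M. V 0 \<omega> = 0} \<omega> = 0"
      by (subst (asm) nn_integral_0_iff_AE) auto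
    then have "AE \<omega> in M. \<not> (0 < V 0 \<omega> \<and> V 0 \<omega> < \<infinity>)"
    proof eventually_elim
      fix \<omega> assume "exp_minus (V 0 \<omega>) - indicator {\<omega> \<in> space M. V 0 \<omega> = 0} \<omega> = 0"
      then show "\<not> (0 < V 0 \<omega> \<and> V 0 \<omega> < \<infinity>)"
      proof (cases "V 0 \<omega> = 0")
        case False
        with \<open>exp_minus (V 0 \<omega>) - _ = 0\<close> have "exp_minus (V 0 \<omega>) = 0" by simp
        then show ?thesis using exp_minus_V_pos_iff[of 0 \<omega>] by simp
      qed simp
    qed
    with not_AE_trivial show False by simp
  qed
  with 1 show ?thesis by simp
qed

text \<open>This is the contraction factor of the continued fraction in \<open>gap_step\<close>; it
  is below 1 because V is not almost surely 0.\<close>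

lemma \<kappa>_2_less_1: "\<kappa> 2 < 1"
proof -
  have "\<kappa> 2 \<noteq> 1"
  proof
    assume eq: "\<kappa> 2 = 1"
    have "(\<integral>\<^sup>+\<omega>. 1 - exp_minus (V 0 \<omega>) ^ 2 \<partial>M) = (\<integral>\<^sup>+\<omega>. 1 \<partial>M) - (\<integral>\<^sup>+\<omega>. exp_minus (V 0 \<omega>) ^ 2 \<partial>M)"
      using exp_minus_V_le_1 by (intro nn_integral_diff AE_I2 power_le_one) (auto simp: \<kappa>_eq)
    also have "\<dots> = 0" by (simp add: \<kappa>_eq eq emeasure_space_1)
    finally have "AE \<omega> in M. 1 - exp_minus (V 0 \<omega>) ^ 2 = 0" by (subst (asm) nn_integral_0_iff_AE) auto
    then have "AE \<omega> in M. V 0 \<omega> = 0"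
    proof eventually_elim
      fix \<omega> assume "1 - exp_minus (V 0 \<omega>) ^ 2 = 0"
      then have "1 \<le> exp_minus (V 0 \<omega>) ^ 2" by (simp add: diff_eq_0_iff_ennreal)
      also have "\<dots> \<le> exp_minus (V 0 \<omega>) * 1"
        unfolding power2_eq_square by (intro mult_left_mono exp_minus_V_le_1) auto
      finally show "V 0 \<omega> = 0" using exp_minus_V_le_1[of 0 \<omega>] exp_minus_V_eq_1_iff[of 0 \<omega>] by simp
    qed
    then have "measure M {\<omega> \<in> space M. V 0 \<omega> = 0} = 1" by (subst prob_eq_1) auto
    with prob_zero show False by simp
  qed
  then show ?thesis using \<kappa>_le[of 2] by simp
qed

lemma sum_binomial_products: "(\<integral>\<^sup>+j. ennreal (real (a choose j) * real (b choose j)) \<partial>count_space UNIV) = ennreal (real ((a + b) choose a))"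
proof -
  have "(\<integral>\<^sup>+j. ennreal (real (a choose j) * real (b choose j)) \<partial>count_space UNIV)
      = (\<integral>\<^sup>+j. ennreal (real (a choose j) * real (b choose j)) * indicator {..a} j \<partial>count_space UNIV)"
    by (intro nn_integral_cong) (auto simp: indicator_def)
  also have "\<dots> = (\<Sum>j\<le>a. ennreal (real (a choose j) * real (b choose j)))"
    by (simp add: nn_integral_count_space_finite flip: nn_integral_count_space_indicator)
  also have "\<dots> = ennreal (\<Sum>j\<le>a. real (a choose j) * real (b choose j))" by (rule sum_ennreal) auto
  also have "(\<Sum>j\<le>a. real (a choose j) * real (b choose j)) = real (\<Sum>j\<le>a. (b choose j) * (a choose (a - j)))"
    by (simp add: binomial_symmetric[symmetric] mult.commute)
  also have "(\<Sum>j\<le>a. (b choose j) * (a choose (a - j))) = (a + b) choose a"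
    by (simp add: vandermonde add.commute)
  finally show ?thesis .
qed

text \<open>By Vandermonde, (a + b choose a) is the sum over j of (a choose j) (b choose j), and the
  moment of order 1 + a + b is the mean of a product of powers a + 1/2 and b + 1/2. Thus the kernel
  is a Gram kernel over pairs of j and environment; the square root carries half of the exponent 1
  and of the factor 1/2.\<close>

lemma psd:
  assumes t: "0 \<le> t"
  shows "psd_kernel (\<lambda>a b. ennreal (exp (- t * real (1 + a + b)) * \<kappa> (1 + a + b) * pk a b))"
proof (rule psd_kernelI[where N = "count_space UNIV \<Otimes>\<^sub>M M"
      and \<phi> = "\<lambda>(j, \<omega>) a. ennreal (real (a choose j) / 2 ^ a * enn2real (wt t 0 \<omega>) ^ a * sqrt (enn2real (wt t 0 \<omega>) / 2))"])
  show "(\<lambda>x. (case x of (j, \<omega>) \<Rightarrow> \<lambda>a. ennreal (real (a choose j) / 2 ^ a * enn2real (wt t 0 \<omega>) ^ a * sqrt (enn2real (wt t 0 \<omega>) / 2))) a)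
      \<in> borel_measurable (count_space UNIV \<Otimes>\<^sub>M M)" for a
    by (simp add: case_prod_beta) measurable
  fix a b
  let ?\<phi> = "\<lambda>j \<omega> a. ennreal (real (a choose j) / 2 ^ a * enn2real (wt t 0 \<omega>) ^ a * sqrt (enn2real (wt t 0 \<omega>) / 2))"
  have eq: "?\<phi> j \<omega> a * ?\<phi> j \<omega> b = ennreal (1 / 2 ^ (a + b + 1)) * ennreal (real (a choose j) * real (b choose j)) * wt t 0 \<omega> ^ (1 + a + b)" for j \<omega>
  proof -
    define e where "e = enn2real (wt t 0 \<omega>)"
    have e: "0 \<le> e" "wt t 0 \<omega> = ennreal e" using wt_le_1[OF t, of 0 \<omega>] by (auto simp: e_def le_less_trans)
    have "real (a choose j) / 2 ^ a * e ^ a * sqrt (e / 2) * (real (b choose j) / 2 ^ b * e ^ b * sqrt (e / 2))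
        = (real (a choose j) * real (b choose j) / (2 ^ a * 2 ^ b)) * (e ^ a * e ^ b) * (sqrt (e / 2) * sqrt (e / 2))"
    proof -
      have "x / 2 ^ a * y * S * (x' / 2 ^ b * y' * S) = (x * x' / (2 ^ a * 2 ^ b)) * (y * y') * (S * S)" for x y x' y' S :: real
        by (simp add: field_simps)
      then show ?thesis .
    qed
    also have "sqrt (e / 2) * sqrt (e / 2) = e / 2" using e by simp
    also have "(real (a choose j) * real (b choose j) / (2 ^ a * 2 ^ b)) * (e ^ a * e ^ b) * (e / 2)
        = 1 / 2 ^ (a + b + 1) * (real (a choose j) * real (b choose j)) * e ^ (1 + a + b)"
      by (simp add: power_add mult_ac)
    finally have id: "real (a choose j) / 2 ^ a * e ^ a * sqrt (e / 2) * (real (b choose j) / 2 ^ b * e ^ b * sqrt (e / 2))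
        = 1 / 2 ^ (a + b + 1) * (real (a choose j) * real (b choose j)) * e ^ (1 + a + b)" .
    have "?\<phi> j \<omega> a * ?\<phi> j \<omega> b = ennreal (real (a choose j) / 2 ^ a * e ^ a * sqrt (e / 2) * (real (b choose j) / 2 ^ b * e ^ b * sqrt (e / 2)))"
      unfolding e_def[symmetric] using e(1) by (subst ennreal_mult[symmetric]) auto
    also have "\<dots> = ennreal (1 / 2 ^ (a + b + 1)) * ennreal (real (a choose j) * real (b choose j)) * ennreal (e ^ (1 + a + b))"
      unfolding id using e(1) by (subst ennreal_mult, simp, simp)+ simp
    finally show ?thesis using e by (simp only: e(2) ennreal_power)
  qed
  have "(\<integral>\<^sup>+x. (case x of (j, \<omega>) \<Rightarrow> ?\<phi> j \<omega>) a * (case x of (j, \<omega>) \<Rightarrow> ?\<phi> j \<omega>) b \<partial>(count_space UNIV \<Otimes>\<^sub>M M))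
      = (\<integral>\<^sup>+x. (\<lambda>(j, \<omega>). ennreal (1 / 2 ^ (a + b + 1)) * ennreal (real (a choose j) * real (b choose j)) * wt t 0 \<omega> ^ (1 + a + b)) x \<partial>(count_space UNIV \<Otimes>\<^sub>M M))"
    by (rule nn_integral_cong) (simp only: split_beta eq)
  also have "\<dots> = (\<integral>\<^sup>+j. \<integral>\<^sup>+\<omega>. ennreal (1 / 2 ^ (a + b + 1)) * ennreal (real (a choose j) * real (b choose j)) * wt t 0 \<omega> ^ (1 + a + b) \<partial>M \<partial>count_space UNIV)"
    by (subst nn_integral_fst[symmetric]) auto
  also have "\<dots> = (\<integral>\<^sup>+j. ennreal (1 / 2 ^ (a + b + 1)) * ennreal (real (a choose j) * real (b choose j)) * ennreal (exp (- t * real (1 + a + b)) * \<kappa> (1 + a + b)) \<partial>count_space UNIV)"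
    by (intro nn_integral_cong) (subst nn_integral_cmult, measurable, simp only: nn_integral_wt_power)
  also have "\<dots> = ennreal (1 / 2 ^ (a + b + 1)) * ennreal (real ((a + b) choose a)) * ennreal (exp (- t * real (1 + a + b)) * \<kappa> (1 + a + b))"
    by (subst nn_integral_multc, simp, subst nn_integral_cmult, simp, simp only: sum_binomial_products)
  also have "\<dots> = ennreal (exp (- t * real (1 + a + b)) * \<kappa> (1 + a + b) * pk a b)"
  proof -
    have "ennreal A * ennreal B * ennreal C = ennreal (C * (B * A))" if "0 \<le> A" "0 \<le> B" "0 \<le> C" for A B C
      using that by (simp add: ennreal_mult mult_ac)
    from this[of "1 / 2 ^ (a + b + 1)" "real ((a + b) choose a)" "exp (- t * real (1 + a + b)) * \<kappa> (1 + a + b)"]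
    show ?thesis using \<kappa>_nonneg by (simp add: pk_def)
  qed
  finally show "ennreal (exp (- t * real (1 + a + b)) * \<kappa> (1 + a + b) * pk a b) =
    (\<integral>\<^sup>+x. (case x of (j, \<omega>) \<Rightarrow> ?\<phi> j \<omega>) a * (case x of (j, \<omega>) \<Rightarrow> ?\<phi> j \<omega>) b \<partial>(count_space UNIV \<Otimes>\<^sub>M M))" ..
qed

sublocale kernel_family \<kappa> q
  by unfold_locales (use \<kappa>_pos \<kappa>_le \<kappa>_decseq \<kappa>_tendsto q_less psd in auto)

end

lemma measurable_cross_weight_PiM [measurable]:
  "(\<lambda>w. cross_weight w z) \<in> borel_measurable (PiM UNIV (\<lambda>_. borel))"
  by (rule measurable_cross_weight) (rule measurable_component_singleton, simp)

lemma power_diff_le: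
  fixes a b :: real
  assumes "0 \<le> b" "b \<le> a" "a \<le> 1"
  shows "a ^ n \<le> b ^ n + real n * (a - b)"
proof (induction n)
  case (Suc n)
  have "a ^ Suc n \<le> a * (b ^ n + real n * (a - b))" using Suc assms by (simp add: mult_left_mono)
  also have "\<dots> = b ^ Suc n + (a - b) * b ^ n + a * (real n * (a - b))" by (simp add: algebra_simps)
  also have "\<dots> \<le> b ^ Suc n + (a - b) * 1 + 1 * (real n * (a - b))"
    using assms by (intro add_mono mult_mono power_le_one) auto
  finally show ?case by (simp add: algebra_simps)
qed simp

text \<open>Over the common denominator, which is at least 1, the difference has numerator 2 (e -
  e') + e e' (s - s').\<close>

lemma continued_fraction_diff_le:
  fixes e e' s s' t :: real
  assumes "0 \<le> e'" "e' \<le> e" "e \<le> 1" "0 \<le> s'" "s' \<le> s" "s \<le> 1" "e - e' \<le> t"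
  shows "e / (2 - e * s) - e' / (2 - e' * s') \<le> 2 * t + e\<^sup>2 * (s - s')"
proof -
  have es: "e * s \<le> 1" "e' * s' \<le> 1" using assms by (auto intro!: mult_le_one)
  define d where "d = (2 - e * s) * (2 - e' * s')"
  have d: "1 \<le> d" using mult_mono[of 1 "2 - e * s" 1 "2 - e' * s'"] es by (simp add: d_def)
  have nn: "0 \<le> 2 * (e - e') + e * e' * (s - s')" using assms by simp
  have "e / (2 - e * s) - e' / (2 - e' * s') = (2 * (e - e') + e * e' * (s - s')) / d"
    using es by (simp add: d_def field_simps)
  also have "\<dots> \<le> 2 * (e - e') + e * e' * (s - s')"
    using d nn mult_right_mono[OF d nn] by (simp add: divide_le_eq mult.commute)
  also have "\<dots> \<le> 2 * t + e\<^sup>2 * (s - s')"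
    using assms by (intro add_mono mult_right_mono) (auto simp: power2_eq_square mult_left_mono)
  finally show ?thesis .
qed

context environment begin

text \<open>The assumption \<open>cong\<close> says that F looks only at sites left of m, hence is
  independent of the weight at m.\<close>

lemma nn_integral_wt_indep:
  assumes F [measurable]: "F \<in> borel_measurable (PiM UNIV (\<lambda>_. borel))"
    and cong: "\<And>w w'. (\<And>i. i < m \<Longrightarrow> w i = w' i) \<Longrightarrow> F w = F w'"
  shows "(\<integral>\<^sup>+\<omega>. wt t m \<omega> ^ k * F (\<lambda>z. wt t z \<omega>) \<partial>M) = (\<integral>\<^sup>+\<omega>. wt t m \<omega> ^ k \<partial>M) * (\<integral>\<^sup>+\<omega>. F (\<lambda>z. wt t z \<omega>) \<partial>M)"
proof -
  \<comment> \<open>Two blocks of sites, indexed by truth values. A configuration on the left block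
    is extended by 0 to all sites, which F does not notice.\<close>
  define I where "I b = (if b then {m} else {..<m})" for b
  define Y where "Y b f = (if b then f m ^ k else F (\<lambda>z. if z < m then f z else 0))" for b and f :: "int \<Rightarrow> ennreal"
  have 1: "indep_vars (\<lambda>_. borel) (wt t) UNIV"
    unfolding wt_def[abs_def] by (rule indep_vars_compose2[OF indep]) measurable
  have 2: "indep_vars (\<lambda>b. PiM (I b) (\<lambda>_. borel)) (\<lambda>b \<omega>. restrict (\<lambda>i. wt t i \<omega>) (I b)) UNIV"
    by (rule indep_vars_restrict[OF 1]) (auto simp: disjoint_family_on_def I_def)
  have Y: "Y b \<in> borel_measurable (PiM (I b) (\<lambda>_. borel))" for b
  proof (cases b)
    case True
    have "(\<lambda>f. f m) \<in> borel_measurable (PiM {m} (\<lambda>_. borel))"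
      by (rule measurable_component_singleton) simp
    then show ?thesis using True by (simp add: Y_def[abs_def] I_def)
  next
    case False
    have "(\<lambda>f z. if z < m then f z else 0) \<in> PiM {..<m} (\<lambda>_. borel) \<rightarrow>\<^sub>M PiM UNIV (\<lambda>_. borel :: ennreal measure)"
    proof (rule measurable_PiM_single')
      fix z
      show "(\<lambda>f. if z < m then f z else 0) \<in> borel_measurable (PiM {..<m} (\<lambda>_. borel :: ennreal measure))"
        by (cases "z < m") (auto intro: measurable_component_singleton)
    qed auto
    from measurable_compose[OF this F] show ?thesis using False by (simp add: Y_def[abs_def] I_def)
  qed
  have 3: "indep_vars (\<lambda>_. borel) (\<lambda>b \<omega>. Y b (restrict (\<lambda>i. wt t i \<omega>) (I b))) UNIV"
    by (rule indep_vars_compose2[OF 2 Y])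
  have YT: "Y True (restrict (\<lambda>i. wt t i \<omega>) (I True)) = wt t m \<omega> ^ k" for \<omega>
    by (simp add: Y_def I_def)
  have YF: "Y False (restrict (\<lambda>i. wt t i \<omega>) (I False)) = F (\<lambda>z. wt t z \<omega>)" for \<omega>
    unfolding Y_def I_def by (simp, rule cong) simp
  from indep_vars_nn_integral[OF _ 3] show ?thesis
    by (simp add: UNIV_bool YT YF mult.commute)
qed

section \<open>The partition function as a kernel power\<close>

definition cw :: "real \<Rightarrow> int \<Rightarrow> 'w \<Rightarrow> ennreal" where
  "cw t z \<omega> = cross_weight (\<lambda>z. wt t z \<omega>) z"

lemma cw_measurable [measurable]: "cw t z \<in> borel_measurable M"
  unfolding cw_def by measurable

lemma cw_le_1: "0 \<le> t \<Longrightarrow> cw t z \<omega> \<le> 1"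
  unfolding cw_def by (intro cross_weight_le_1 wt_le_1)

lemma cw_mono: "0 \<le> t \<Longrightarrow> cw t z \<omega> \<le> cw 0 z \<omega>"
  unfolding cw_def wt_def by (intro cross_weight_mono mult_right_mono ennreal_leI) auto

text \<open>The boundary weight called G in the overview: it averages everything left of the origin,
  given b crossings from -1 back to 0.\<close>

definition left_weight :: "real \<Rightarrow> nat \<Rightarrow> ennreal" where
  "left_weight t b = (\<integral>\<^sup>+\<omega>. cw t (-1) \<omega> ^ b \<partial>M)"

text \<open>The additional power d closes the recursion: expanding the crossing weight at one site
  produces powers of the weight at its left neighbour. The case d = 0 is the partition function, and
  n = 0 is the boundary weight.\<close>

definition Phi :: "real \<Rightarrow> nat \<Rightarrow> nat \<Rightarrow> ennreal" where
  "Phi t n d = (\<integral>\<^sup>+\<omega>. cw t (int n - 1) \<omega> ^ d * (\<Prod>z<n. cw t (int z) \<omega>) \<partial>M)"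

text \<open>Expanding the continued fraction at the rightmost site by the negative binomial series and
  integrating out the weight there produces the kernel.\<close>

lemma Phi_Suc: assumes t: "0 \<le> t" shows "Phi t (Suc n) d = kop (K t) (Phi t n) d"
proof -
  define F where "F b w = cross_weight w (int n - 1) ^ b * (\<Prod>z<n. cross_weight w (int z))" for b w
  have F [measurable]: "F b \<in> borel_measurable (PiM UNIV (\<lambda>_. borel))" for b
    unfolding F_def by measurable
  have Fcong: "F b w = F b w'" if "\<And>i. i < int n \<Longrightarrow> w i = w' i" for b w w'
  proof -
    have "cross_weight w z = cross_weight w' z" if "z < int n" for z
      using \<open>\<And>i. i < int n \<Longrightarrow> w i = w' i\<close> that by (intro cross_weight_cong) auto
    then show ?thesis by (simp add: F_def)
  qed
  have Fm [measurable]: "(\<lambda>\<omega>. F b (\<lambda>z. wt t z \<omega>)) \<in> borel_measurable M" for b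
    unfolding F_def cw_def[symmetric] by measurable
  have FPhi: "(\<integral>\<^sup>+\<omega>. F b (\<lambda>z. wt t z \<omega>) \<partial>M) = Phi t n b" for b
    by (simp add: F_def Phi_def cw_def)
  have "cw t (int n) \<omega> ^ d * (\<Prod>z<Suc n. cw t (int z) \<omega>) =
      (\<integral>\<^sup>+b. pe d b * (wt t (int n) \<omega> ^ (1 + d + b) * F b (\<lambda>z. wt t z \<omega>)) \<partial>count_space UNIV)" for \<omega>
  proof -
    have "cw t (int n) \<omega> ^ d * (\<Prod>z<Suc n. cw t (int z) \<omega>) = cw t (int n) \<omega> ^ (d + 1) * (\<Prod>z<n. cw t (int z) \<omega>)"
      by (simp add: mult_ac)
    also have "cw t (int n) \<omega> ^ (d + 1) = (\<integral>\<^sup>+b. pe d b * (wt t (int n) \<omega> ^ (1 + d + b) * cw t (int n - 1) \<omega> ^ b) \<partial>count_space UNIV)"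
      unfolding cw_def by (rule cross_weight_power) (rule wt_le_1[OF t])
    finally show ?thesis by (simp add: nn_integral_multc[symmetric] F_def cw_def mult.assoc)
  qed
  then have "Phi t (Suc n) d = (\<integral>\<^sup>+\<omega>. \<integral>\<^sup>+b. pe d b * (wt t (int n) \<omega> ^ (1 + d + b) * F b (\<lambda>z. wt t z \<omega>)) \<partial>count_space UNIV \<partial>M)"
    by (simp add: Phi_def)
  also have "\<dots> = (\<integral>\<^sup>+b. \<integral>\<^sup>+\<omega>. pe d b * (wt t (int n) \<omega> ^ (1 + d + b) * F b (\<lambda>z. wt t z \<omega>)) \<partial>M \<partial>count_space UNIV)"
    by (rule nn_integral_count_space_swap[symmetric]) measurable
  also have "\<dots> = (\<integral>\<^sup>+b. K t d b * Phi t n b \<partial>count_space UNIV)"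
  proof (rule nn_integral_cong)
    fix b
    have "(\<integral>\<^sup>+\<omega>. pe d b * (wt t (int n) \<omega> ^ (1 + d + b) * F b (\<lambda>z. wt t z \<omega>)) \<partial>M)
        = pe d b * (\<integral>\<^sup>+\<omega>. wt t (int n) \<omega> ^ (1 + d + b) * F b (\<lambda>z. wt t z \<omega>) \<partial>M)"
      by (rule nn_integral_cmult) measurable
    also have "(\<integral>\<^sup>+\<omega>. wt t (int n) \<omega> ^ (1 + d + b) * F b (\<lambda>z. wt t z \<omega>) \<partial>M)
        = ennreal (exp (- t * real (1 + d + b)) * \<kappa> (1 + d + b)) * Phi t n b"
      unfolding nn_integral_wt_power[of t "int n", symmetric] FPhi[symmetric]
      by (rule nn_integral_wt_indep[OF F]) (rule Fcong)
    also have "pe d b * (ennreal (exp (- t * real (1 + d + b)) * \<kappa> (1 + d + b)) * Phi t n b) = K t d b * Phi t n b"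
      using \<kappa>_nonneg[of "1 + d + b"] pk_pos[of d b]
      by (subst ennreal_mult_left) (auto simp: K_def mult_ac less_imp_le)
    finally show "(\<integral>\<^sup>+\<omega>. pe d b * (wt t (int n) \<omega> ^ (1 + d + b) * F b (\<lambda>z. wt t z \<omega>)) \<partial>M) = K t d b * Phi t n b" .
  qed
  finally show ?thesis by (simp add: kop_def)
qed

lemma Phi_eq: "0 \<le> t \<Longrightarrow> Phi t n = (kop (K t) ^^ n) (left_weight t)"
proof (induction n)
  case 0
  show ?case by (simp add: fun_eq_iff Phi_def left_weight_def)
next
  case (Suc n)
  have "Phi t (Suc n) = kop (K t) (Phi t n)" using Phi_Suc[OF Suc.prems] by (simp add: fun_eq_iff)
  then show ?case using Suc by simp
qed

lemma annealed_Z_shift_eq: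
  assumes t: "0 \<le> t"
  shows "annealed_Z M (\<lambda>z \<omega>. ereal t + V z \<omega>) (int n) = (kop (K t) ^^ n) (left_weight t) 0"
proof -
  have V': "0 \<le> ereal t + V z \<omega>" for z \<omega> using t nonneg[of z \<omega>] by simp
  have "annealed_Z M (\<lambda>z \<omega>. ereal t + V z \<omega>) (int n) = (\<integral>\<^sup>+\<omega>. hit (\<lambda>z. wt t z \<omega>) (int n) 0 \<partial>M)"
    unfolding annealed_Z_def using nn_integral_path_weight[of "\<lambda>z \<omega>. ereal t + V z \<omega>", OF V']
    by (simp add: wt_eq[OF t])
  also have "\<dots> = Phi t n 0"
    unfolding Phi_def cw_def using hit_eq_prod[OF wt_le_1[OF t]] by simp
  finally show ?thesis by (simp add: Phi_eq[OF t])
qed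

lemma annealed_Z_eq: "annealed_Z M V (int n) = (kop (K 0) ^^ n) (left_weight 0) 0"
  using annealed_Z_shift_eq[of 0 n] by (simp flip: zero_ereal_def)

lemma left_weight_le_1: "0 \<le> t \<Longrightarrow> left_weight t b \<le> 1"
proof -
  assume "0 \<le> t"
  then have "left_weight t b \<le> (\<integral>\<^sup>+\<omega>. 1 \<partial>M)"
    unfolding left_weight_def by (intro nn_integral_mono power_le_one cw_le_1) auto
  then show ?thesis by (simp add: emeasure_space_1)
qed

lemma left_weight_0: "left_weight t 0 = 1"
  by (simp add: left_weight_def emeasure_space_1)

lemma left_weight_mono: "0 \<le> t \<Longrightarrow> left_weight t b \<le> left_weight 0 b"
  unfolding left_weight_def by (intro nn_integral_mono power_mono cw_mono) auto

section \<open>Dependence of the left boundary weight on the killing rate\<close>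

definition cwr :: "real \<Rightarrow> int \<Rightarrow> 'w \<Rightarrow> real" where
  "cwr t z \<omega> = enn2real (cw t z \<omega>)"

lemma cwr_measurable [measurable]: "cwr t z \<in> borel_measurable M"
  unfolding cwr_def by measurable

lemma cwr: "0 \<le> t \<Longrightarrow> cw t z \<omega> = ennreal (cwr t z \<omega>)" "0 \<le> cwr t z \<omega>" "0 \<le> t \<Longrightarrow> cwr t z \<omega> \<le> 1"
  "0 \<le> t \<Longrightarrow> cwr t z \<omega> \<le> cwr 0 z \<omega>"
proof -
  show 1: "cw t z \<omega> = ennreal (cwr t z \<omega>)" if "0 \<le> t" for t
    using le_less_trans[OF cw_le_1[OF that, of z \<omega>], of \<top>] by (simp add: cwr_def)
  show 2: "0 \<le> cwr t z \<omega>" for t by (simp add: cwr_def)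
  show "0 \<le> t \<Longrightarrow> cwr t z \<omega> \<le> 1" using cw_le_1[of t z \<omega>] by (simp add: cwr_def enn2real_leI)
  assume t: "0 \<le> t"
  have "ennreal (cwr t z \<omega>) \<le> ennreal (cwr 0 z \<omega>)"
    using cw_mono[OF t, of z \<omega>] 1[OF t] 1[of 0] by simp
  then show "cwr t z \<omega> \<le> cwr 0 z \<omega>" using 2 by simp
qed

definition gap :: "real \<Rightarrow> int \<Rightarrow> ennreal" where
  "gap t z = (\<integral>\<^sup>+\<omega>. ennreal (cwr 0 z \<omega> - cwr t z \<omega>) \<partial>M)"

lemma gap_le_1: "0 \<le> t \<Longrightarrow> gap t z \<le> 1"
proof -
  assume t: "0 \<le> t"
  have "gap t z \<le> (\<integral>\<^sup>+\<omega>. 1 \<partial>M)"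
    unfolding gap_def
  proof (rule nn_integral_mono)
    fix \<omega>
    have "cwr 0 z \<omega> - cwr t z \<omega> \<le> 1" using cwr(2)[of t z \<omega>] cwr(3)[of 0 z \<omega>] by simp
    then show "ennreal (cwr 0 z \<omega> - cwr t z \<omega>) \<le> 1" by (simp add: ennreal_le_1)
  qed
  then show ?thesis by (simp add: emeasure_space_1)
qed

text \<open>Killing changes the weight at z by at most t, and the difference inherited from z - 1 is
  multiplied by at most exp (- 2 V z), which is independent of it and has mean
  \<open>\<kappa> 2\<close>.\<close>

lemma gap_step: assumes t: "0 \<le> t" shows "gap t z \<le> ennreal (2 * t) + ennreal (\<kappa> 2) * gap t (z - 1)"
proof -
  define F where "F w = ennreal (enn2real (cross_weight w (z - 1)) - enn2real (cross_weight (\<lambda>i. ennreal (exp (- t)) * w i) (z - 1)))" for w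
  have [measurable]: "(\<lambda>w. cross_weight (\<lambda>i. ennreal (exp (- t)) * w i) (z - 1)) \<in> borel_measurable (PiM UNIV (\<lambda>_. borel))"
  proof (rule measurable_cross_weight)
    fix i
    have [measurable]: "(\<lambda>w. w i) \<in> borel_measurable (PiM UNIV (\<lambda>_. borel :: ennreal measure))"
      by (rule measurable_component_singleton) simp
    show "(\<lambda>w. ennreal (exp (- t)) * w i) \<in> borel_measurable (PiM UNIV (\<lambda>_. borel))" by measurable
  qed
  have F [measurable]: "F \<in> borel_measurable (PiM UNIV (\<lambda>_. borel))" unfolding F_def by measurable
  have Fcong: "F w = F w'" if "\<And>i. i < z \<Longrightarrow> w i = w' i" for w w'
  proof -
    have "cross_weight w (z - 1) = cross_weight w' (z - 1)"
      using that by (intro cross_weight_cong) auto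
    moreover have "cross_weight (\<lambda>i. ennreal (exp (- t)) * w i) (z - 1) = cross_weight (\<lambda>i. ennreal (exp (- t)) * w' i) (z - 1)"
      using that by (intro cross_weight_cong) auto
    ultimately show ?thesis by (simp add: F_def)
  qed
  have Fwt: "F (\<lambda>z. wt 0 z \<omega>) = ennreal (cwr 0 (z - 1) \<omega> - cwr t (z - 1) \<omega>)" for \<omega>
    by (simp add: F_def cwr_def cw_def wt_0[of t])
  have Fm [measurable]: "(\<lambda>\<omega>. F (\<lambda>z. wt 0 z \<omega>)) \<in> borel_measurable M" unfolding Fwt by measurable
  have "gap t z \<le> (\<integral>\<^sup>+\<omega>. ennreal (2 * t) + wt 0 z \<omega> ^ 2 * F (\<lambda>z. wt 0 z \<omega>) \<partial>M)"
    unfolding gap_def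
  proof (rule nn_integral_mono)
    fix \<omega>
    define e where "e = enn2real (wt 0 z \<omega>)"
    define e' where "e' = enn2real (wt t z \<omega>)"
    have e: "wt 0 z \<omega> = ennreal e" "0 \<le> e" "e \<le> 1"
      using wt_le_1[of 0 z \<omega>] le_less_trans[OF wt_le_1[of 0 z \<omega>], of \<top>] by (auto simp: e_def enn2real_leI)
    have "ennreal (exp (- t)) * ennreal e = ennreal (exp (- t) * e)" using e(2) by (simp add: ennreal_mult)
    then have e': "e' = exp (- t) * e" using e(2) by (simp add: e'_def wt_0[of t] e(1))
    have "exp (- t) \<le> 1" using t by simp
    then have e'_le: "e' \<le> e" using e(2) by (simp add: e' mult_left_le_one_le)
    have "(1 - exp (- t)) * e \<le> t * 1"
      using exp_ge_add_one_self[of "- t"] e \<open>exp (- t) \<le> 1\<close> t by (intro mult_mono) auto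
    then have diff: "e - e' \<le> t" by (simp add: e' algebra_simps)
    have r0: "cwr 0 z \<omega> = e / (2 - e * cwr 0 (z - 1) \<omega>)"
      using cross_weight_real(1)[of "\<lambda>z. wt 0 z \<omega>" z] wt_le_1[of 0] by (simp add: cwr_def cw_def e_def)
    have rt: "cwr t z \<omega> = e' / (2 - e' * cwr t (z - 1) \<omega>)"
      using cross_weight_real(1)[of "\<lambda>z. wt t z \<omega>" z] wt_le_1[OF t] by (simp add: cwr_def cw_def e'_def)
    have "cwr 0 z \<omega> - cwr t z \<omega> \<le> 2 * t + e\<^sup>2 * (cwr 0 (z - 1) \<omega> - cwr t (z - 1) \<omega>)"
      unfolding r0 rt using e e' e'_le diff cwr t by (intro continued_fraction_diff_le) auto
    then have "ennreal (cwr 0 z \<omega> - cwr t z \<omega>) \<le> ennreal (2 * t + e\<^sup>2 * (cwr 0 (z - 1) \<omega> - cwr t (z - 1) \<omega>))"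
      by (rule ennreal_leI)
    also have "\<dots> = ennreal (2 * t) + wt 0 z \<omega> ^ 2 * F (\<lambda>z. wt 0 z \<omega>)"
      unfolding Fwt e(1) using t e(2) cwr(4)[OF t, of "z - 1" \<omega>]
      by (subst ennreal_plus) (auto simp: ennreal_power ennreal_mult)
    finally show "ennreal (cwr 0 z \<omega> - cwr t z \<omega>) \<le> ennreal (2 * t) + wt 0 z \<omega> ^ 2 * F (\<lambda>z. wt 0 z \<omega>)" .
  qed
  also have "\<dots> = ennreal (2 * t) + (\<integral>\<^sup>+\<omega>. wt 0 z \<omega> ^ 2 * F (\<lambda>z. wt 0 z \<omega>) \<partial>M)"
    by (subst nn_integral_add) (auto simp: emeasure_space_1)
  also have "(\<integral>\<^sup>+\<omega>. wt 0 z \<omega> ^ 2 * F (\<lambda>z. wt 0 z \<omega>) \<partial>M) = ennreal (\<kappa> 2) * gap t (z - 1)"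
  proof -
    have "(\<integral>\<^sup>+\<omega>. wt 0 z \<omega> ^ 2 * F (\<lambda>z. wt 0 z \<omega>) \<partial>M) = (\<integral>\<^sup>+\<omega>. wt 0 z \<omega> ^ 2 \<partial>M) * (\<integral>\<^sup>+\<omega>. F (\<lambda>z. wt 0 z \<omega>) \<partial>M)"
      by (rule nn_integral_wt_indep[OF F]) (rule Fcong)
    then show ?thesis by (simp add: nn_integral_wt_power Fwt gap_def)
  qed
  finally show ?thesis .
qed

text \<open>The bound is the fixed point of c -> 2 t + \<open>\<kappa> 2\<close> c. Running
  \<open>gap_step\<close> for n sites to the left from the trivial bound 1 leaves an error
  \<open>\<kappa> 2 ^ n\<close>.\<close>

lemma gap_le: assumes t: "0 \<le> t" shows "gap t z \<le> ennreal (2 / (1 - \<kappa> 2) * t)"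
proof -
  define c where "c = 2 / (1 - \<kappa> 2) * t"
  have k: "0 \<le> \<kappa> 2" "\<kappa> 2 < 1" using \<kappa>_nonneg \<kappa>_2_less_1 by auto
  have c: "0 \<le> c" "2 * t + \<kappa> 2 * c = c" using k t by (auto simp: c_def field_simps)
  have *: "gap t z \<le> ennreal (c + \<kappa> 2 ^ n)" for n z
  proof (induction n arbitrary: z)
    case 0
    have "gap t z \<le> ennreal 1" using gap_le_1[OF t] by simp
    also have "\<dots> \<le> ennreal (c + \<kappa> 2 ^ 0)" using c by (intro ennreal_leI) simp
    finally show ?case .
  next
    case (Suc n)
    have "gap t z \<le> ennreal (2 * t) + ennreal (\<kappa> 2) * ennreal (c + \<kappa> 2 ^ n)"
      by (rule order_trans[OF gap_step[OF t]]) (intro add_left_mono mult_left_mono Suc, simp)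
    also have "\<dots> = ennreal (2 * t + \<kappa> 2 * (c + \<kappa> 2 ^ n))"
      using t k c by (simp add: ennreal_mult[symmetric] del: ennreal_plus flip: ennreal_plus)
    also have "2 * t + \<kappa> 2 * (c + \<kappa> 2 ^ n) = c + \<kappa> 2 ^ Suc n" using c(2) by (simp add: algebra_simps)
    finally show ?case .
  qed
  have "(\<lambda>n. ennreal (c + \<kappa> 2 ^ n)) \<longlonglongrightarrow> ennreal (c + 0)"
    using k by (intro tendsto_ennrealI tendsto_add tendsto_const LIMSEQ_realpow_zero)
  then show ?thesis unfolding c_def[symmetric] using * by (intro LIMSEQ_le_const) auto
qed

text \<open>A Lipschitz bound in t that is linear in b, as \<open>first_moment_bounds\<close>
  demands of its family G.\<close>

lemma left_weight_diff: assumes t: "0 \<le> t" shows "left_weight 0 b \<le> left_weight t b + ennreal (2 / (1 - \<kappa> 2) * t * real b)"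
proof -
  have "left_weight 0 b \<le> (\<integral>\<^sup>+\<omega>. cw t (-1) \<omega> ^ b + ennreal (real b) * ennreal (cwr 0 (-1) \<omega> - cwr t (-1) \<omega>) \<partial>M)"
    unfolding left_weight_def
  proof (rule nn_integral_mono)
    fix \<omega>
    have "cwr 0 (-1) \<omega> ^ b \<le> cwr t (-1) \<omega> ^ b + real b * (cwr 0 (-1) \<omega> - cwr t (-1) \<omega>)"
      using cwr t by (intro power_diff_le) auto
    then have "ennreal (cwr 0 (-1) \<omega> ^ b) \<le> ennreal (cwr t (-1) \<omega> ^ b + real b * (cwr 0 (-1) \<omega> - cwr t (-1) \<omega>))"
      by (rule ennreal_leI)
    also have "\<dots> = cw t (-1) \<omega> ^ b + ennreal (real b) * ennreal (cwr 0 (-1) \<omega> - cwr t (-1) \<omega>)"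
      using cwr(2)[of t "-1" \<omega>] cwr(4)[OF t, of "-1" \<omega>]
      by (subst ennreal_plus) (auto simp: cwr(1)[OF t] ennreal_power ennreal_mult)
    finally show "cw 0 (-1) \<omega> ^ b \<le> cw t (-1) \<omega> ^ b + ennreal (real b) * ennreal (cwr 0 (-1) \<omega> - cwr t (-1) \<omega>)"
      using cwr(2)[of 0 "-1" \<omega>] by (simp add: cwr(1)[of 0] ennreal_power)
  qed
  also have "\<dots> = left_weight t b + ennreal (real b) * gap t (-1)"
    by (simp add: nn_integral_add nn_integral_cmult left_weight_def gap_def)
  also have "\<dots> \<le> left_weight t b + ennreal (real b) * ennreal (2 / (1 - \<kappa> 2) * t)"
    by (intro add_left_mono mult_left_mono gap_le t) auto
  also have "ennreal (real b) * ennreal (2 / (1 - \<kappa> 2) * t) = ennreal (2 / (1 - \<kappa> 2) * t * real b)"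
    using t \<kappa>_2_less_1 by (subst ennreal_mult[symmetric]) (auto simp: mult_ac)
  finally show ?thesis .
qed

end

section \<open>Speed\<close>

lemma measurable_path_weight_srw:
  assumes "\<And>z. V z \<in> borel_measurable M"
  shows "(\<lambda>p. path_weight V y (fst p) (snd p)) \<in> borel_measurable (M \<Otimes>\<^sub>M srw 0)"
  using measurable_path_weight[of V M y, OF assms]
  by (simp add: case_prod_beta cong: measurable_cong_sets sets_pair_measure_cong)

lemma annealed_Z_eq_pair:
  assumes "\<And>z. V z \<in> borel_measurable M"
  shows "annealed_Z M V y = (\<integral>\<^sup>+p. path_weight V y (fst p) (snd p) \<partial>(M \<Otimes>\<^sub>M srw 0))"
proof -
  interpret srw: prob_space "srw 0" by (rule prob_space_srw)
  show ?thesis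
    unfolding annealed_Z_def
    using srw.nn_integral_fst[OF measurable_path_weight_srw[of V M y, OF assms]] by simp
qed

lemma measurable_hit_time_snd [measurable]:
  "(\<lambda>p. hit_time y (snd p)) \<in> M \<Otimes>\<^sub>M srw 0 \<rightarrow>\<^sub>M count_space UNIV"
proof -
  have "snd \<in> M \<Otimes>\<^sub>M srw 0 \<rightarrow>\<^sub>M path_space"
    using measurable_snd[of M "srw 0"] by (simp cong: measurable_cong_sets)
  then show ?thesis by (rule measurable_compose) (rule measurable_hit_time)
qed

lemma annealed_expected_hit_time_eq:
  assumes V: "\<And>z. V z \<in> borel_measurable M"
  shows "annealed_expected_hit_time M V y =
    (\<integral>\<^sup>+p. path_weight V y (fst p) (snd p) * ennreal_of_enat (hit_time y (snd p)) \<partial>(M \<Otimes>\<^sub>M srw 0)) / annealed_Z M V y"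
proof -
  have snd: "snd \<in> M \<Otimes>\<^sub>M srw 0 \<rightarrow>\<^sub>M path_space"
    using measurable_snd[of M "srw 0"] by (simp cong: measurable_cong_sets)
  have ht: "(\<lambda>s. ennreal_of_enat (hit_time y s)) \<in> borel_measurable path_space"
    by (rule measurable_compose[OF measurable_hit_time]) simp
  have ht': "(\<lambda>p. ennreal_of_enat (hit_time y (snd p))) \<in> borel_measurable (M \<Otimes>\<^sub>M srw 0)"
    by (rule measurable_compose[OF snd ht])
  note pw [measurable] = measurable_path_weight_srw[of V M y, OF V]
  have "annealed_expected_hit_time M V y = (\<integral>\<^sup>+p. ennreal_of_enat (hit_time y (snd p))
      \<partial>density (M \<Otimes>\<^sub>M srw 0) (\<lambda>(\<omega>, s). path_weight V y \<omega> s / annealed_Z M V y))"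
    unfolding annealed_expected_hit_time_def annealed_measure_def
    by (rule nn_integral_distr) (use snd ht in \<open>simp_all cong: measurable_cong_sets\<close>)
  also have "\<dots> = (\<integral>\<^sup>+p. path_weight V y (fst p) (snd p) / annealed_Z M V y * ennreal_of_enat (hit_time y (snd p)) \<partial>(M \<Otimes>\<^sub>M srw 0))"
    unfolding case_prod_beta by (rule nn_integral_density) (use ht' in \<open>auto intro!: borel_measurable_divide_ennreal\<close>)
  also have "\<dots> = (\<integral>\<^sup>+p. path_weight V y (fst p) (snd p) * ennreal_of_enat (hit_time y (snd p)) / annealed_Z M V y \<partial>(M \<Otimes>\<^sub>M srw 0))"
    by (intro nn_integral_cong) (simp add: divide_ennreal_def mult_ac)
  also have "\<dots> = (\<integral>\<^sup>+p. path_weight V y (fst p) (snd p) * ennreal_of_enat (hit_time y (snd p)) \<partial>(M \<Otimes>\<^sub>M srw 0)) / annealed_Z M V y"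
    using ht' by (intro nn_integral_divide) measurable
  finally show ?thesis .
qed

lemma tendsto_floor_ratio:
  fixes f :: "nat \<Rightarrow> real"
  assumes f: "(\<lambda>n. f n / real n) \<longlonglongrightarrow> l"
  shows "((\<lambda>r. f (nat \<lfloor>r\<rfloor>) / r) \<longlongrightarrow> l) (at_top :: real filter)"
proof -
  have n: "filterlim (\<lambda>r::real. nat \<lfloor>r\<rfloor>) sequentially at_top"
    by (rule filterlim_compose[OF filterlim_nat_sequentially filterlim_floor_sequentially])
  have 1: "((\<lambda>r::real. f (nat \<lfloor>r\<rfloor>) / real (nat \<lfloor>r\<rfloor>)) \<longlongrightarrow> l) at_top"
    by (rule filterlim_compose[OF f n])
  have 2: "((\<lambda>r::real. real (nat \<lfloor>r\<rfloor>) / r) \<longlongrightarrow> 1) at_top"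
  proof (rule tendsto_sandwich)
    show "\<forall>\<^sub>F r in at_top. 1 - 1 / r \<le> real (nat \<lfloor>r\<rfloor>) / (r::real)"
      using eventually_ge_at_top[of 1]
    proof eventually_elim
      fix r :: real assume "1 \<le> r"
      then have "(r - 1) / r \<le> real (nat \<lfloor>r\<rfloor>) / r" by (intro divide_right_mono) linarith+
      then show "1 - 1 / r \<le> real (nat \<lfloor>r\<rfloor>) / r" using \<open>1 \<le> r\<close> by (simp add: diff_divide_distrib)
    qed
    show "\<forall>\<^sub>F r in at_top. real (nat \<lfloor>r\<rfloor>) / (r::real) \<le> 1"
      using eventually_ge_at_top[of 1] by eventually_elim (simp add: divide_le_eq)
    have "((\<lambda>r::real. 1 - 1 / r) \<longlongrightarrow> 1 - 0) at_top"
      by (intro tendsto_diff tendsto_const tendsto_divide_0[OF tendsto_const filterlim_at_top_imp_at_infinity[OF filterlim_ident]])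
    then show "((\<lambda>r::real. 1 - 1 / r) \<longlongrightarrow> 1) at_top" by simp
  qed auto
  have "((\<lambda>r::real. f (nat \<lfloor>r\<rfloor>) / real (nat \<lfloor>r\<rfloor>) * (real (nat \<lfloor>r\<rfloor>) / r)) \<longlongrightarrow> l * 1) at_top"
    by (intro tendsto_mult 1 2)
  moreover have "\<forall>\<^sub>F r in at_top. f (nat \<lfloor>r\<rfloor>) / real (nat \<lfloor>r\<rfloor>) * (real (nat \<lfloor>r\<rfloor>) / r) = f (nat \<lfloor>r\<rfloor>) / (r::real)"
    using eventually_ge_at_top[of 1]
  proof eventually_elim
    fix r :: real assume "1 \<le> r"
    then have "\<lfloor>r\<rfloor> \<noteq> 0" by linarith
    then show "f (nat \<lfloor>r\<rfloor>) / real (nat \<lfloor>r\<rfloor>) * (real (nat \<lfloor>r\<rfloor>) / r) = f (nat \<lfloor>r\<rfloor>) / r"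
      using \<open>1 \<le> r\<close> by simp
  qed
  ultimately show ?thesis by (auto intro: Lim_transform_eventually)
qed

context environment begin

section \<open>The mean hitting time as a derivative in the killing rate\<close>

definition time_moment :: "int \<Rightarrow> ennreal" where
  "time_moment y = (\<integral>\<^sup>+p. path_weight V y (fst p) (snd p) * ennreal_of_enat (hit_time y (snd p)) \<partial>(M \<Otimes>\<^sub>M srw 0))"

lemma path_weight_measurable [measurable]:
  "(\<lambda>p. path_weight V y (fst p) (snd p)) \<in> borel_measurable (M \<Otimes>\<^sub>M srw 0)"
  by (rule measurable_path_weight_srw) (rule V_measurable)

lemma annealed_Z_shift_eq_pair:
  assumes t: "0 \<le> t"
  shows "annealed_Z M (\<lambda>z \<omega>. ereal t + V z \<omega>) y =
    (\<integral>\<^sup>+p. ennreal (exp (- t * real (the_enat (hit_time y (snd p))))) * path_weight V y (fst p) (snd p) \<partial>(M \<Otimes>\<^sub>M srw 0))"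
proof -
  have "annealed_Z M (\<lambda>z \<omega>. ereal t + V z \<omega>) y = (\<integral>\<^sup>+p. path_weight (\<lambda>z \<omega>. ereal t + V z \<omega>) y (fst p) (snd p) \<partial>(M \<Otimes>\<^sub>M srw 0))"
    by (rule annealed_Z_eq_pair) measurable
  then show ?thesis using path_weight_shift[of V _ t y, OF nonneg t] by simp
qed

lemma path_weight_infinite: "\<not> hit_time y s < \<infinity> \<Longrightarrow> path_weight V y \<omega> s = 0"
  by (simp add: path_weight_def)

text \<open>Integrates the pointwise bound 1 <= exp (- t k) + t k at the hitting time k.\<close>

lemma annealed_Z_le_time_moment:
  assumes t: "0 \<le> t"
  shows "annealed_Z M V y \<le> annealed_Z M (\<lambda>z \<omega>. ereal t + V z \<omega>) y + ennreal t * time_moment y"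
proof -
  let ?k = "\<lambda>p. real (the_enat (hit_time y (snd p)))"
  let ?w = "\<lambda>p. path_weight V y (fst p) (snd p)"
  have "annealed_Z M V y = (\<integral>\<^sup>+p. ?w p \<partial>(M \<Otimes>\<^sub>M srw 0))" by (rule annealed_Z_eq_pair) measurable
  also have "\<dots> \<le> (\<integral>\<^sup>+p. ennreal (exp (- t * ?k p)) * ?w p + ennreal t * (?w p * ennreal_of_enat (hit_time y (snd p))) \<partial>(M \<Otimes>\<^sub>M srw 0))"
  proof (rule nn_integral_mono)
    fix p :: "'w \<times> (nat \<Rightarrow> int)"
    show "?w p \<le> ennreal (exp (- t * ?k p)) * ?w p + ennreal t * (?w p * ennreal_of_enat (hit_time y (snd p)))"
    proof (cases "hit_time y (snd p)")
      case (enat k)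
      have "1 \<le> exp (- t * real k) + t * real k" using exp_ge_add_one_self[of "- t * real k"] by simp
      then have "ennreal 1 * ?w p \<le> ennreal (exp (- t * real k) + t * real k) * ?w p"
        by (intro mult_right_mono ennreal_leI) auto
      also have "\<dots> = ennreal (exp (- t * real k)) * ?w p + ennreal t * (?w p * ennreal (real k))"
        using t by (simp add: ennreal_mult algebra_simps)
      finally show ?thesis by (simp add: enat ennreal_of_nat_eq_real_of_nat)
    qed (simp add: path_weight_infinite)
  qed
  also have "\<dots> = annealed_Z M (\<lambda>z \<omega>. ereal t + V z \<omega>) y + ennreal t * time_moment y"
    unfolding annealed_Z_shift_eq_pair[OF t] time_moment_def
    by (subst nn_integral_add) (auto simp: nn_integral_cmult)
  finally show ?thesis .
qed

text \<open>The quotients (1 - exp (- t k)) / t have mean at most A and tend to k as t -> 0; Fatou's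
  lemma gives the bound without assuming the moment to be finite.\<close>

lemma time_moment_le:
  assumes t0: "0 < t0"
    and A: "\<And>t. 0 < t \<Longrightarrow> t \<le> t0 \<Longrightarrow> annealed_Z M V y \<le> annealed_Z M (\<lambda>z \<omega>. ereal t + V z \<omega>) y + ennreal t * A"
    and fin: "\<And>t. 0 \<le> t \<Longrightarrow> annealed_Z M (\<lambda>z \<omega>. ereal t + V z \<omega>) y < \<top>"
  shows "time_moment y \<le> A"
proof -
  let ?k = "\<lambda>p. real (the_enat (hit_time y (snd p)))"
  let ?w = "\<lambda>p. path_weight V y (fst p) (snd p)"
  define D where "D t p = ennreal ((1 - exp (- t * ?k p)) / t) * ?w p" for t and p :: "'w \<times> (nat \<Rightarrow> int)"
  have D [measurable]: "D t \<in> borel_measurable (M \<Otimes>\<^sub>M srw 0)" for t unfolding D_def by measurable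
  have DA: "(\<integral>\<^sup>+p. D t p \<partial>(M \<Otimes>\<^sub>M srw 0)) \<le> A" if t: "0 < t" "t \<le> t0" for t
  proof -
    have "annealed_Z M V y = (\<integral>\<^sup>+p. ?w p \<partial>(M \<Otimes>\<^sub>M srw 0))" by (rule annealed_Z_eq_pair) measurable
    also have "\<dots> = (\<integral>\<^sup>+p. ennreal (exp (- t * ?k p)) * ?w p + ennreal t * D t p \<partial>(M \<Otimes>\<^sub>M srw 0))"
    proof (rule nn_integral_cong)
      fix p :: "'w \<times> (nat \<Rightarrow> int)"
      have e1: "exp (- t * ?k p) \<le> 1" using t by simp
      have "ennreal (exp (- t * ?k p)) * ?w p + ennreal t * D t p = (ennreal (exp (- t * ?k p)) + ennreal t * ennreal ((1 - exp (- t * ?k p)) / t)) * ?w p"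
        by (simp add: D_def distrib_right mult.assoc)
      also have "ennreal (exp (- t * ?k p)) + ennreal t * ennreal ((1 - exp (- t * ?k p)) / t) = ennreal (exp (- t * ?k p) + t * ((1 - exp (- t * ?k p)) / t))"
      proof -
        have sum: "ennreal a + ennreal t * ennreal b = ennreal (a + t * b)" if "0 \<le> a" "0 \<le> b" for a b
          using that t by (simp add: ennreal_mult)
        show ?thesis by (rule sum) (use t e1 in auto)
      qed
      also have "\<dots> = 1" using t by simp
      finally show "?w p = ennreal (exp (- t * ?k p)) * ?w p + ennreal t * D t p" by simp
    qed
    also have "\<dots> = annealed_Z M (\<lambda>z \<omega>. ereal t + V z \<omega>) y + ennreal t * (\<integral>\<^sup>+p. D t p \<partial>(M \<Otimes>\<^sub>M srw 0))"
      using t unfolding annealed_Z_shift_eq_pair[OF less_imp_le[OF t(1)]]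
      by (subst nn_integral_add) (auto simp: nn_integral_cmult)
    finally have "annealed_Z M (\<lambda>z \<omega>. ereal t + V z \<omega>) y + ennreal t * (\<integral>\<^sup>+p. D t p \<partial>(M \<Otimes>\<^sub>M srw 0))
        \<le> annealed_Z M (\<lambda>z \<omega>. ereal t + V z \<omega>) y + ennreal t * A"
      using A[OF t] by simp
    then have "ennreal t * (\<integral>\<^sup>+p. D t p \<partial>(M \<Otimes>\<^sub>M srw 0)) \<le> ennreal t * A"
      using fin[of t] t by (auto simp: ennreal_add_left_cancel_le)
    then show ?thesis using t by (subst (asm) ennreal_mult_le_mult_iff) auto
  qed
  define S where "S i = t0 / real (Suc i)" for i
  have S: "0 < S i" "S i \<le> t0" for i using t0 by (auto simp: S_def field_simps)
  have S0: "S \<longlonglongrightarrow> 0" unfolding S_def using LIMSEQ_Suc[OF lim_const_over_n[of t0]] by simp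
  have wfin: "?w p < \<top>" for p :: "'w \<times> (nat \<Rightarrow> int)"
  proof -
    have "?w p \<le> 1"
      using path_weight_eq[of V "fst p" y "snd p", OF nonneg] exp_minus_V_le_1
      by (auto simp: stopped_prod_def intro!: prod_le_1)
    then show ?thesis by (rule le_less_trans) simp
  qed
  have lim: "(\<lambda>i. D (S i) p) \<longlonglongrightarrow> ?w p * ennreal_of_enat (hit_time y (snd p))" for p :: "'w \<times> (nat \<Rightarrow> int)"
  proof (cases "hit_time y (snd p)")
    case (enat k)
    have "(\<lambda>i. ennreal ((1 - exp (- S i * real k)) / S i) * ?w p) \<longlonglongrightarrow> ennreal (real k) * ?w p"
      by (intro tendsto_mult_ennreal tendsto_ennrealI one_minus_exp_quotient_tendsto S S0 tendsto_const wfin) simp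
    then show ?thesis by (simp add: D_def enat ennreal_of_nat_eq_real_of_nat mult.commute)
  qed (simp add: D_def path_weight_infinite)
  have "time_moment y = (\<integral>\<^sup>+p. liminf (\<lambda>i. D (S i) p) \<partial>(M \<Otimes>\<^sub>M srw 0))"
    unfolding time_moment_def by (intro nn_integral_cong) (rule lim_imp_Liminf[OF _ lim, symmetric], simp)
  also have "\<dots> \<le> liminf (\<lambda>i. \<integral>\<^sup>+p. D (S i) p \<partial>(M \<Otimes>\<^sub>M srw 0))" by (rule nn_integral_liminf) measurable
  also have "\<dots> \<le> liminf (\<lambda>i. A)" by (intro Liminf_mono always_eventually allI DA S)
  also have "\<dots> = A" by (intro lim_imp_Liminf tendsto_const) simp
  finally show ?thesis .
qed

lemma speed:
  "\<exists>v::real. 0 < v \<and> v < 1 \<and>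
    (\<lambda>n. annealed_expected_hit_time M V (int n) / ennreal (real n)) \<longlonglongrightarrow> ennreal (1 / v) \<and>
    ((\<lambda>t::real. lyapunov M (\<lambda>z \<omega>. ereal t + V z \<omega>)) has_real_derivative 1 / v) (at_right 0)"
proof -
  obtain s \<rho> t0 M' N where "kernel_gap \<kappa> q s \<rho> t0 M' N" using ex_kernel_gap by blast
  then interpret kg: kernel_gap \<kappa> q s \<rho> t0 M' N .
  \<comment> \<open>The time per site is one net step to the right plus two steps for each of
    \<open>mean\<close> down-steps across a bond; positivity of \<open>mean\<close> makes v <
    1.\<close>
  define v where "v = 1 / (1 + 2 * kg.mean)"
  have v: "0 < v" "v < 1" "1 / v = 1 + 2 * kg.mean"
    using kg.mean_pos by (auto simp: v_def)
  have t0: "0 < t0" by (rule kg.t0)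
  have Z0: "annealed_Z M V (int n) = (kop (K 0) ^^ n) (left_weight 0) 0" for n by (rule annealed_Z_eq)
  have Zt: "annealed_Z M (\<lambda>z \<omega>. ereal t + V z \<omega>) (int n) = (kop (K t) ^^ n) (left_weight t) 0" if "0 \<le> t" for t n
    using that by (rule annealed_Z_shift_eq)
  define c where "c = 2 / (1 - \<kappa> 2)"
  have c: "0 \<le> c" using \<kappa>_2_less_1 by (simp add: c_def)
  \<comment> \<open>Together with \<open>H2\<close> this characterises the time moment as the least
    admissible constant, the form in which it is compared with \<open>first_moment\<close>.\<close>
  have H1: "(kop (K 0) ^^ n) (left_weight 0) 0 \<le> (kop (K t) ^^ n) (left_weight t) 0 + ennreal t * time_moment (int n)"
    if "0 < t" for t n
    using annealed_Z_le_time_moment[of t "int n"] that by (simp add: Z0 Zt)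
  have H2: "time_moment (int n) \<le> A"
    if *: "\<And>t. 0 < t \<Longrightarrow> t \<le> t0 \<Longrightarrow> (kop (K 0) ^^ n) (left_weight 0) 0 \<le> (kop (K t) ^^ n) (left_weight t) 0 + ennreal t * A" for n A
  proof (rule time_moment_le[OF t0])
    show "annealed_Z M V (int n) \<le> annealed_Z M (\<lambda>z \<omega>. ereal t + V z \<omega>) (int n) + ennreal t * A" if "0 < t" "t \<le> t0" for t
      using *[of t] that by (simp add: Z0 Zt)
    show "annealed_Z M (\<lambda>z \<omega>. ereal t + V z \<omega>) (int n) < \<top>" if "0 \<le> t" for t
      using kop_K_le_const[where f = "left_weight t" and c = 1 and n = n and a = 0, OF that left_weight_le_1[OF that]] that by (auto simp: Zt intro: le_less_trans)
  qed
  have bounds: "kg.first_moment (left_weight 0) n \<le> time_moment (int n)"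
    "time_moment (int n) \<le> kg.first_moment (left_weight 0) n + ennreal c * ip (x 0 n) (\<lambda>a. ennreal (real a))" for n
  proof -
    have diff: "left_weight 0 a \<le> left_weight t a + ennreal (c * t * real a)" if "0 < t" for t a
      using left_weight_diff[of t a] that by (simp add: c_def)
    show "kg.first_moment (left_weight 0) n \<le> time_moment (int n)"
      by (rule kg.first_moment_bounds(1)[where c = c and G = left_weight])
        (use left_weight_le_1 left_weight_mono diff c H1 H2 in auto)
    show "time_moment (int n) \<le> kg.first_moment (left_weight 0) n + ennreal c * ip (x 0 n) (\<lambda>a. ennreal (real a))"
      by (rule kg.first_moment_bounds(2)[where c = c and G = left_weight])
        (use left_weight_le_1 left_weight_mono diff c H1 H2 in auto)
  qed
  have "(\<lambda>n. time_moment (int n) / (kop (K 0) ^^ n) (left_weight 0) 0 / ennreal (real n)) \<longlonglongrightarrow> ennreal (1 + 2 * kg.mean)"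
    by (rule kg.mean_time_tendsto[where c = c]) (use left_weight_le_1 left_weight_0 c bounds in auto)
  moreover have "annealed_expected_hit_time M V (int n) = time_moment (int n) / (kop (K 0) ^^ n) (left_weight 0) 0" for n
    unfolding Z0[symmetric] time_moment_def by (rule annealed_expected_hit_time_eq) measurable
  ultimately have 1: "(\<lambda>n. annealed_expected_hit_time M V (int n) / ennreal (real n)) \<longlonglongrightarrow> ennreal (1 / v)"
    by (simp add: v(3))
  have ly: "lyapunov M (\<lambda>z \<omega>. ereal t + V z \<omega>) = - ln (r t)" if t: "0 \<le> t" "t \<le> t0" for t
  proof -
    define f where "f n = ln (enn2real (annealed_Z M (\<lambda>z \<omega>. ereal t + V z \<omega>) (int n)))" for n
    have "(\<lambda>n. f n / real n) \<longlonglongrightarrow> ln (r t)"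
      unfolding f_def Zt[OF t(1)]
      by (rule kg.ln_Z_tendsto[OF t]) (use t left_weight_le_1 left_weight_0 in auto)
    from tendsto_floor_ratio[OF this]
    have "((\<lambda>r. ln (enn2real (annealed_Z M (\<lambda>z \<omega>. ereal t + V z \<omega>) \<lfloor>r\<rfloor>)) / r) \<longlongrightarrow> ln (r t)) at_top"
    proof (rule Lim_transform_eventually)
      show "\<forall>\<^sub>F ra in at_top. f (nat \<lfloor>ra\<rfloor>) / ra = ln (enn2real (annealed_Z M (\<lambda>z \<omega>. ereal t + V z \<omega>) \<lfloor>ra\<rfloor>)) / ra"
        using eventually_ge_at_top[of 0] by eventually_elim (simp add: f_def)
    qed
    then show ?thesis unfolding lyapunov_def by (simp add: tendsto_Lim)
  qed
  have "((\<lambda>t. lyapunov M (\<lambda>z \<omega>. ereal t + V z \<omega>)) has_real_derivative 1 + 2 * kg.mean) (at_right 0)"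
    unfolding has_field_derivative_iff
  proof (rule Lim_transform_eventually)
    show "((\<lambda>t. (- ln (r t) - - ln (r 0)) / (t - 0)) \<longlongrightarrow> 1 + 2 * kg.mean) (at_right 0)"
      using kg.ln_r_has_derivative unfolding has_field_derivative_iff .
    \<comment> \<open>The exponent is identified as - ln (r t) only for rates in [0, t0], which
      covers a right neighbourhood of 0 and the base point.\<close>
    have "\<forall>\<^sub>F t in at_right 0. t \<in> {0<..<t0}" using t0 by (rule eventually_at_right_real)
    then show "\<forall>\<^sub>F t in at_right 0. (- ln (r t) - - ln (r 0)) / (t - 0) =
        (lyapunov M (\<lambda>z \<omega>. ereal t + V z \<omega>) - lyapunov M (\<lambda>z \<omega>. ereal 0 + V z \<omega>)) / (t - 0)"
    proof eventually_elim
      fix t assume "t \<in> {0<..<t0}"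
      then have "lyapunov M (\<lambda>z \<omega>. ereal t + V z \<omega>) = - ln (r t)" by (intro ly) auto
      moreover have "lyapunov M (\<lambda>z \<omega>. ereal 0 + V z \<omega>) = - ln (r 0)" by (rule ly) (use t0 in auto)
      ultimately show "(- ln (r t) - - ln (r 0)) / (t - 0) =
        (lyapunov M (\<lambda>z \<omega>. ereal t + V z \<omega>) - lyapunov M (\<lambda>z \<omega>. ereal 0 + V z \<omega>)) / (t - 0)"
        by (simp only:)
    qed
  qed
  with 1 v show ?thesis by (intro exI[of _ v]) auto
qed

end

theorem theorem1p2:
  fixes M :: "'w measure" and V :: "int \<Rightarrow> 'w \<Rightarrow> ereal"
  assumes "prob_space M"
    and "prob_space.indep_vars M (\<lambda>_. borel) V UNIV"
    and "\<And>z. distr M borel (V z) = distr M borel (V 0)"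
    and "AE \<omega> in M. 0 \<le> V 0 \<omega>"
    and "measure M {\<omega> \<in> space M. V 0 \<omega> = 0} < 1"
    and "essinf M (V 0) = 0"
    and "measure M {\<omega> \<in> space M. 0 < V 0 \<omega> \<and> V 0 \<omega> < \<infinity>} > 0"
  shows "\<exists>v::real. 0 < v \<and> v < 1 \<and>
    ((\<lambda>y::int. annealed_expected_hit_time M V y / ennreal (real_of_int y))
       \<longlongrightarrow> ennreal (1 / v)) at_top \<and>
    ((\<lambda>t::real. lyapunov M (\<lambda>z \<omega>. ereal t + V z \<omega>)) has_real_derivative 1 / v) (at_right 0)"
proof -
  interpret prob_space M by (rule assms(1))
  \<comment> \<open>The positive part agrees with V at all sites off one null set, as there are
    countably many sites, and is nonnegative everywhere as \<open>environment\<close>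
    requires.\<close>
  define V' where "V' z \<omega> = max 0 (V z \<omega>)" for z \<omega>
  have [measurable]: "V z \<in> borel_measurable M" for z
    using assms(2) unfolding indep_vars_def by auto
  have [measurable]: "V' z \<in> borel_measurable M" for z unfolding V'_def by measurable
  have "AE \<omega> in M. 0 \<le> V z \<omega>" for z
  proof -
    have "AE x in distr M borel (V 0). 0 \<le> x" using assms(4) by (subst AE_distr_iff) auto
    then have "AE x in distr M borel (V z). 0 \<le> x" by (simp only: assms(3)[of z])
    then show ?thesis by (subst (asm) AE_distr_iff) auto
  qed
  then have "AE \<omega> in M. \<forall>z. 0 \<le> V z \<omega>" by (simp add: AE_all_countable)
  then have eq: "AE \<omega> in M. \<forall>z. V z \<omega> = V' z \<omega>" by eventually_elim (simp add: V'_def)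
  have eq0: "AE \<omega> in M. V 0 \<omega> = V' 0 \<omega>" using eq by eventually_elim simp
  have pw: "path_weight W y \<omega> s = path_weight W' y \<omega> s" if "\<forall>z. W z \<omega> = W' z \<omega>" for W W' :: "int \<Rightarrow> 'w \<Rightarrow> ereal" and y \<omega> s
    using that by (simp add: path_weight_def)
  have Z: "annealed_Z M (\<lambda>z \<omega>. ereal t + V z \<omega>) y = annealed_Z M (\<lambda>z \<omega>. ereal t + V' z \<omega>) y" for t y
    unfolding annealed_Z_def
    by (rule nn_integral_cong_AE, use eq in eventually_elim) (intro nn_integral_cong pw, simp)
  have Z0: "annealed_Z M V y = annealed_Z M V' y" for y
    using Z[of 0 y] by (simp flip: zero_ereal_def)
  have T: "annealed_expected_hit_time M V y = annealed_expected_hit_time M V' y" for y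
  proof -
    interpret srw: prob_space "srw 0" by (rule prob_space_srw)
    \<comment> \<open>In the iterated integral the exceptional null set concerns the environment
      alone.\<close>
    have iter: "(\<integral>\<^sup>+p. path_weight W y (fst p) (snd p) * ennreal_of_enat (hit_time y (snd p)) \<partial>(M \<Otimes>\<^sub>M srw 0)) =
      (\<integral>\<^sup>+\<omega>. \<integral>\<^sup>+s. path_weight W y \<omega> s * ennreal_of_enat (hit_time y s) \<partial>srw 0 \<partial>M)"
      if "\<And>z. W z \<in> borel_measurable M" for W :: "int \<Rightarrow> 'w \<Rightarrow> ereal"
    proof -
      have "(\<lambda>p. path_weight W y (fst p) (snd p) * ennreal_of_enat (hit_time y (snd p))) \<in> borel_measurable (M \<Otimes>\<^sub>M srw 0)"
        using measurable_path_weight_srw[of W M y, OF that]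
        by (intro borel_measurable_times_ennreal measurable_compose[OF measurable_hit_time_snd]) auto
      from srw.nn_integral_fst[OF this] show ?thesis by simp
    qed
    have "(\<integral>\<^sup>+\<omega>. \<integral>\<^sup>+s. path_weight V y \<omega> s * ennreal_of_enat (hit_time y s) \<partial>srw 0 \<partial>M) =
        (\<integral>\<^sup>+\<omega>. \<integral>\<^sup>+s. path_weight V' y \<omega> s * ennreal_of_enat (hit_time y s) \<partial>srw 0 \<partial>M)"
      by (rule nn_integral_cong_AE, use eq in eventually_elim)
        (intro nn_integral_cong arg_cong2[where f = "(*)"] pw refl, simp)
    then show ?thesis
      by (simp add: annealed_expected_hit_time_eq iter Z0)
  qed
  interpret environment M V'
  proof
    show "indep_vars (\<lambda>_. borel) V' UNIV"
      unfolding V'_def[abs_def] by (rule indep_vars_compose2[OF assms(2)]) measurable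
    show "distr M borel (V' z) = distr M borel (V' 0)" for z
    proof -
      have "distr M borel (V' z) = distr (distr M borel (V z)) borel (max 0)" for z
        by (subst distr_distr) (auto simp: V'_def[abs_def] comp_def)
      then show ?thesis by (simp only: assms(3)[of z])
    qed
    show "0 \<le> V' z \<omega>" for z \<omega> by (simp add: V'_def)
    have "measure M {\<omega> \<in> space M. V' 0 \<omega> = 0} = measure M {\<omega> \<in> space M. V 0 \<omega> = 0}"
      using eq0 by (intro finite_measure_eq_AE) (auto elim: eventually_mono)
    with assms(5) show "measure M {\<omega> \<in> space M. V' 0 \<omega> = 0} < 1" by simp
    have "measure M {\<omega> \<in> space M. 0 < V' 0 \<omega> \<and> V' 0 \<omega> < \<infinity>} = measure M {\<omega> \<in> space M. 0 < V 0 \<omega> \<and> V 0 \<omega> < \<infinity>}"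
      using eq0 by (intro finite_measure_eq_AE) (auto elim: eventually_mono)
    with assms(7) show "0 < measure M {\<omega> \<in> space M. 0 < V' 0 \<omega> \<and> V' 0 \<omega> < \<infinity>}" by simp
  qed
  obtain v where v: "0 < v" "v < 1"
    "(\<lambda>n. annealed_expected_hit_time M V' (int n) / ennreal (real n)) \<longlonglongrightarrow> ennreal (1 / v)"
    "((\<lambda>t::real. lyapunov M (\<lambda>z \<omega>. ereal t + V' z \<omega>)) has_real_derivative 1 / v) (at_right 0)"
    using speed by blast
  have "((\<lambda>y::int. annealed_expected_hit_time M V (int (nat y)) / ennreal (real (nat y))) \<longlongrightarrow> ennreal (1 / v)) at_top"
    unfolding T using v(3) filterlim_nat_sequentially by (rule filterlim_compose)
  then have 1: "((\<lambda>y::int. annealed_expected_hit_time M V y / ennreal (real_of_int y)) \<longlongrightarrow> ennreal (1 / v)) at_top"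
  proof (rule Lim_transform_eventually)
    show "\<forall>\<^sub>F y in at_top. annealed_expected_hit_time M V (int (nat y)) / ennreal (real (nat y)) =
        annealed_expected_hit_time M V y / ennreal (real_of_int y)"
      using eventually_ge_at_top[of 0] by eventually_elim simp
  qed
  have "lyapunov M (\<lambda>z \<omega>. ereal t + V z \<omega>) = lyapunov M (\<lambda>z \<omega>. ereal t + V' z \<omega>)" for t
    by (simp add: lyapunov_def Z)
  with v 1 show ?thesis by (intro exI[of _ v]) simp
qed

end
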